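(* Let $R=\mathrm{GR}(p^d,r)$ be the Galois ring of characteristic $p^d$ with residue field of order $p^r$, where $p>2$ is a prime, and let $K\le R^\times$. Then the cyclotomic scheme $\mathrm{Cyc}(K,R)$ is normal exactly in one of the following cases: (1) $d=1$ and either $(p,r)=(3,1)$ or $K\ne R^\times$; (2) $d>1$ and $K$ does not contain the group $1+p^{d-1}R$.
   Context: All rings have an identity. $\mathrm{GR}(p^d,r)$ denotes the (unique up to isomorphism) Galois ring of characteristic $p^d$ whose residue field has $p^r$ elements; it is a finite local commutative ring with maximal ideal $pR$. For a subgroup $K$ of $R^\times$, the cyclotomic scheme $\mathrm{Cyc}(K,R)$ is the pair $(R,\mathrm{Rel}(K,R))$, where $\mathrm{Rel}(K,R)$ is the set of binary relations $\{(x,y)\in R\times R:\ y-x\in sK\}$, $s\in R$. Its automorphism group $\mathrm{Aut}(\mathcal C)$ is the group of permutations $f$ of $R$ with $S^f=S$ for every $S\in\mathrm{Rel}(K,R)$. $\mathrm{A\Gamma L}_1(R)$ is the group of permutations $x\mapsto ax^\sigma+b$ with $a\in R^\times$, $b\in R$, $\sigma\in\mathrm{Aut}(R)$; the scheme is normal if $\mathrm{Aut}(\mathcal C)\le\mathrm{A\Gamma L}_1(R)$. *)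

theory Defs
  imports "HOL-Algebra.Algebra"
begin

definition has_char :: "('a, 'b) ring_scheme \<Rightarrow> nat \<Rightarrow> bool" where
  "has_char R n \<longleftrightarrow> 0 < n \<and> add_pow R (n) \<one>\<^bsub>R\<^esub> = \<zero>\<^bsub>R\<^esub>
      \<and> (\<forall>m. 0 < m \<and> m < n \<longrightarrow> add_pow R (m) \<one>\<^bsub>R\<^esub> \<noteq> \<zero>\<^bsub>R\<^esub>)"

definition scaled_ring :: "('a, 'b) ring_scheme \<Rightarrow> 'a \<Rightarrow> 'a set" where
  "scaled_ring R c = (\<lambda>x. c \<otimes>\<^bsub>R\<^esub> x) ` carrier R"

(* R is (isomorphic to) the Galois ring GR(p^d, r): a finite commutative local ring of
   characteristic p^d whose unique maximal ideal is pR, with residue field R/pR of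
   order p^r. *)
definition galois_ring :: "('a, 'b) ring_scheme \<Rightarrow> nat \<Rightarrow> nat \<Rightarrow> nat \<Rightarrow> bool" where
  "galois_ring R p d r \<longleftrightarrow> cring R \<and> finite (carrier R) \<and> Factorial_Ring.prime p \<and> 1 \<le> d \<and> 1 \<le> r
     \<and> has_char R (p ^ d)
     \<and> (\<forall>I. maximalideal I R \<longleftrightarrow> I = scaled_ring R (add_pow R (p) \<one>\<^bsub>R\<^esub>))
     \<and> card (carrier (R Quot scaled_ring R (add_pow R (p) \<one>\<^bsub>R\<^esub>))) = p ^ r"

definition cyc_rel :: "('a, 'b) ring_scheme \<Rightarrow> 'a set \<Rightarrow> 'a \<Rightarrow> ('a \<times> 'a) set" where
  "cyc_rel R K s = {(x, y). x \<in> carrier R \<and> y \<in> carrier R \<and>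
       y \<ominus>\<^bsub>R\<^esub> x \<in> (\<lambda>k. s \<otimes>\<^bsub>R\<^esub> k) ` K}"

definition cyc_rels :: "('a, 'b) ring_scheme \<Rightarrow> 'a set \<Rightarrow> ('a \<times> 'a) set set" where
  "cyc_rels R K = cyc_rel R K ` carrier R"

definition cyc_aut :: "('a, 'b) ring_scheme \<Rightarrow> 'a set \<Rightarrow> ('a \<Rightarrow> 'a) set" where
  "cyc_aut R K = {f. bij_betw f (carrier R) (carrier R) \<and>
       (\<forall>S \<in> cyc_rels R K. (\<lambda>(x, y). (f x, f y)) ` S = S)}"

definition AGammaL1 :: "('a, 'b) ring_scheme \<Rightarrow> ('a \<Rightarrow> 'a) set" where
  "AGammaL1 R = {f. \<exists>a \<in> Units R. \<exists>b \<in> carrier R. \<exists>\<sigma> \<in> ring_iso R R.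
       \<forall>x \<in> carrier R. f x = a \<otimes>\<^bsub>R\<^esub> \<sigma> x \<oplus>\<^bsub>R\<^esub> b}"

definition cyc_normal :: "('a, 'b) ring_scheme \<Rightarrow> 'a set \<Rightarrow> bool" where
  "cyc_normal R K \<longleftrightarrow> (\<forall>f \<in> cyc_aut R K. f \<in> AGammaL1 R)"

end

(* McConnel's theorem settles d = 1: binomial expansion of (f x - f y)^n = (x - y)^n over the
   field, with Lucas' theorem controlling which binomial coefficients survive, bounds the base-p
   digits of the exponents occurring in the powers of f and forces f to be a Frobenius power.

   For d > 1 let H be the additive group of all z with 1 + p^(d-1) z in K.  An automorphism f fixing
   0 and 1 acts on the top layer p^(d-1) R by maps adjoint, modulo H, to a |-> 1 / (f y - f (y - 1/a));
   as H is proper these are additive on the residue field, and a Hua-type argument makes the residue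
   map of f a field automorphism.  An automorphism that also induces the identity on the residue field
   is the identity: if it is the identity modulo p^j, the error term E satisfies
   (E y - E x) / (y - x) in H, and a function on the residue field with this property is affine.
   Applying this rigidity to (f (f^-1 z + b) - f b) / (f (1 + b) - f b) and to
   f (t f^-1 z) / f t, for t in K, shows that f is additive and satisfies f (t x) = f t f x.
   Replacing K by {u. u^(q-1) : K}, q = p^r, does not change H but puts the Teichmueller units into K,
   and these generate R as a ring. *)
theory Submission
  imports Defs "HOL-Number_Theory.Cong"
begin

section \<open>Base-p digits and the theorem of Lucas\<close>

text \<open>For d > 1 the residues of K may fill the whole multiplicative group of the residue
  field, so McConnel's theorem gives no hold on the residue map. The usable information sits at the
  opposite end, in the layer 1 + p^(d-1) R, and a proper H is what makes it usable: an element all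
  of whose multiples lie in H is zero modulo p, so relations known only modulo H become exact in the
  residue field. Odd p enters as room: digits up to (p-1)/2 add without carry, a digit 2 exists, p
  divides (p choose 2) so that p-th powers move layers upward faithfully, and 2 is invertible in the
  Hua-type argument. The pair (3,1) is exceptional because a permutation of three points fixing 0
  and 1 is trivial. The negative cases rest on explicit permutations: swapping 1 and -1 in a field
  with more than three elements, and adding p^(d-1) on the ideal pR only.\<close>

definition dig :: "nat \<Rightarrow> nat \<Rightarrow> nat \<Rightarrow> nat" where
  "dig p k i = k div p ^ i mod p"

lemma dig_0: "dig p k 0 = k mod p"
  by (simp add: dig_def)

lemma dig_Suc: "dig p k (Suc i) = dig p (k div p) i"
  by (simp add: dig_def div_mult2_eq)

lemma dig_zero [simp]: "dig p 0 i = 0"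
  by (simp add: dig_def)

lemma dig_less: "0 < p \<Longrightarrow> dig p k i < p"
  by (simp add: dig_def)

lemma dig_beyond: "k < p ^ r \<Longrightarrow> r \<le> i \<Longrightarrow> dig p k i = 0"
proof (cases "p = 0")
  case False
  assume "k < p ^ r" "r \<le> i"
  with False have "k < p ^ i"
    by (meson less_le_trans not_gr_zero power_increasing less_one not_le)
  then show ?thesis by (simp add: dig_def)
qed (auto simp: dig_def power_0_left split: if_splits)

lemma digit_expansion:
  assumes "k < p ^ r"
  shows "k = (\<Sum>i<r. dig p k i * p ^ i)"
  using assms
proof (induction r arbitrary: k)
  case (Suc r)
  have "k div p < p ^ r" using Suc.prems by (simp add: less_mult_imp_div_less mult.commute)
  from Suc.IH[OF this] have "k div p = (\<Sum>i<r. dig p k (Suc i) * p ^ i)" by (simp add: dig_Suc)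
  moreover have "(\<Sum>i<Suc r. dig p k i * p ^ i) = k mod p + p * (\<Sum>i<r. dig p k (Suc i) * p ^ i)"
    unfolding sum.lessThan_Suc_shift by (simp add: dig_0 sum_distrib_left mult_ac)
  ultimately show ?case by (metis mod_mult_div_eq)
qed simp

lemma dig_eqI:
  assumes "1 < p" "\<And>i. dig p k i = dig p l i"
  shows "k = l"
proof -
  obtain r where "k < p ^ r" "l < p ^ r"
  proof
    have *: "n < p ^ (k + l)" if "n \<le> k + l" for n
      using power_gt_expt[of p "k + l"] that assms(1) by linarith
    show "k < p ^ (k + l)" "l < p ^ (k + l)" by (auto intro: *)
  qed
  then show ?thesis by (metis (no_types, lifting) assms(2) digit_expansion sum.cong)
qed

text \<open>Cutting k off at p^r changes no digit, and digits determine the number; hence k is its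
  own remainder modulo p^r.\<close>

lemma dig_less_power:
  assumes "1 < p" "\<And>i. r \<le> i \<Longrightarrow> dig p k i = 0"
  shows "k < p ^ r"
proof -
  have "dig p k i = dig p (k mod p ^ r) i" for i
  proof (cases "r \<le> i")
    case True
    then show ?thesis using assms dig_beyond[of "k mod p ^ r" p r i] by simp
  next
    case False
    then obtain t where t: "r = i + Suc t" using less_imp_Suc_add by (metis add_Suc_right not_le)
    have "k mod p ^ r = k mod p ^ i + p ^ i * (k div p ^ i mod p ^ Suc t)"
      unfolding t power_add by (metis add.commute mod_mult2_eq)
    then have "k mod p ^ r div p ^ i = k div p ^ i mod p ^ Suc t"
      using assms(1) by simp
    then show ?thesis by (simp add: dig_def mod_mult2_eq)
  qed
  then have "k = k mod p ^ r" by (rule dig_eqI[OF assms(1)])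
  then show ?thesis using assms(1) by (metis gr0I less_zeroE mod_less_divisor power_eq_0_iff)
qed

lemma dig_add:
  assumes "0 < p" "\<And>i. dig p k i + dig p l i < p"
  shows "dig p (k + l) i = dig p k i + dig p l i"
  using assms(2)
proof (induction i arbitrary: k l)
  case 0
  from 0[of 0] have "(k mod p + l mod p) mod p = k mod p + l mod p" unfolding dig_0 by (rule mod_less)
  then show ?case unfolding dig_0 mod_add_eq .
next
  case (Suc i)
  from Suc.prems[of 0] have "(k + l) div p = k div p + l div p"
    using div_add1_eq[of k l p] by (simp add: dig_0)
  moreover have "dig p (k div p) j + dig p (l div p) j < p" for j
    using Suc.prems[of "Suc j"] by (simp add: dig_Suc)
  ultimately show ?case using Suc.IH[of "k div p" "l div p"] by (simp add: dig_Suc)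
qed

lemma dig_sum:
  assumes "0 < p" "\<And>i. i < r \<Longrightarrow> m i < p"
  shows "dig p (\<Sum>i<r. m i * p ^ i) j = (if j < r then m j else 0)"
  using assms(2)
proof (induction r arbitrary: m j)
  case (Suc r)
  have eq: "(\<Sum>i<Suc r. m i * p ^ i) = m 0 + p * (\<Sum>i<r. m (Suc i) * p ^ i)"
    unfolding sum.lessThan_Suc_shift by (simp add: sum_distrib_left mult_ac)
  show ?case
  proof (cases j)
    case 0
    then show ?thesis unfolding eq using Suc.prems[of 0] by (simp add: dig_0)
  next
    case (Suc j')
    have "(m 0 + p * (\<Sum>i<r. m (Suc i) * p ^ i)) div p = (\<Sum>i<r. m (Suc i) * p ^ i)"
      using Suc.prems[of 0] assms(1) by simp
    then show ?thesis unfolding eq Suc dig_Suc using Suc.IH[of "\<lambda>i. m (Suc i)" j'] Suc.prems by simp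
  qed
qed simp

lemma dig_power:
  assumes "1 < p"
  shows "dig p (p ^ i) j = (if j = i then 1 else 0)"
proof -
  have "p ^ i = (\<Sum>l<Suc i. (if l = i then 1 else 0) * p ^ l)" by (simp add: sum.delta if_distrib cong: if_cong)
  then show ?thesis using dig_sum[of p "Suc i" "\<lambda>l. if l = i then 1 else 0" j] assms by auto
qed

text \<open>All r digits of p^r - 1 equal p - 1, so the subtraction never borrows.\<close>

lemma dig_complement:
  assumes "1 < p" "a < p ^ r" "i < r"
  shows "dig p (p ^ r - 1 - a) i = p - 1 - dig p a i"
proof -
  let ?b = "\<Sum>i<r. (p - 1 - dig p a i) * p ^ i"
  have "a + ?b = (\<Sum>i<r. dig p a i * p ^ i) + ?b" using digit_expansion[OF assms(2)] by simp
  also have "\<dots> = (\<Sum>i<r. (p - 1) * p ^ i)"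
    unfolding sum.distrib[symmetric] distrib_right[symmetric]
    using dig_less[of p a] assms(1) by (intro sum.cong refl) (metis One_nat_def Suc_pred add_diff_inverse_nat less_Suc_eq_le not_le zero_less_one less_trans)
  also have "\<dots> = p ^ r - 1"
  proof (induction r)
    case (Suc r)
    have "p ^ r \<ge> 1" using assms(1) by simp
    then show ?case using Suc assms(1) by (simp add: diff_mult_distrib)
  qed simp
  finally have "p ^ r - 1 - a = ?b" by simp
  then show ?thesis using dig_sum[of p r "\<lambda>i. p - 1 - dig p a i" i] assms by simp
qed

text \<open>The digitwise order of Lucas' theorem: it decides which binomial coefficients are
  nonzero modulo p.\<close>

definition dominated :: "nat \<Rightarrow> nat \<Rightarrow> nat \<Rightarrow> bool" where
  "dominated p k n \<longleftrightarrow> (\<forall>i. dig p k i \<le> dig p n i)"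

lemma dominated_rec:
  "dominated p k n \<longleftrightarrow> k mod p \<le> n mod p \<and> dominated p (k div p) (n div p)"
  unfolding dominated_def by (metis dig_0 dig_Suc not0_implies_Suc)

text \<open>Coefficient form of (1 + X)^(p+m) = (1 + X^p) (1 + X)^m modulo p: in Vandermonde's sum
  only j = 0 and j = p survive.\<close>

lemma choose_prime_add_cong:
  fixes p :: nat
  assumes p: "Factorial_Ring.prime p"
  shows "[p + m choose k = (m choose k) + (if p \<le> k then m choose (k - p) else 0)] (mod p)"
proof -
  have p0: "0 < p" using p by (simp add: prime_gt_0_nat)
  define g where "g j = (p choose j) * (m choose (k - j))" for j
  have z: "[g j = 0] (mod p)" if "j \<noteq> 0" "j \<noteq> p" for j
  proof (cases "j < p")
    case True
    then have "p dvd (p choose j)" using that p by (intro dvd_choose_prime) auto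
    then show ?thesis by (simp add: g_def cong_0_iff)
  qed (use that in \<open>auto simp: g_def binomial_eq_0\<close>)
  have "p + m choose k = (\<Sum>j\<le>k. g j)" by (simp add: g_def vandermonde)
  also have "[(\<Sum>j\<le>k. g j) = (\<Sum>j\<le>k. if j = 0 then m choose k else if j = p then m choose (k - p) else 0)] (mod p)"
    by (intro cong_sum) (use z in \<open>auto simp: g_def\<close>)
  also have "(\<Sum>j\<le>k. if j = 0 then m choose k else if j = p then m choose (k - p) else 0) =
      (\<Sum>j\<le>k. (if j = 0 then m choose k else 0) + (if j = p then m choose (k - p) else 0))"
    using p0 by (intro sum.cong) auto
  also have "\<dots> = (m choose k) + (if p \<le> k then m choose (k - p) else 0)"
    by (simp add: sum.distrib)
  finally show ?thesis .
qed

text \<open>Raising the upper argument by p acts on the leading parts n and k by Pascal's rule and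
  leaves the last digits alone, so induction on n applies.\<close>

lemma lucas_step:
  fixes p :: nat
  assumes p: "Factorial_Ring.prime p" and "b < p" "l < p"
  shows "[p * n + b choose (p * k + l) = (n choose k) * (b choose l)] (mod p)"
proof (induction n arbitrary: k)
  case 0
  then show ?case using assms by (cases k) (auto simp: binomial_eq_0)
next
  case (Suc n)
  have "[p * Suc n + b choose (p * k + l) = ((p * n + b) choose (p * k + l)) +
      (if p \<le> p * k + l then (p * n + b) choose (p * k + l - p) else 0)] (mod p)"
    using choose_prime_add_cong[OF p, of "p * n + b" "p * k + l"] by (simp add: add.assoc)
  also have "[((p * n + b) choose (p * k + l)) +
      (if p \<le> p * k + l then (p * n + b) choose (p * k + l - p) else 0) = (Suc n choose k) * (b choose l)] (mod p)"
  proof (cases k)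
    case 0
    then show ?thesis using Suc.IH[of 0] assms by simp
  next
    case (Suc k')
    then have "p * k + l - p = p * k' + l" by simp
    then show ?thesis using cong_add[OF Suc.IH[of k] Suc.IH[of k']] \<open>k = Suc k'\<close> by (simp add: distrib_right add.assoc) (simp add: add.commute)
  qed
  finally show ?case .
qed

text \<open>Modulo p the coefficient factors over the digits. For two single digits it is zero when
  the lower one is larger, and otherwise prime to p because it divides the factorial of a number
  below p.\<close>

lemma prime_dvd_choose_iff:
  fixes p :: nat
  assumes p: "Factorial_Ring.prime p"
  shows "p dvd (n choose k) \<longleftrightarrow> \<not> dominated p k n"
proof (induction n arbitrary: k rule: less_induct)
  case (less n)
  have p1: "1 < p" using p by (rule prime_gt_1_nat)
  show ?case
  proof (cases "n = 0")
    case True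
    have "dominated p k 0 \<longleftrightarrow> k = 0" unfolding dominated_def
      using dig_eqI[OF p1, of k 0] by auto
    then show ?thesis using True p1 by (cases k) auto
  next
    case False
    then have lt: "n div p < n" using p1 by simp
    have b: "p dvd ((n mod p) choose (k mod p)) \<longleftrightarrow> n mod p < k mod p"
    proof (cases "k mod p \<le> n mod p")
      case True
      have "\<not> p dvd fact (n mod p)" using p p1 by (simp add: prime_dvd_fact_iff not_le)
      moreover have "((n mod p) choose (k mod p)) dvd fact (n mod p)"
        using binomial_fact_lemma[OF True] by (metis dvd_triv_right)
      ultimately show ?thesis using True dvd_trans leD by blast
    qed (simp add: binomial_eq_0)
    have "[n choose k = ((n div p) choose (k div p)) * ((n mod p) choose (k mod p))] (mod p)"
      using lucas_step[OF p, of "n mod p" "k mod p" "n div p" "k div p"] p1 by simp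
    then have "p dvd (n choose k) \<longleftrightarrow> p dvd ((n div p) choose (k div p)) * ((n mod p) choose (k mod p))"
      by (rule cong_dvd_iff)
    then show ?thesis using less.IH[OF lt, of "k div p"] b p
      by (subst dominated_rec) (auto simp: prime_dvd_mult_iff)
  qed
qed

text \<open>The induction step on exponents: one power of p is peeled off at a nonzero digit, where
  no borrow can occur.\<close>

lemma dig_decrement:
  assumes p: "1 < p" and pos: "0 < dig p k i"
  obtains l where "k = l + p ^ i" "\<And>j. dig p k j = dig p l j + (if j = i then 1 else 0)"
proof -
  have kr: "k < p ^ k" using p power_gt_expt[of p k] by simp
  have i: "i < k" using dig_beyond[OF kr, of i] pos by (cases "i < k") auto
  define l where "l = (\<Sum>j<k. (dig p k j - (if j = i then 1 else 0)) * p ^ j)"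
  have bound: "dig p k j < p" for j using p by (intro dig_less) simp
  have dl: "dig p l j = (if j < k then dig p k j - (if j = i then 1 else 0) else 0)" for j
    unfolding l_def using p bound by (intro dig_sum) (auto intro: le_less_trans[OF diff_le_self])
  have dk: "dig p k j = dig p l j + (if j = i then 1 else 0)" for j
    using dl[of j] pos i dig_beyond[OF kr, of j] by auto
  have add: "dig p (l + p ^ i) j = dig p l j + dig p (p ^ i) j" for j
    using p bound by (intro dig_add) (auto simp: dig_power[OF p] dk[symmetric] split: if_splits)
  have "k = l + p ^ i" by (rule dig_eqI[OF p]) (simp add: add dk dig_power[OF p])
  then show thesis using dk by (rule that)
qed

text \<open>For k > n the coefficient (n choose k) is 0 and hence divisible by p, so the inequality
  is contained in Lucas' criterion.\<close>

lemma dominated_imp_le: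
  fixes p :: nat
  assumes "Factorial_Ring.prime p" "dominated p k n"
  shows "k \<le> n"
  using prime_dvd_choose_iff[OF assms(1), of n k] assms(2) by (metis binomial_eq_0 dvd_0_right not_le)

lemma dominated_diff:
  fixes p :: nat
  assumes "Factorial_Ring.prime p" "dominated p k n"
  shows "dominated p (n - k) n"
  using prime_dvd_choose_iff[OF assms(1), of n k] prime_dvd_choose_iff[OF assms(1), of n "n - k"]
    binomial_symmetric[OF dominated_imp_le[OF assms]] assms(2) by simp

section \<open>Polynomial functions on a finite field\<close>

context abelian_monoid begin

lemma finsum_swap:
  assumes "finite A" "finite B" "\<And>i j. i \<in> A \<Longrightarrow> j \<in> B \<Longrightarrow> f i j \<in> carrier G"
  shows "(\<Oplus>i\<in>A. \<Oplus>j\<in>B. f i j) = (\<Oplus>j\<in>B. \<Oplus>i\<in>A. f i j)"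
  using assms(1,3)
proof (induction A rule: finite_induct)
  case (insert a A)
  have "(\<Oplus>i\<in>insert a A. \<Oplus>j\<in>B. f i j) = (\<Oplus>j\<in>B. f a j) \<oplus> (\<Oplus>j\<in>B. \<Oplus>i\<in>A. f i j)"
    using insert by (subst finsum_insert) (auto intro!: finsum_closed)
  also have "\<dots> = (\<Oplus>j\<in>B. f a j \<oplus> (\<Oplus>i\<in>A. f i j))"
    using insert by (subst finsum_addf) (auto intro!: finsum_closed)
  also have "\<dots> = (\<Oplus>j\<in>B. \<Oplus>i\<in>insert a A. f i j)"
    using insert by (intro finsum_cong') (auto simp: finsum_insert intro!: finsum_closed)
  finally show ?case .
qed (simp add: finsum_zero)

lemma finsum_extend:
  assumes "finite B" "A \<subseteq> B" "\<And>i. i \<in> A \<Longrightarrow> f i \<in> carrier G" "\<And>i. i \<in> B - A \<Longrightarrow> f i = \<zero>"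
  shows "(\<Oplus>i\<in>A. f i) = (\<Oplus>i\<in>B. f i)"
proof (rule add.finprod_mono_neutral_cong_left[OF assms(1,2)])
  show "f \<in> B \<rightarrow> carrier G" using assms(3,4) by (metis DiffI Pi_I zero_closed)
qed (use assms(4) in auto)

lemma finsum_single:
  assumes "finite A" "a \<in> A" "f a \<in> carrier G" "\<And>i. i \<in> A \<Longrightarrow> i \<noteq> a \<Longrightarrow> f i = \<zero>"
  shows "(\<Oplus>i\<in>A. f i) = f a"
  using finsum_extend[of A "{a}" f] assms by (simp add: finsum_insert)

end

section \<open>Binomial theorem and Frobenius in commutative rings\<close>

context cring begin

lemma binomial_expansion:
  assumes x: "x \<in> carrier R" and y: "y \<in> carrier R"
  shows "(x \<oplus> y) [^] (n::nat) = (\<Oplus>k\<in>{..n}. add_pow R (n choose k) (x [^] k \<otimes> y [^] (n - k)))"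
proof (induction n)
  case 0
  then show ?case using assms by (simp add: finsum_insert)
next
  case (Suc n)
  let ?t = "\<lambda>n k. add_pow R (n choose k) (x [^] k \<otimes> y [^] (n - k))"
  let ?a = "\<lambda>k. add_pow R (n choose k) (x [^] Suc k \<otimes> y [^] (n - k))"
  let ?b = "\<lambda>k. add_pow R (n choose k) (x [^] k \<otimes> y [^] (Suc n - k))"
  have "(x \<oplus> y) [^] Suc n = (\<Oplus>k\<in>{..n}. ?t n k) \<otimes> x \<oplus> (\<Oplus>k\<in>{..n}. ?t n k) \<otimes> y"
    using assms by (simp add: Suc r_distr)
  also have "(\<Oplus>k\<in>{..n}. ?t n k) \<otimes> x = (\<Oplus>k\<in>{..n}. ?a k)"
    using assms by (subst finsum_ldistr) (auto intro!: finsum_cong' simp: add_pow_ldistr add_pow_rdistr m_ac)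
  also have "(\<Oplus>k\<in>{..n}. ?t n k) \<otimes> y = (\<Oplus>k\<in>{..n}. ?b k)"
    using assms by (subst finsum_ldistr) (auto intro!: finsum_cong' simp: add_pow_ldistr add_pow_rdistr m_ac Suc_diff_le)
  also have "(\<Oplus>k\<in>{..n}. ?b k) = (\<Oplus>k\<in>{..Suc n}. ?b k)"
    using assms by (subst finsum_Suc) (auto simp: binomial_eq_0)
  also have "\<dots> = (\<Oplus>k\<in>{..n}. ?b (Suc k)) \<oplus> ?b 0"
    using assms by (subst finsum_Suc2) auto
  also have "(\<Oplus>k\<in>{..n}. ?a k) \<oplus> ((\<Oplus>k\<in>{..n}. ?b (Suc k)) \<oplus> ?b 0) =
      (\<Oplus>k\<in>{..n}. ?a k \<oplus> ?b (Suc k)) \<oplus> ?b 0"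
    using assms by (subst finsum_addf) (auto simp: a_assoc intro!: finsum_closed)
  also have "(\<Oplus>k\<in>{..n}. ?a k \<oplus> ?b (Suc k)) = (\<Oplus>k\<in>{..n}. ?t (Suc n) (Suc k))"
    using assms by (intro finsum_cong') (auto simp del: nat_pow_Suc simp add: add.nat_pow_mult)
  also have "?b 0 = ?t (Suc n) 0" by simp
  also have "(\<Oplus>k\<in>{..n}. ?t (Suc n) (Suc k)) \<oplus> ?t (Suc n) 0 = (\<Oplus>k\<in>{..Suc n}. ?t (Suc n) k)"
    using assms by (subst finsum_Suc2) auto
  finally show ?case .
qed

lemma add_pow_eq_mult: "x \<in> carrier R \<Longrightarrow> add_pow R (n::nat) x = (add_pow R (n) \<one>) \<otimes> x"
  by (simp add: add_pow_ldistr)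

lemma add_pow_dvd_zero:
  assumes "add_pow R (p::nat) \<one> = \<zero>" "p dvd n" "x \<in> carrier R"
  shows "add_pow R (n) x = \<zero>"
proof -
  obtain m where "n = p * m" using assms(2) by (rule dvdE)
  then have "add_pow R (n) \<one> = add_pow R (m) (add_pow R (p) \<one>)" by (simp add: add.nat_pow_pow)
  then show ?thesis using assms by (simp add: add_pow_eq_mult[of x])
qed

lemma frobenius_add:
  assumes p: "Factorial_Ring.prime p" "add_pow R (p::nat) \<one> = \<zero>" and x: "x \<in> carrier R" and y: "y \<in> carrier R"
  shows "(x \<oplus> y) [^] (p ^ i) = x [^] (p ^ i) \<oplus> y [^] (p ^ i)"
proof -
  have p0: "0 < p" using p by (simp add: prime_gt_0_nat)
  have step: "(x \<oplus> y) [^] p = x [^] p \<oplus> y [^] p" if xy: "x \<in> carrier R" "y \<in> carrier R" for x y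
  proof -
    let ?t = "\<lambda>k. add_pow R (p choose k) (x [^] k \<otimes> y [^] (p - k))"
    have z: "?t k = \<zero>" if "k \<noteq> 0" "k < p" for k
      using that p xy by (intro add_pow_dvd_zero[OF p(2)] dvd_choose_prime) auto
    obtain m where m: "p = Suc m" using p0 gr0_conv_Suc by auto
    have "(x \<oplus> y) [^] p = (\<Oplus>k\<in>{..p}. ?t k)" using xy by (rule binomial_expansion)
    also have "\<dots> = ?t p \<oplus> (\<Oplus>k\<in>{..m}. ?t k)" using xy unfolding m by (subst finsum_Suc) auto
    also have "(\<Oplus>k\<in>{..m}. ?t k) = ?t 0" using xy z m by (intro finsum_single) auto
    finally show ?thesis using xy by simp
  qed
  show ?thesis
  proof (induction i)
    case (Suc i)
    have *: "z [^] (p ^ Suc i) = (z [^] (p ^ i)) [^] p" if "z \<in> carrier R" for z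
      using that by (simp add: nat_pow_pow mult.commute)
    show ?case using Suc x y by (simp add: * step del: power_Suc)
  qed (use x y in simp)
qed

end

section \<open>Reduced polynomials over a finite field: uniqueness, interpolation, products\<close>

locale odd_finite_field = field R for R (structure) +
  fixes p r q :: nat
  assumes finite_carrier: "finite (carrier R)"
    and prime_p: "Factorial_Ring.prime p"
    and odd_p: "2 < p"
    and char_p: "add_pow R (p) \<one> = \<zero>"
    and card_carrier: "card (carrier R) = q"
    and q_def: "q = p ^ r"
begin

lemma p_pos: "0 < p" and p_gt_1: "1 < p" using odd_p by auto

lemma q_gt_1: "1 < q"
proof -
  have "card {\<zero>, \<one>} \<le> q"
    unfolding card_carrier[symmetric] by (intro card_mono finite_carrier) auto
  then show ?thesis by simp
qed

lemma r_pos: "0 < r"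
  using q_gt_1 q_def by (cases r) auto

lemma add_pow_one_eq_zero_iff: "add_pow R (n::nat) \<one> = \<zero> \<longleftrightarrow> p dvd n"
proof -
  have o: "add.ord \<one> dvd p" using add.pow_eq_id[of \<one> p] char_p by simp
  have "add.ord \<one> \<noteq> 1" using add.ord_eq_1[of \<one>] by simp
  then have "add.ord \<one> = p" using o prime_p by (metis One_nat_def prime_nat_iff)
  then show ?thesis using add.pow_eq_id[of \<one> n] by simp
qed

lemma pow_q: "x \<in> carrier R \<Longrightarrow> x [^] q = x"
proof (cases "x = \<zero>")
  case False
  assume x: "x \<in> carrier R"
  interpret M: group "Multiplicative_Group.mult_of R" by (rule field_mult_group)
  have "x [^] (q - 1) = \<one>"
    using M.pow_order_eq_1[of x] x False order_mult_of[OF finite_carrier]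
    by (simp add: mult_of_simps order_def card_carrier)
  moreover have "x [^] q = x [^] (q - 1) \<otimes> x"
    using q_gt_1 x by (metis Suc_diff_1 nat_pow_Suc less_trans zero_less_one)
  ultimately show ?thesis using x by simp
qed (use q_gt_1 in \<open>simp add: nat_pow_zero\<close>)

text \<open>Exponents stop below q because x^q = x: these are the reduced polynomials, one for each
  function on the field.\<close>

definition pol :: "(nat \<Rightarrow> 'a) \<Rightarrow> 'a \<Rightarrow> 'a" where
  "pol c x = (\<Oplus>k\<in>{..<q}. c k \<otimes> x [^] k)"

lemma pol_closed: "(\<And>k. c k \<in> carrier R) \<Longrightarrow> x \<in> carrier R \<Longrightarrow> pol c x \<in> carrier R"
  by (auto simp: pol_def intro!: finsum_closed)

text \<open>A nonzero polynomial of degree at most q - 1 cannot have all q field elements as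
  roots.\<close>

lemma pol_unique_zero:
  assumes c: "\<And>k. c k \<in> carrier R" and z: "\<And>x. x \<in> carrier R \<Longrightarrow> pol c x = \<zero>" and k: "k < q"
  shows "c k = \<zero>"
proof (rule ccontr)
  assume ck: "c k \<noteq> \<zero>"
  interpret U: UP_domain R "UP R" by unfold_locales
  \<comment> \<open>Truncation at q makes the sequence finitely supported, hence an element of
    \<open>UP R\<close>; c itself is unconstrained from q on.\<close>
  let ?e = "\<lambda>k. if k < q then c k else \<zero>"
  have e: "?e \<in> carrier (UP R)"
    unfolding UP_def using c by (auto simp: up_def bound_def intro!: exI[of _ q])
  have co: "up_ring.coeff (UP R) ?e i = ?e i" for i
    using e unfolding UP_def by simp
  have ne: "?e \<noteq> \<zero>\<^bsub>UP R\<^esub>" using co[of k] ck k by auto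
  have deg: "deg R ?e \<le> q - 1"
    by (rule U.deg_aboveI) (use e in \<open>auto simp: co\<close>)
  have ev: "UnivPoly.eval R R id x ?e = \<zero>" if x: "x \<in> carrier R" for x
  proof -
    have "UnivPoly.eval R R id x ?e = (\<Oplus>i\<in>{..deg R ?e}. ?e i \<otimes> x [^] i)"
      using U.eval_on_carrier[OF e, of R id x] by (simp add: co)
    also have "\<dots> = (\<Oplus>i\<in>{..<q}. ?e i \<otimes> x [^] i)"
    proof (rule finsum_extend)
      show "{..deg R ?e} \<subseteq> {..<q}" using deg q_gt_1 by (auto simp: le_less_trans)
      show "?e i \<otimes> x [^] i = \<zero>" if "i \<in> {..<q} - {..deg R ?e}" for i
        using U.deg_aboveD[of ?e i] e that x co[of i] by auto
    qed (use c x in auto)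
    also have "\<dots> = pol c x" unfolding pol_def using c x by (intro finsum_cong') auto
    finally show ?thesis using z x by simp
  qed
  have roots: "{a \<in> carrier R. UnivPoly.eval R R id a ?e = \<zero>} = carrier R" using ev by auto
  have "q \<le> deg R ?e"
    using U.roots_bound[OF e ne finite_carrier, unfolded roots card_carrier] by (rule conjunct2)
  with deg q_gt_1 show False by linarith
qed

lemma pol_unique:
  assumes c: "\<And>k. c k \<in> carrier R" and d: "\<And>k. d k \<in> carrier R"
    and z: "\<And>x. x \<in> carrier R \<Longrightarrow> pol c x = pol d x" and k: "k < q"
  shows "c k = d k"
proof -
  have "pol (\<lambda>k. c k \<ominus> d k) x = \<zero>" if x: "x \<in> carrier R" for x
  proof -
    have "pol (\<lambda>k. c k \<ominus> d k) x \<oplus> pol d x = (\<Oplus>k\<in>{..<q}. (c k \<ominus> d k) \<otimes> x [^] k \<oplus> d k \<otimes> x [^] k)"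
      unfolding pol_def using c d x by (subst finsum_addf) auto
    also have "\<dots> = pol c x" unfolding pol_def
    proof (rule finsum_cong'[OF refl])
      fix i
      have [simp]: "c i \<in> carrier R" "d i \<in> carrier R" using c d by auto
      show "(c i \<ominus> d i) \<otimes> x [^] i \<oplus> d i \<otimes> x [^] i = c i \<otimes> x [^] i"
        using x by (simp add: l_distr minus_eq l_minus a_assoc l_neg)
    qed (use c x in auto)
    finally have "pol (\<lambda>k. c k \<ominus> d k) x \<oplus> pol d x = pol d x" using z[OF x] by simp
    moreover have "pol (\<lambda>k. c k \<ominus> d k) x \<in> carrier R" "pol d x \<in> carrier R"
      using c d x by (auto intro: pol_closed)
    ultimately show ?thesis using add.r_cancel_one[of "pol d x" "pol (\<lambda>k. c k \<ominus> d k) x"] by simp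
  qed
  then have "c k \<ominus> d k = \<zero>" using c d k by (intro pol_unique_zero[of "\<lambda>k. c k \<ominus> d k"]) auto
  then show ?thesis using c d by simp
qed

lemma geometric_identity:
  assumes x: "x \<in> carrier R" and a: "a \<in> carrier R"
  shows "(\<Oplus>k\<in>{..n}. x [^] k \<otimes> a [^] (n - k)) \<otimes> (x \<ominus> a) = x [^] Suc n \<ominus> a [^] Suc n"
proof (induction n)
  case (Suc n)
  let ?S = "\<Oplus>k\<in>{..n}. x [^] k \<otimes> a [^] (n - k)"
  have "(\<Oplus>k\<in>{..Suc n}. x [^] k \<otimes> a [^] (Suc n - k)) =
      x [^] Suc n \<oplus> (\<Oplus>k\<in>{..n}. x [^] k \<otimes> a [^] (Suc n - k))"
    using assms by (subst finsum_Suc) auto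
  also have "(\<Oplus>k\<in>{..n}. x [^] k \<otimes> a [^] (Suc n - k)) = (\<Oplus>k\<in>{..n}. x [^] k \<otimes> a [^] (n - k)) \<otimes> a"
    using assms by (subst finsum_ldistr) (auto intro!: finsum_cong' simp: m_assoc Suc_diff_le)
  finally have *: "(\<Oplus>k\<in>{..Suc n}. x [^] k \<otimes> a [^] (Suc n - k)) = x [^] Suc n \<oplus> ?S \<otimes> a" .
  have S: "?S \<in> carrier R" using assms by (auto intro!: finsum_closed)
  have "(\<Oplus>k\<in>{..Suc n}. x [^] k \<otimes> a [^] (Suc n - k)) \<otimes> (x \<ominus> a) =
     x [^] Suc n \<otimes> (x \<ominus> a) \<oplus> (?S \<otimes> (x \<ominus> a)) \<otimes> a"
    unfolding * using assms S by (simp add: l_distr m_assoc m_comm[of a "x \<ominus> a"] del: nat_pow_Suc)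
  also have "\<dots> = x [^] Suc n \<otimes> (x \<ominus> a) \<oplus> (x [^] Suc n \<ominus> a [^] Suc n) \<otimes> a"
    by (simp only: Suc)
  also have "\<dots> = x [^] Suc (Suc n) \<ominus> a [^] Suc (Suc n)"
  proof -
    define u v where "u = x [^] Suc n" "v = a [^] Suc n"
    have uv: "u \<in> carrier R" "v \<in> carrier R" using assms by (auto simp: u_v_def)
    have "u \<otimes> (x \<ominus> a) \<oplus> (u \<ominus> v) \<otimes> a = u \<otimes> x \<ominus> a \<otimes> v" using uv assms by algebra
    then show ?thesis using assms uv by (simp add: u_v_def m_comm)
  qed
  finally show ?case .
qed (use assms in \<open>simp add: finsum_insert\<close>)


text \<open>For n = q - 1 the sum of x^k a^(n-k) over k \<le> n equals (x^q - a^q) / (x - a) = 1 if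
  x \<noteq> a, and q x^n = 0 if x = a. One minus this sum is the indicator of a, and h is the
  combination of these indicators with weights h a; \<open>c\<close> collects the powers of
  x.\<close>

lemma pol_interpolation:
  assumes h: "h \<in> carrier R \<rightarrow> carrier R"
  shows "\<exists>c. (\<forall>k. c k \<in> carrier R) \<and> (\<forall>k\<ge>q. c k = \<zero>) \<and> (\<forall>x\<in>carrier R. h x = pol c x)"
proof -
  obtain n where n: "q = Suc n" using q_gt_1 by (cases q) auto
  define g where "g k a = (if k \<le> n then h a \<otimes> a [^] (n - k) else \<zero>)" for k a
  define H where "H = (\<Oplus>a\<in>carrier R. h a)"
  define c where "c k = (if k = 0 then H else \<zero>) \<ominus> (\<Oplus>a\<in>carrier R. g k a)" for k
  have hc [simp]: "h a \<in> carrier R" if "a \<in> carrier R" for a using h that by auto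
  have H [simp]: "H \<in> carrier R" unfolding H_def by (intro finsum_closed) auto
  have g: "g k a \<in> carrier R" if "a \<in> carrier R" for k a using that by (simp add: g_def)
  have G: "(\<Oplus>a\<in>carrier R. g k a) \<in> carrier R" for k using g by (intro finsum_closed) auto
  show ?thesis
  proof (intro exI[of _ c] conjI allI impI ballI)
    show cc: "c k \<in> carrier R" for k unfolding c_def using G by simp
    show "c k = \<zero>" if "q \<le> k" for k unfolding c_def g_def using that n by simp
    fix x assume x: "x \<in> carrier R"
    have geo: "(\<Oplus>k\<in>{..n}. x [^] k \<otimes> a [^] (n - k)) = (if a = x then \<zero> else \<one>)"
      if a: "a \<in> carrier R" for a
    proof (cases "a = x")
      case True
      have "(\<Oplus>k\<in>{..n}. x [^] k \<otimes> x [^] (n - k)) = (\<Oplus>k\<in>{..n}. x [^] n)"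
        using x by (intro finsum_cong') (auto simp: nat_pow_mult)
      also have "\<dots> = add_pow R q (x [^] n)" using x n by (simp add: add.finprod_const)
      also have "\<dots> = \<zero>" using x r_pos q_def by (intro add_pow_dvd_zero[OF char_p]) auto
      finally show ?thesis using True by simp
    next
      case False
      let ?S = "\<Oplus>k\<in>{..n}. x [^] k \<otimes> a [^] (n - k)"
      have S: "?S \<in> carrier R" using a x by (auto intro!: finsum_closed)
      have "?S \<otimes> (x \<ominus> a) = x [^] q \<ominus> a [^] q"
        using geometric_identity[OF x a, of n] n by simp
      also have "\<dots> = \<one> \<otimes> (x \<ominus> a)" using a x by (simp add: pow_q)
      finally have eq: "?S \<otimes> (x \<ominus> a) = \<one> \<otimes> (x \<ominus> a)" .
      have "x \<ominus> a \<noteq> \<zero>" using False a x by (metis r_right_minus_eq)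
      then have "?S = \<one>" using S a x m_rcancel[of "x \<ominus> a" ?S \<one>] eq by simp
      then show ?thesis using False by simp
    qed
    have inner: "(\<Oplus>k\<in>{..<q}. g k a \<otimes> x [^] k) = (if a = x then \<zero> else h a)" if a: "a \<in> carrier R" for a
    proof -
      have "(\<Oplus>k\<in>{..<q}. g k a \<otimes> x [^] k) = (\<Oplus>k\<in>{..n}. h a \<otimes> (x [^] k \<otimes> a [^] (n - k)))"
        unfolding n lessThan_Suc_atMost using a x
        by (intro finsum_cong') (auto simp: g_def m_assoc m_comm[of "x [^] (_::nat)"])
      also have "\<dots> = h a \<otimes> (\<Oplus>k\<in>{..n}. x [^] k \<otimes> a [^] (n - k))"
        using a x by (subst finsum_rdistr) auto
      finally show ?thesis using geo[OF a] a x by simp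
    qed
    have "(\<Oplus>k\<in>{..<q}. (\<Oplus>a\<in>carrier R. g k a) \<otimes> x [^] k) =
        (\<Oplus>k\<in>{..<q}. \<Oplus>a\<in>carrier R. g k a \<otimes> x [^] k)"
      using g x finite_carrier
      by (intro finsum_cong') (auto simp: finsum_ldistr intro!: finsum_closed)
    also have "\<dots> = (\<Oplus>a\<in>carrier R. \<Oplus>k\<in>{..<q}. g k a \<otimes> x [^] k)"
      using g x finite_carrier by (intro finsum_swap) auto
    also have "\<dots> = (\<Oplus>a\<in>carrier R. if a = x then \<zero> else h a)"
      by (intro finsum_cong') (auto simp: inner)
    finally have 1: "(\<Oplus>k\<in>{..<q}. (\<Oplus>a\<in>carrier R. g k a) \<otimes> x [^] k) =
      (\<Oplus>a\<in>carrier R. if a = x then \<zero> else h a)" (is "?A = ?B") .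
    have B: "?B \<in> carrier R" by (intro finsum_closed) auto
    \<comment> \<open>Adding the subtracted part back leaves the constant H, the sum of all values
      of h; \<open>?A\<close> is the same sum without the value at x, so the difference is h
      x.\<close>
    have "pol c x \<oplus> ?A = (\<Oplus>k\<in>{..<q}. (if k = 0 then H else \<zero>) \<otimes> x [^] k)"
      unfolding pol_def
    proof (subst finsum_addf[symmetric])
      show "(\<Oplus>k\<in>{..<q}. c k \<otimes> x [^] k \<oplus> (\<Oplus>a\<in>carrier R. g k a) \<otimes> x [^] k) =
        (\<Oplus>k\<in>{..<q}. (if k = 0 then H else \<zero>) \<otimes> x [^] k)"
      proof (rule finsum_cong'[OF refl])
        fix k :: nat
        define u where "u = (if k = 0 then H else \<zero>)"
        define v where "v = (\<Oplus>a\<in>carrier R. g k a)"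
        define w where "w = x [^] k"
        have uvw: "u \<in> carrier R" "v \<in> carrier R" "w \<in> carrier R"
          using x G[of k] by (auto simp: u_def v_def w_def)
        have "(u \<ominus> v) \<otimes> w \<oplus> v \<otimes> w = u \<otimes> w" using uvw by algebra
        then show "c k \<otimes> x [^] k \<oplus> (\<Oplus>a\<in>carrier R. g k a) \<otimes> x [^] k = (if k = 0 then H else \<zero>) \<otimes> x [^] k"
          unfolding c_def u_def v_def w_def .
      qed (use x in auto)
    qed (use cc G x in auto)
    also have "\<dots> = H" using q_gt_1 x by (subst finsum_single[of _ 0]) auto
    also have "\<dots> = h x \<oplus> (\<Oplus>a\<in>carrier R - {x}. h a)"
      unfolding H_def using finite_carrier x
      by (subst finsum_insert[symmetric]) (auto simp: insert_absorb)
    also have "(\<Oplus>a\<in>carrier R - {x}. h a) = (\<Oplus>a\<in>carrier R - {x}. if a = x then \<zero> else h a)"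
      by (intro finsum_cong') auto
    also have "\<dots> = ?B"
      using finite_carrier by (intro finsum_extend) auto
    finally show "h x = pol c x" unfolding 1
      using pol_closed[OF cc x] B x add.right_cancel[of ?B "pol c x" "h x"] by simp
  qed
qed

text \<open>The bound on exponents keeps the product reduced: x^q = x never wraps a term round, so
  the coefficients are the plain convolution.\<close>

lemma pol_mult:
  assumes c: "\<And>k. c k \<in> carrier R" and d: "\<And>k. d k \<in> carrier R"
    and lt: "\<And>i j. c i \<noteq> \<zero> \<Longrightarrow> d j \<noteq> \<zero> \<Longrightarrow> i + j < q"
    and cq: "\<And>k. q \<le> k \<Longrightarrow> c k = \<zero>" and dq: "\<And>k. q \<le> k \<Longrightarrow> d k = \<zero>"
    and x: "x \<in> carrier R"
  shows "pol c x \<otimes> pol d x = pol (\<lambda>n. \<Oplus>i\<in>{..n}. c i \<otimes> d (n - i)) x"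
proof -
  obtain n where n: "q = Suc n" using q_gt_1 by (cases q) auto
  have le: "{..<q} = {..n}" using n by auto
  let ?c = "\<lambda>i. c i \<otimes> x [^] i" and ?d = "\<lambda>i. d i \<otimes> x [^] i"
  let ?e = "\<lambda>k. \<Oplus>i\<in>{..k}. c i \<otimes> d (k - i)"
  have e: "?e k \<in> carrier R" for k using c d by (auto intro!: finsum_closed)
  have e0: "?e k = \<zero>" if "q \<le> k" for k
  proof -
    have "?e k = (\<Oplus>i\<in>{..k}. \<zero>)"
      using c d lt that by (intro finsum_cong') (auto, metis add_diff_inverse_nat integral_iff leD not_less)
    then show ?thesis by simp
  qed
  have "pol c x \<otimes> pol d x = (\<Oplus>i\<in>{..n}. ?c i) \<otimes> (\<Oplus>i\<in>{..n}. ?d i)"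
    unfolding pol_def le ..
  also have "\<dots> = (\<Oplus>k\<in>{..n + n}. \<Oplus>i\<in>{..k}. ?c i \<otimes> ?d (k - i))"
    using c d x cq dq n by (intro cauchy_product[symmetric]) (auto simp: bound_def)
  also have "\<dots> = (\<Oplus>k\<in>{..n + n}. ?e k \<otimes> x [^] k)"
  proof (rule finsum_cong'[OF refl])
    fix k
    have "(\<Oplus>i\<in>{..k}. ?c i \<otimes> ?d (k - i)) = (\<Oplus>i\<in>{..k}. (c i \<otimes> d (k - i)) \<otimes> x [^] k)"
    proof (rule finsum_cong'[OF refl])
      fix i assume i: "i \<in> {..k}"
      then have "x [^] k = x [^] i \<otimes> x [^] (k - i)" using x by (simp add: nat_pow_mult)
      moreover have [simp]: "c i \<in> carrier R" "d (k - i) \<in> carrier R" using c d by auto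
      ultimately show "?c i \<otimes> ?d (k - i) = (c i \<otimes> d (k - i)) \<otimes> x [^] k"
        using x by (simp add: m_ac)
    qed (use c d x in auto)
    then show "(\<Oplus>i\<in>{..k}. ?c i \<otimes> ?d (k - i)) = ?e k \<otimes> x [^] k"
      using c d x by (simp add: finsum_ldistr)
  qed (use e x in auto)
  also have "\<dots> = (\<Oplus>k\<in>{..<q}. ?e k \<otimes> x [^] k)"
    using e e0 x n by (intro finsum_extend[symmetric]) auto
  finally show ?thesis unfolding pol_def .
qed

end

section \<open>Coefficients of a function on a finite field\<close>

context odd_finite_field begin

text \<open>The reduced polynomial of h, depending only on the values of h on the carrier. The value
  0 from q on lets later arguments range over all exponents.\<close>

definition coef :: "('a \<Rightarrow> 'a) \<Rightarrow> nat \<Rightarrow> 'a" where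
  "coef h = (SOME c. (\<forall>k. c k \<in> carrier R) \<and> (\<forall>k\<ge>q. c k = \<zero>) \<and> (\<forall>x\<in>carrier R. h x = pol c x))"

context
  fixes h assumes h: "h \<in> carrier R \<rightarrow> carrier R"
begin

lemma coef_props:
  "(\<forall>k. coef h k \<in> carrier R) \<and> (\<forall>k\<ge>q. coef h k = \<zero>) \<and> (\<forall>x\<in>carrier R. h x = pol (coef h) x)"
  unfolding coef_def by (rule someI_ex[OF pol_interpolation[OF h]])

lemma coef_closed: "coef h k \<in> carrier R"
  and coef_ge: "q \<le> k \<Longrightarrow> coef h k = \<zero>"
  and pol_coef: "x \<in> carrier R \<Longrightarrow> pol (coef h) x = h x"
  using coef_props by auto

lemma coef_eqI:
  assumes "\<And>k. c k \<in> carrier R" "\<And>k. q \<le> k \<Longrightarrow> c k = \<zero>" "\<And>x. x \<in> carrier R \<Longrightarrow> h x = pol c x"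
  shows "coef h k = c k"
proof (cases "k < q")
  case True
  have "pol (coef h) x = pol c x" if "x \<in> carrier R" for x
    using pol_coef[OF that] assms(3)[OF that] by simp
  then show ?thesis using pol_unique[of "coef h" c k] coef_closed assms(1) True by blast
qed (use coef_ge assms(2) in auto)

end

lemma pol_cong: "(\<And>k. k < q \<Longrightarrow> c k = d k) \<Longrightarrow> (\<And>k. d k \<in> carrier R) \<Longrightarrow> x \<in> carrier R \<Longrightarrow> pol c x = pol d x"
  unfolding pol_def by (intro finsum_cong') auto

lemma coef_cong:
  assumes h: "h \<in> carrier R \<rightarrow> carrier R" and eq: "\<And>x. x \<in> carrier R \<Longrightarrow> g x = h x"
  shows "coef g k = coef h k"
proof -
  have g: "g \<in> carrier R \<rightarrow> carrier R" using assms by auto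
  show ?thesis by (rule coef_eqI[OF g]) (use h eq in \<open>auto simp: coef_closed coef_ge pol_coef\<close>)
qed

lemma pol_single:
  assumes "m < q" "x \<in> carrier R" "b \<in> carrier R"
  shows "pol (\<lambda>k. if k = m then b else \<zero>) x = b \<otimes> x [^] m"
  unfolding pol_def using assms by (subst finsum_single[of _ m]) auto

lemma coef_monom:
  assumes "m < q" "b \<in> carrier R"
  shows "coef (\<lambda>x. b \<otimes> x [^] m) k = (if k = m then b else \<zero>)"
  by (rule coef_eqI[of _ "\<lambda>k. if k = m then b else \<zero>"]) (use assms in \<open>auto simp: pol_single\<close>)

lemma coef_smult:
  assumes h: "h \<in> carrier R \<rightarrow> carrier R" and b: "b \<in> carrier R"
  shows "coef (\<lambda>x. b \<otimes> h x) k = b \<otimes> coef h k"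
proof (rule coef_eqI)
  show "b \<otimes> h x = pol (\<lambda>k. b \<otimes> coef h k) x" if x: "x \<in> carrier R" for x
  proof -
    have "h x = (\<Oplus>k\<in>{..<q}. coef h k \<otimes> x [^] k)" using pol_coef[OF h x] by (simp add: pol_def)
    then have "b \<otimes> h x = (\<Oplus>k\<in>{..<q}. b \<otimes> (coef h k \<otimes> x [^] k))"
      using x h b coef_closed by (simp add: finsum_rdistr)
    also have "\<dots> = pol (\<lambda>k. b \<otimes> coef h k) x"
      unfolding pol_def using x h b coef_closed by (intro finsum_cong') (auto simp: m_assoc)
    finally show ?thesis .
  qed
qed (use h b coef_closed coef_ge in auto)

lemma coef_add:
  assumes h: "h \<in> carrier R \<rightarrow> carrier R" and g: "g \<in> carrier R \<rightarrow> carrier R"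
  shows "coef (\<lambda>x. h x \<oplus> g x) k = coef h k \<oplus> coef g k"
proof (rule coef_eqI)
  show "h x \<oplus> g x = pol (\<lambda>k. coef h k \<oplus> coef g k) x" if x: "x \<in> carrier R" for x
  proof -
    have "h x \<oplus> g x = (\<Oplus>k\<in>{..<q}. coef h k \<otimes> x [^] k \<oplus> coef g k \<otimes> x [^] k)"
      using pol_coef[OF h x] pol_coef[OF g x] x h g coef_closed by (simp add: pol_def finsum_addf)
    also have "\<dots> = pol (\<lambda>k. coef h k \<oplus> coef g k) x"
      unfolding pol_def using x h g coef_closed by (intro finsum_cong') (auto simp: l_distr)
    finally show ?thesis .
  qed
qed (use h g coef_closed coef_ge in auto)

lemma coef_mult:
  assumes h: "h \<in> carrier R \<rightarrow> carrier R" and g: "g \<in> carrier R \<rightarrow> carrier R"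
    and lt: "\<And>i j. coef h i \<noteq> \<zero> \<Longrightarrow> coef g j \<noteq> \<zero> \<Longrightarrow> i + j < q"
  shows "coef (\<lambda>x. h x \<otimes> g x) n = (\<Oplus>i\<in>{..n}. coef h i \<otimes> coef g (n - i))"
proof (rule coef_eqI)
  show "h x \<otimes> g x = pol (\<lambda>n. \<Oplus>i\<in>{..n}. coef h i \<otimes> coef g (n - i)) x" if x: "x \<in> carrier R" for x
    unfolding pol_coef[OF h x, symmetric] pol_coef[OF g x, symmetric]
    using coef_closed[OF h] coef_closed[OF g] lt coef_ge[OF h] coef_ge[OF g] x by (rule pol_mult)
  show "(\<Oplus>i\<in>{..k}. coef h i \<otimes> coef g (k - i)) = \<zero>" if "q \<le> k" for k
  proof -
    have "coef h i \<otimes> coef g (k - i) = \<zero>" if "i \<le> k" for i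
      using lt[of i "k - i"] that \<open>q \<le> k\<close> coef_closed[OF h, of i] coef_closed[OF g, of "k - i"] by fastforce
    then have "(\<Oplus>i\<in>{..k}. coef h i \<otimes> coef g (k - i)) = (\<Oplus>i\<in>{..k}. \<zero>)"
      by (intro finsum_cong') auto
    then show ?thesis by simp
  qed
qed (use h g coef_closed in \<open>auto intro!: finsum_closed\<close>)

lemma coef_mult_nonzeroD:
  assumes h: "h \<in> carrier R \<rightarrow> carrier R" and g: "g \<in> carrier R \<rightarrow> carrier R"
    and lt: "\<And>i j. coef h i \<noteq> \<zero> \<Longrightarrow> coef g j \<noteq> \<zero> \<Longrightarrow> i + j < q"
    and nz: "coef (\<lambda>x. h x \<otimes> g x) n \<noteq> \<zero>"
  obtains i j where "n = i + j" "coef h i \<noteq> \<zero>" "coef g j \<noteq> \<zero>"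
proof (rule ccontr)
  assume no: "\<not> thesis"
  note T = that
  have "coef h i \<otimes> coef g (n - i) = \<zero>" if i: "i \<le> n" for i
  proof -
    have "coef h i = \<zero> \<or> coef g (n - i) = \<zero>" using no T[of i "n - i"] i by fastforce
    then show ?thesis using coef_closed[OF h] coef_closed[OF g] by auto
  qed
  then have "(\<Oplus>i\<in>{..n}. coef h i \<otimes> coef g (n - i)) = (\<Oplus>i\<in>{..n}. \<zero>)"
    by (intro finsum_cong') auto
  then show False using nz coef_mult[OF h g lt] by simp
qed

text \<open>Both sides expand one function of two variables, by powers of x and by powers of y, so
  they share one matrix of coefficients. A vanishing \<open>W j\<close> thus removes y^j from every
  \<open>G k\<close>; this is how information passes between the two variables.\<close>

lemma coef_exchange:
  assumes G: "\<And>k y. y \<in> carrier R \<Longrightarrow> G k y \<in> carrier R" and W: "\<And>j x. x \<in> carrier R \<Longrightarrow> W j x \<in> carrier R"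
    and eq: "\<And>x y. x \<in> carrier R \<Longrightarrow> y \<in> carrier R \<Longrightarrow>
      (\<Oplus>k\<in>{..<q}. G k y \<otimes> x [^] k) = (\<Oplus>j\<in>{..<q}. W j x \<otimes> y [^] j)"
    and k: "k < q" and j: "j < q"
  shows "coef (G k) j = coef (W j) k"
proof -
  have Wf: "W j \<in> carrier R \<rightarrow> carrier R" and Gf: "G j \<in> carrier R \<rightarrow> carrier R" for j using W G by auto
  define V where "V k y = pol (\<lambda>j. coef (W j) k) y" for k y
  have V: "V k y \<in> carrier R" if "y \<in> carrier R" for k y
    unfolding V_def using that coef_closed[OF Wf] by (intro pol_closed)
  have "G k y = V k y" if y: "y \<in> carrier R" for y
  proof (rule pol_unique[OF _ _ _ k])
    show "G k y \<in> carrier R" "V k y \<in> carrier R" for k using G V y by auto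
    fix x assume x: "x \<in> carrier R"
    have "pol (\<lambda>k. G k y) x = (\<Oplus>j\<in>{..<q}. W j x \<otimes> y [^] j)"
      using eq[OF x y] by (simp add: pol_def)
    also have "\<dots> = (\<Oplus>j\<in>{..<q}. \<Oplus>k\<in>{..<q}. (coef (W j) k \<otimes> x [^] k) \<otimes> y [^] j)"
    proof (rule finsum_cong'[OF refl])
      fix j
      show "W j x \<otimes> y [^] j = (\<Oplus>k\<in>{..<q}. (coef (W j) k \<otimes> x [^] k) \<otimes> y [^] j)"
        unfolding pol_coef[OF Wf x, symmetric] pol_def
        using x y coef_closed[OF Wf] by (intro finsum_ldistr) auto
    qed (use x y coef_closed[OF Wf] in \<open>auto intro!: finsum_closed\<close>)
    also have "\<dots> = (\<Oplus>k\<in>{..<q}. \<Oplus>j\<in>{..<q}. (coef (W j) k \<otimes> x [^] k) \<otimes> y [^] j)"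
      using x y coef_closed[OF Wf] by (intro finsum_swap) auto
    also have "\<dots> = pol (\<lambda>k. V k y) x" unfolding pol_def
    proof (rule finsum_cong'[OF refl])
      fix k
      have "(\<Oplus>j\<in>{..<q}. (coef (W j) k \<otimes> x [^] k) \<otimes> y [^] j) = (\<Oplus>j\<in>{..<q}. (coef (W j) k \<otimes> y [^] j) \<otimes> x [^] k)"
        using x y coef_closed[OF Wf] by (intro finsum_cong') (auto simp: m_ac)
      then show "(\<Oplus>j\<in>{..<q}. (coef (W j) k \<otimes> x [^] k) \<otimes> y [^] j) = V k y \<otimes> x [^] k"
        unfolding V_def pol_def using x y coef_closed[OF Wf] by (simp add: finsum_ldistr)
    qed (use x y V in auto)
    finally show "pol (\<lambda>k. G k y) x = pol (\<lambda>k. V k y) x" .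
  qed
  then have "coef (G k) j = (if j < q then coef (W j) k else \<zero>)"
    by (intro coef_eqI[OF Gf]) (auto simp: V_def coef_closed[OF Wf] intro!: pol_cong)
  then show ?thesis using j by simp
qed

text \<open>The coefficient of y^(n-k) x^k in (y - x)^n, taken in the field.\<close>

definition bc :: "nat \<Rightarrow> nat \<Rightarrow> 'a" where
  "bc n k = add_pow R (n choose k) ((\<ominus> \<one>) [^] k)"

lemma bc_closed [simp]: "bc n k \<in> carrier R"
  by (simp add: bc_def)

lemma add_pow_eq_zero_iff:
  assumes "x \<in> carrier R"
  shows "add_pow R (n::nat) x = \<zero> \<longleftrightarrow> p dvd n \<or> x = \<zero>"
  using assms add_pow_one_eq_zero_iff[of n] by (subst add_pow_eq_mult) (auto simp: integral_iff)

lemma bc_eq_zero_iff: "bc n k = \<zero> \<longleftrightarrow> \<not> dominated p k n"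
proof -
  have "(\<ominus> \<one>) [^] k \<otimes> (\<ominus> \<one>) [^] k = \<one>"
    by (simp add: nat_pow_distrib[symmetric] l_minus)
  then have "(\<ominus> \<one>) [^] k \<noteq> \<zero>" by auto
  then show ?thesis unfolding bc_def using prime_dvd_choose_iff[OF prime_p] by (simp add: add_pow_eq_zero_iff)
qed

lemma minus_pow_expansion_right:
  assumes x: "x \<in> carrier R" and y: "y \<in> carrier R" and n: "n < q"
  shows "(y \<ominus> x) [^] n = (\<Oplus>k\<in>{..<q}. (bc n k \<otimes> y [^] (n - k)) \<otimes> x [^] k)"
proof -
  have ox: "\<ominus> x = \<ominus> \<one> \<otimes> x" using x by (simp add: l_minus)
  have "(y \<ominus> x) [^] n = (\<ominus> x \<oplus> y) [^] n" using x y by (simp add: minus_eq a_comm)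
  also have "\<dots> = (\<Oplus>k\<in>{..n}. add_pow R (n choose k) ((\<ominus> x) [^] k \<otimes> y [^] (n - k)))"
    using x y by (intro binomial_expansion) auto
  \<comment> \<open>Padding to q terms is harmless: for k > n the binomial coefficient is 0,
    whatever the truncated difference n - k yields.\<close>
  also have "\<dots> = (\<Oplus>k\<in>{..<q}. add_pow R (n choose k) ((\<ominus> x) [^] k \<otimes> y [^] (n - k)))"
    using x y n by (intro finsum_extend) (auto simp: binomial_eq_0)
  also have "\<dots> = (\<Oplus>k\<in>{..<q}. (bc n k \<otimes> y [^] (n - k)) \<otimes> x [^] k)"
    using x y unfolding bc_def ox
    by (intro finsum_cong') (auto simp: nat_pow_distrib add_pow_ldistr add_pow_rdistr m_ac)
  finally show ?thesis .
qed

lemma minus_pow_expansion_left: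
  assumes x: "x \<in> carrier R" and y: "y \<in> carrier R" and n: "n < q"
  shows "(x \<ominus> y) [^] n = (\<Oplus>k\<in>{..<q}. add_pow R (n choose k) ((\<ominus> y) [^] (n - k)) \<otimes> x [^] k)"
proof -
  have "(x \<ominus> y) [^] n = (\<Oplus>k\<in>{..n}. add_pow R (n choose k) (x [^] k \<otimes> (\<ominus> y) [^] (n - k)))"
    using x y unfolding minus_eq by (intro binomial_expansion) auto
  also have "\<dots> = (\<Oplus>k\<in>{..<q}. add_pow R (n choose k) (x [^] k \<otimes> (\<ominus> y) [^] (n - k)))"
    using x y n by (intro finsum_extend) (auto simp: binomial_eq_0)
  also have "\<dots> = (\<Oplus>k\<in>{..<q}. add_pow R (n choose k) ((\<ominus> y) [^] (n - k)) \<otimes> x [^] k)"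
    using x y by (intro finsum_cong') (auto simp: add_pow_ldistr add_pow_rdistr m_comm)
  finally show ?thesis .
qed

end

section \<open>McConnel's theorem\<close>

context odd_finite_field begin

lemma coef_const_zero: "coef (\<lambda>x. \<zero>) k = \<zero>"
  by (rule coef_eqI[of _ "\<lambda>k. \<zero>"]) (auto simp: pol_def)

lemma coef_0:
  assumes "h \<in> carrier R \<rightarrow> carrier R"
  shows "coef h 0 = h \<zero>"
proof -
  have c: "coef h k \<in> carrier R" for k using assms by (rule coef_closed)
  have "h \<zero> = (\<Oplus>k\<in>{..<q}. coef h k \<otimes> \<zero> [^] k)"
    using pol_coef[OF assms, of \<zero>] by (simp add: pol_def)
  also have "\<dots> = coef h 0" using q_gt_1 c by (subst finsum_single[of _ 0]) (auto simp: nat_pow_zero)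
  finally show ?thesis by simp
qed

text \<open>With g inverse to f the hypothesis reads (f y - x)^b = (y - g x)^b. On the left the
  coefficient of x^(b-k) is a nonzero multiple of (f y)^k; on the right y^j comes with the factor (b
  choose j), which vanishes unless j is digitwise below b.\<close>

lemma power_coef_dominated:
  assumes f: "bij_betw f (carrier R) (carrier R)" and b: "b < q"
    and eq: "\<And>x y. x \<in> carrier R \<Longrightarrow> y \<in> carrier R \<Longrightarrow> (f x \<ominus> f y) [^] b = (x \<ominus> y) [^] b"
    and k: "dominated p k b" and nz: "coef (\<lambda>y. f y [^] k) j \<noteq> \<zero>"
  shows "dominated p j b"
proof (rule ccontr)
  assume nd: "\<not> dominated p j b"
  have fc: "f x \<in> carrier R" if "x \<in> carrier R" for x using f that by (rule bij_betwE[THEN bspec])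
  define g where "g = inv_into (carrier R) f"
  have gc: "g x \<in> carrier R" and fg: "f (g x) = x" if "x \<in> carrier R" for x
    using f that unfolding g_def by (auto simp: bij_betw_def inv_into_into f_inv_into_f)
  define G where "G m y = bc b m \<otimes> f y [^] (b - m)" for m y
  define W where "W m x = add_pow R (b choose m) ((\<ominus> g x) [^] (b - m))" for m x
  have G: "G m y \<in> carrier R" if "y \<in> carrier R" for m y using fc that by (simp add: G_def)
  have W: "W m x \<in> carrier R" if "x \<in> carrier R" for m x using gc that by (simp add: W_def)
  have GW: "(\<Oplus>m\<in>{..<q}. G m y \<otimes> x [^] m) = (\<Oplus>m\<in>{..<q}. W m x \<otimes> y [^] m)"
    if x: "x \<in> carrier R" and y: "y \<in> carrier R" for x y
  proof -
    have "(\<Oplus>m\<in>{..<q}. G m y \<otimes> x [^] m) = (f y \<ominus> x) [^] b"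
      unfolding G_def using minus_pow_expansion_right[OF x fc[OF y] b] by simp
    also have "\<dots> = (y \<ominus> g x) [^] b" using eq[OF y gc[OF x]] fg[OF x] by simp
    also have "\<dots> = (\<Oplus>m\<in>{..<q}. W m x \<otimes> y [^] m)"
      unfolding W_def by (rule minus_pow_expansion_left[OF y gc[OF x] b])
    finally show ?thesis .
  qed
  have kb: "k \<le> b" using dominated_imp_le[OF prime_p k] .
  have fk: "(\<lambda>y. f y [^] k) \<in> carrier R \<rightarrow> carrier R" using fc by auto
  have j: "j < q" using coef_ge[OF fk] nz not_le by blast
  have "coef (G (b - k)) j = coef (W j) (b - k)"
    by (rule coef_exchange[OF G W GW]) (use b j in auto)
  also have "\<dots> = coef (\<lambda>x. \<zero>) (b - k)"
  proof (rule coef_cong)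
    show "W j x = \<zero>" if "x \<in> carrier R" for x
      using nd prime_dvd_choose_iff[OF prime_p, of b j] gc[OF that] by (simp add: W_def add_pow_eq_zero_iff)
  qed simp
  finally have "coef (\<lambda>y. bc b (b - k) \<otimes> f y [^] k) j = \<zero>"
    using kb by (simp add: G_def[abs_def] coef_const_zero)
  then have "bc b (b - k) \<otimes> coef (\<lambda>y. f y [^] k) j = \<zero>"
    using coef_smult[OF fk bc_closed] by simp
  moreover have "bc b (b - k) \<noteq> \<zero>"
    using dominated_diff[OF prime_p k] by (simp add: bc_eq_zero_iff)
  ultimately show False using nz coef_closed[OF fk] by (simp add: integral_iff)
qed

text \<open>Both a and q - 1 - a must end in a nonzero digit. The last digit of n is nonzero because
  q - 1 is prime to p; if it is p - 1, then 2n ends in p - 2, nonzero for p > 2 and different from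
  the last digit of q - 1.\<close>

lemma exponent_choice:
  assumes n: "n dvd q - 1" and lt: "n < q - 1"
  obtains a where "n dvd a" "0 < a" "a < q - 1" "a mod p \<noteq> 0" "a mod p \<noteq> p - 1"
proof -
  obtain s where s: "q = p * Suc s"
    using q_def r_pos q_gt_1 by (cases r; cases "p ^ (r - 1)") auto
  have q1: "q - 1 = p * s + (p - 1)" using s odd_p by simp
  have q1m: "(q - 1) mod p = p - 1" unfolding q1 mod_mult_self4 using odd_p by (intro mod_less) simp
  obtain m where m: "q - 1 = n * m" using n by (rule dvdE)
  have m2: "2 \<le> m" using m lt by (cases m; cases "m - 1") auto
  have n0: "n mod p \<noteq> 0"
  proof
    assume "n mod p = 0"
    then have "p dvd q - 1" using m by (simp add: dvd_eq_mod_eq_0[symmetric])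
    then show False using q1m odd_p by (simp add: dvd_eq_mod_eq_0)
  qed
  show thesis
  proof (cases "n mod p = p - 1")
    case False
    then show thesis using that[of n] n0 lt by (cases n) auto
  next
    case True
    define t where "t = n div p"
    have nt: "n = p * t + (p - 1)" unfolding t_def using True by (metis mult_div_mod_eq)
    have n2: "2 * n = p * (2 * t + 1) + (p - 2)" unfolding nt using odd_p by (simp add: algebra_simps)
    have mod2: "(2 * n) mod p = p - 2" unfolding n2 mod_mult_self4 using odd_p by (intro mod_less) simp
    have "2 * n \<le> q - 1" using m m2 by (metis mult.commute mult_le_mono2)
    moreover have "2 * n \<noteq> q - 1" using mod2 q1m odd_p by auto
    moreover have "0 < n" using n0 by (cases n) auto
    ultimately show thesis using mod2 odd_p by (intro that[of "2 * n"]) auto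
  qed
qed

text \<open>Two complementary exponents a and q - 1 - a are used together: exponents digitwise below
  both have digits at most (p - 1)/2, so the corresponding powers of f multiply without carry or
  reduction. The largest of these powers is forced to be a monomial, and then so is its factor
  f.\<close>

theorem mcconnel:
  assumes f: "bij_betw f (carrier R) (carrier R)" and n: "n dvd q - 1" "n < q - 1"
    and eq: "\<And>x y. x \<in> carrier R \<Longrightarrow> y \<in> carrier R \<Longrightarrow> (f x \<ominus> f y) [^] n = (x \<ominus> y) [^] n"
    and f0: "f \<zero> = \<zero>" and f1: "f \<one> = \<one>"
  obtains e where "\<And>x. x \<in> carrier R \<Longrightarrow> f x = x [^] (p ^ e)"
proof -
  have fc: "f x \<in> carrier R" if "x \<in> carrier R" for x using f that by (rule bij_betwE[THEN bspec])
  have fk: "(\<lambda>y. f y [^] (k::nat)) \<in> carrier R \<rightarrow> carrier R" for k using fc by auto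
  obtain a where a: "n dvd a" "0 < a" "a < q - 1" "a mod p \<noteq> 0" "a mod p \<noteq> p - 1"
    using exponent_choice[OF n] .
  define a' where "a' = q - 1 - a"
  have a': "n dvd a'" unfolding a'_def using n(1) a(1) by (rule dvd_diff_nat)
  have aq: "a < q" "a' < q" using a by (auto simp: a'_def)
  have eqb: "(f x \<ominus> f y) [^] b = (x \<ominus> y) [^] b" if b: "n dvd b" and x: "x \<in> carrier R" and y: "y \<in> carrier R" for b x y
  proof -
    obtain m where "b = n * m" using b by (rule dvdE)
    then show ?thesis using eq[OF x y] x y fc by (simp add: nat_pow_pow[symmetric])
  qed
  define S where "S k \<longleftrightarrow> dominated p k a \<and> dominated p k a'" for k
  define s where "s k = (\<Sum>i<r. dig p k i)" for k
  define F where "F k = coef (\<lambda>x. f x [^] k)" for k :: nat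
  have F_closed: "F k j \<in> carrier R" for k j unfolding F_def by (rule coef_closed[OF fk])
  have dig_a: "dig p a i + dig p a' i = (if i < r then p - 1 else 0)" for i
    using dig_complement[OF p_gt_1, of a r i] aq dig_less[OF p_pos, of a i] dig_beyond[of _ p r i]
    unfolding a'_def q_def by (auto simp: not_less)
  \<comment> \<open>The digits of a and a' in one place add up to p - 1, so a digit below both is at
    most half of that.\<close>
  have S_dig: "dig p k i + dig p k i \<le> p - 1" "r \<le> i \<Longrightarrow> dig p k i = 0" if "S k" for k i
  proof -
    have "dig p k i \<le> dig p a i" "dig p k i \<le> dig p a' i" using that by (auto simp: S_def dominated_def)
    then show "dig p k i + dig p k i \<le> p - 1" "r \<le> i \<Longrightarrow> dig p k i = 0"
      using dig_a[of i] by (auto split: if_splits)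
  qed
  have add_dig: "dig p (k + l) i = dig p k i + dig p l i" if "S k" "S l" for k l i
  proof (rule dig_add[OF p_pos])
    fix i show "dig p k i + dig p l i < p"
      using S_dig(1)[OF that(1), of i] S_dig(1)[OF that(2), of i] odd_p by linarith
  qed
  have s_add: "s (k + l) = s k + s l" if "S k" "S l" for k l
    unfolding s_def using add_dig[OF that] by (simp add: sum.distrib)
  have lt_q: "k + l < q" if "S k" "S l" for k l
    unfolding q_def using S_dig(2)[OF that(1)] S_dig(2)[OF that(2)] add_dig[OF that] by (intro dig_less_power p_gt_1) auto
  have s_pos: "0 < s k" if "S k" "k \<noteq> 0" for k
  proof (rule ccontr)
    assume "\<not> 0 < s k"
    then have "dig p k i = dig p 0 i" for i using S_dig(2)[OF that(1), of i] by (cases "i < r") (auto simp: s_def)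
    then show False using dig_eqI[OF p_gt_1] that(2) by blast
  qed
  have F_S: "S j" if "S k" "F k j \<noteq> \<zero>" for k j
    using power_coef_dominated[OF f aq(1) eqb[OF a(1)], of k j] power_coef_dominated[OF f aq(2) eqb[OF a'], of k j] that
    unfolding S_def F_def by blast
  have F_lt: "i + j < q" if "S k" "S l" "F k i \<noteq> \<zero>" "F l j \<noteq> \<zero>" for k l i j
    using lt_q F_S that by blast
  have pow_split: "F (k + l) = coef (\<lambda>x. f x [^] k \<otimes> f x [^] l)" for k l
    unfolding F_def using fc by (intro ext coef_cong) (auto simp: nat_pow_mult)
  have S_mono: "S k" if "S l" "\<And>i. dig p k i \<le> dig p l i" for k l
    using that unfolding S_def dominated_def by (meson le_trans)
  \<comment> \<open>Digit sums cannot drop: when one p^i is split off, the factor f^(p^i) has no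
    constant term because f fixes 0, so each of its exponents contributes digit sum at least
    1.\<close>
  have F_s: "s k \<le> s j" if "S k" "F k j \<noteq> \<zero>" for k j
    using that
  proof (induction k arbitrary: j rule: less_induct)
    case (less k)
    show ?case
    proof (cases "s k = 0")
      case False
      then obtain i where i: "i < r" "0 < dig p k i" by (auto simp: s_def)
      obtain l where l: "k = l + p ^ i" "\<And>j. dig p k j = dig p l j + (if j = i then 1 else 0)"
        using dig_decrement[OF p_gt_1 i(2)] by blast
      have Sl: "S l" by (rule S_mono[OF less.prems(1)]) (simp add: l(2))
      have Si: "S (p ^ i)" by (rule S_mono[OF less.prems(1)]) (simp add: l(2) dig_power[OF p_gt_1])
      have sk: "s k = s l + 1" using i(1) by (simp add: s_def l(2) sum.distrib)
      have nz: "coef (\<lambda>x. f x [^] l \<otimes> f x [^] (p ^ i)) j \<noteq> \<zero>"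
        using less.prems(2) unfolding l(1) pow_split .
      have lt: "i1 + i2 < q" if "coef (\<lambda>x. f x [^] l) i1 \<noteq> \<zero>" "coef (\<lambda>x. f x [^] (p ^ i)) i2 \<noteq> \<zero>" for i1 i2
        using that F_lt[OF Sl Si, unfolded F_def] by blast
      obtain j1 j2 where j: "j = j1 + j2" "F l j1 \<noteq> \<zero>" "F (p ^ i) j2 \<noteq> \<zero>"
        using coef_mult_nonzeroD[OF fk[of l] fk[of "p ^ i"] lt nz] unfolding F_def by blast
      have S12: "S j1" "S j2" using F_S Sl Si j by blast+
      have "l < k" using l(1) p_pos by simp
      then have "s l \<le> s j1" using less.IH Sl j(2) by blast
      moreover have "j2 \<noteq> 0"
        using j(3) coef_0[OF fk[of "p ^ i"]] f0 p_pos unfolding F_def by (metis nat_pow_zero power_eq_0_iff not_gr_zero)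
      then have "0 < s j2" using s_pos S12 by blast
      ultimately show ?thesis using s_add[OF S12] j(1) sk by simp
    qed simp
  qed
  \<comment> \<open>The largest element of \<open>S\<close> in the digitwise order; its last digit
    is nonzero by the choice of a, so c = l + 1 without borrow.\<close>
  define c where "c = (\<Sum>i<r. min (dig p a i) (dig p a' i) * p ^ i)"
  have dc: "dig p c i = min (dig p a i) (dig p a' i)" for i
  proof -
    have "dig p c i = (if i < r then min (dig p a i) (dig p a' i) else 0)"
      unfolding c_def using dig_less[OF p_pos] by (intro dig_sum p_pos) (auto intro: le_less_trans[OF min.cobounded1])
    then show ?thesis using dig_a[of i] by auto
  qed
  have S_iff: "S k \<longleftrightarrow> dominated p k c" for k unfolding S_def dominated_def dc by auto
  have Sc: "S c" unfolding S_iff dominated_def by simp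
  have c0: "0 < dig p c 0"
    using a(4,5) dig_a[of 0] r_pos unfolding dc unfolding dig_0 by auto
  obtain l where l: "c = l + p ^ 0" "\<And>j. dig p c j = dig p l j + (if j = 0 then 1 else 0)"
    using dig_decrement[OF p_gt_1 c0] by blast
  have Sl: "S l" by (rule S_mono[OF Sc]) (simp add: l(2))
  have S1: "S (p ^ 0)" by (rule S_mono[OF Sc], unfold l(2) dig_power[OF p_gt_1], simp)
  have S1': "S 1" using S1 by simp
  have sc: "s c = s l + 1" using r_pos by (simp add: s_def l(2) sum.distrib)
  \<comment> \<open>An exponent of f^c lies digitwise below c and yet has digit sum at least that of
    c.\<close>
  have Fc: "j = c" if "F c j \<noteq> \<zero>" for j
  proof (rule dig_eqI[OF p_gt_1])
    fix i
    have dom: "dig p j i \<le> dig p c i" for i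
      using F_S[OF Sc that] unfolding S_iff dominated_def by blast
    show "dig p j i = dig p c i"
    proof (cases "i < r")
      case True
      show ?thesis
      proof (rule ccontr)
        assume "dig p j i \<noteq> dig p c i"
        then have "s j < s c" unfolding s_def using dom True
          by (intro sum_strict_mono_ex1) (auto simp: order.strict_iff_order)
        then show False using F_s[OF Sc that] by simp
      qed
    next
      case False
      then show ?thesis using S_dig(2)[OF Sc, of i] dom[of i] by simp
    qed
  qed
  have Fc_sum: "F c m = (\<Oplus>i\<in>{..m}. F l i \<otimes> F 1 (m - i))" for m
  proof -
    have "F c = coef (\<lambda>x. f x [^] l \<otimes> f x [^] (1::nat))" using pow_split[of l 1] l(1) by simp
    then show ?thesis unfolding F_def
      using coef_mult[OF fk[of l] fk[of 1]] F_lt[OF Sl S1'] unfolding F_def by simp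
  qed
  have nonempty: "\<exists>j. F k j \<noteq> \<zero>" for k
  proof (rule ccontr)
    assume "\<not> (\<exists>j. F k j \<noteq> \<zero>)"
    then have "pol (F k) \<one> = \<zero>" by (simp add: pol_def)
    then show False using pol_coef[OF fk[of k], of \<one>] f1 by (simp add: F_def)
  qed
  have fin: "finite {j. F k j \<noteq> \<zero>}" for k
  proof (rule finite_subset)
    show "{j. F k j \<noteq> \<zero>} \<subseteq> {..<q}" unfolding F_def using coef_ge[OF fk] not_less by blast
  qed simp
  \<comment> \<open>In the product of f^l and f the two highest terms give a nonzero term of f^c,
    and so do the two lowest. As f^c has a single exponent, the highest and lowest exponents of f
    coincide.\<close>
  define MB MA mB mA where "MB = Max {j. F l j \<noteq> \<zero>}" "MA = Max {j. F 1 j \<noteq> \<zero>}"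
    "mB = Min {j. F l j \<noteq> \<zero>}" "mA = Min {j. F 1 j \<noteq> \<zero>}"
  have mem: "F l MB \<noteq> \<zero>" "F l mB \<noteq> \<zero>" "F 1 MA \<noteq> \<zero>" "F 1 mA \<noteq> \<zero>"
    using Max_in[OF fin, of l] Max_in[OF fin, of 1] Min_in[OF fin, of l] Min_in[OF fin, of 1] nonempty[of l] nonempty[of 1]
    unfolding MB_MA_mB_mA_def by blast+
  have upper: "i \<le> MB" "mB \<le> i" if "F l i \<noteq> \<zero>" for i
    using that fin[of l] unfolding MB_MA_mB_mA_def by auto
  have upperA: "i \<le> MA" "mA \<le> i" if "F 1 i \<noteq> \<zero>" for i
    using that fin[of 1] unfolding MB_MA_mB_mA_def by auto
  have "F c (MB + MA) = F l MB \<otimes> F 1 MA"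
  proof -
    have z: "F l i \<otimes> F 1 (MB + MA - i) = \<zero>" if "i \<le> MB + MA" "i \<noteq> MB" for i
    proof (cases "F l i = \<zero>")
      case False
      then have "MA < MB + MA - i" using upper(1)[OF False] that by simp
      then have "F 1 (MB + MA - i) = \<zero>" using upperA(1) not_less by blast
      then show ?thesis using F_closed by simp
    qed (use F_closed in simp)
    show ?thesis unfolding Fc_sum using F_closed z by (subst finsum_single[of _ MB]) auto
  qed
  then have "F c (MB + MA) \<noteq> \<zero>" using mem F_closed by (simp add: integral_iff)
  then have c1: "MB + MA = c" by (rule Fc)
  have "F c (mB + mA) = F l mB \<otimes> F 1 mA"
  proof -
    have z: "F l i \<otimes> F 1 (mB + mA - i) = \<zero>" if "i \<le> mB + mA" "i \<noteq> mB" for i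
    proof (cases "F l i = \<zero>")
      case False
      then have "mB + mA - i < mA" using upper(2)[OF False] that by simp
      then have "F 1 (mB + mA - i) = \<zero>" using upperA(2) not_less by blast
      then show ?thesis using F_closed by simp
    qed (use F_closed in simp)
    show ?thesis unfolding Fc_sum using F_closed z by (subst finsum_single[of _ mB]) auto
  qed
  then have "F c (mB + mA) \<noteq> \<zero>" using mem F_closed by (simp add: integral_iff)
  then have c2: "mB + mA = c" by (rule Fc)
  have AA: "mA = MA" using c1 c2 upper[OF mem(2)] upperA[OF mem(4)] upper(2)[OF mem(1)] upperA(2)[OF mem(3)] by linarith
  have F1: "F 1 j = (if j = MA then F 1 MA else \<zero>)" for j
  proof (cases "F 1 j = \<zero>")
    case True
    then show ?thesis by (cases "j = MA") auto
  next
    case False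
    then have "j = MA" using upperA[OF False] AA by simp
    then show ?thesis by simp
  qed
  have SMA: "S MA" "S MB" using F_S[OF S1' mem(3)] F_S[OF Sl mem(1)] .
  have MA0: "MA \<noteq> 0" using mem(3) coef_0[OF fk[of 1]] f0 unfolding F_def by (metis nat_pow_eone zero_closed)
  \<comment> \<open>The exponent \<open>MB\<close> of f^l already has digit sum at least s c - 1,
    which leaves at most 1 for \<open>MA\<close>.\<close>
  have "s MA = 1"
    using s_add[OF SMA(2,1), unfolded c1] F_s[OF Sl mem(1)] s_pos[OF SMA(1) MA0] sc by linarith
  then have "(\<Sum>i<r. dig p MA i) \<noteq> 0" by (simp add: s_def)
  then obtain i where i: "i < r" "0 < dig p MA i" by auto
  obtain t where t: "MA = t + p ^ i" "\<And>j. dig p MA j = dig p t j + (if j = i then 1 else 0)"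
    using dig_decrement[OF p_gt_1 i(2)] by blast
  have St: "S t" by (rule S_mono[OF SMA(1)]) (simp add: t(2))
  have "s MA = s t + 1" using i(1) by (simp add: s_def t(2) sum.distrib)
  then have "t = 0" using \<open>s MA = 1\<close> s_pos[OF St] by auto
  then have MA: "MA = p ^ i" using t(1) by simp
  have MAq: "MA < q" using lt_q[OF SMA(1), of 0] S_mono[OF Sc, of 0] by simp
  have fx: "f x = F 1 MA \<otimes> x [^] MA" if x: "x \<in> carrier R" for x
  proof -
    have "f x = pol (F 1) x" using pol_coef[OF fk[of 1] x] x fc by (simp add: F_def)
    also have "\<dots> = pol (\<lambda>k. if k = MA then F 1 MA else \<zero>) x"
      using F1 by (metis (no_types, lifting) ext)
    also have "\<dots> = F 1 MA \<otimes> x [^] MA" using pol_single[OF MAq x F_closed] .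
    finally show ?thesis .
  qed
  have "F 1 MA = \<one>" using fx[of \<one>] f1 F_closed by simp
  then have "f x = x [^] (p ^ i)" if "x \<in> carrier R" for x using fx[OF that] that MA by simp
  then show thesis by (rule that)
qed

end

section \<open>Functions whose difference quotients lie in a proper additive subgroup\<close>

context cring begin

lemma frobenius_minus:
  assumes p: "Factorial_Ring.prime p" "add_pow R (p::nat) \<one> = \<zero>" and x: "x \<in> carrier R" and y: "y \<in> carrier R"
  shows "(x \<ominus> y) [^] (p ^ i) = x [^] (p ^ i) \<ominus> y [^] (p ^ i)"
proof -
  have xy: "(x \<ominus> y) \<oplus> y = x" using x y by (simp add: minus_eq a_assoc l_neg)
  have "x [^] (p ^ i) = (x \<ominus> y) [^] (p ^ i) \<oplus> y [^] (p ^ i)"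
    using frobenius_add[OF p, of "x \<ominus> y" y i] x y unfolding xy by simp
  moreover define s t where "s = (x \<ominus> y) [^] (p ^ i)" "t = y [^] (p ^ i)"
  moreover have "s \<in> carrier R" "t \<in> carrier R" using x y by (auto simp: s_t_def)
  moreover from this have "s \<oplus> t \<ominus> t = s" by (simp add: minus_eq a_assoc r_neg)
  ultimately show ?thesis by simp
qed

end

section \<open>Linearized polynomials and additive subgroups\<close>

context odd_finite_field begin

lemma pow_nonzero: "x \<in> carrier R \<Longrightarrow> x \<noteq> \<zero> \<Longrightarrow> x [^] (n::nat) \<noteq> \<zero>"
  by (induction n) (auto simp: integral_iff)

lemma frobenius_finsum:
  assumes "finite A" "\<And>i. i \<in> A \<Longrightarrow> f i \<in> carrier R"
  shows "(\<Oplus>i\<in>A. f i) [^] p = (\<Oplus>i\<in>A. f i [^] p)"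
  using assms
proof (induction A rule: finite_induct)
  case empty
  then show ?case using p_pos by (simp add: nat_pow_zero)
next
  case (insert a A)
  then have "(\<Oplus>i\<in>A. f i) \<in> carrier R" by (intro finsum_closed) auto
  then show ?case using insert frobenius_add[OF prime_p char_p, of "f a" "\<Oplus>i\<in>A. f i" 1] by simp
qed

text \<open>The p multiples of 1 are distinct roots of X^p - X and therefore exhaust its
  roots.\<close>

lemma prime_field_element:
  assumes t: "t \<in> carrier R" and tp: "t [^] p = t"
  obtains k where "t = add_pow R (k::nat) \<one>"
proof -
  let ?A = "(\<lambda>k. add_pow R (k::nat) \<one>) ` {..<p}"
  let ?B = "insert \<zero> {x \<in> carrier R. x [^] (p - 1) = \<one>}"
  have finB: "finite ?B" using finite_carrier by simp
  have AB: "?A \<subseteq> ?B"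
  proof clarsimp
    fix k assume "add_pow R (k::nat) \<one> \<noteq> \<zero>"
    define z where "z = add_pow R k \<one>"
    have z: "z \<in> carrier R" "z \<noteq> \<zero>" using \<open>add_pow R k \<one> \<noteq> \<zero>\<close> by (auto simp: z_def)
    have "add_pow R n \<one> [^] p = add_pow R n \<one>" for n :: nat
    proof (induction n)
      case (Suc n)
      then show ?case using frobenius_add[OF prime_p char_p, of "add_pow R n \<one>" \<one> 1] by simp
    qed (use p_pos in \<open>simp add: nat_pow_zero\<close>)
    then have "z [^] p = z" by (simp add: z_def)
    moreover have "z [^] p = z [^] (p - 1) \<otimes> z" using p_pos z by (cases p) simp_all
    ultimately have "z [^] (p - 1) \<otimes> z = \<one> \<otimes> z" using z by simp
    then have "z [^] (p - 1) = \<one>" using z m_rcancel[of z "z [^] (p - 1)" \<one>] by simp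
    then show "add_pow R k \<one> [^] (p - Suc 0) = \<one>" by (simp add: z_def)
  qed
  have inj: "inj_on (\<lambda>k. add_pow R (k::nat) \<one>) {..<p}"
  proof -
    have aux: "k = l" if kl: "k \<le> l" "l < p" and eq: "add_pow R k \<one> = add_pow R l \<one>" for k l :: nat
    proof -
      have "add_pow R l \<one> = add_pow R k \<one> \<oplus> add_pow R (l - k) \<one>"
        using kl by (simp add: add.nat_pow_mult)
      then have "add_pow R (l - k) \<one> = \<zero>"
        using eq add.l_cancel_one[of "add_pow R k \<one>" "add_pow R (l - k) \<one>"] by simp
      then have "p dvd l - k" by (simp add: add_pow_one_eq_zero_iff)
      then show ?thesis using kl by (metis diff_is_0_eq diff_le_self dvd_imp_le le_antisym le_less_trans not_gr_zero not_le)
    qed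
    show ?thesis by (rule inj_onI) (metis aux lessThan_iff nat_le_linear)
  qed
  have "card ?B \<le> Suc (card {x \<in> carrier R. x [^] (p - 1) = \<one>})" by (rule card_insert_le_m1) auto
  then have "card ?B \<le> card ?A"
    using num_roots_le_deg[OF finite_carrier, of "p - 1"] odd_p card_image[OF inj] by simp
  then have "?A = ?B" using AB finB by (intro card_seteq) auto
  moreover have "t \<in> ?B"
  proof (cases "t = \<zero>")
    case False
    have "t [^] p = t [^] (p - 1) \<otimes> t" using p_pos t by (cases p) simp_all
    then have "t [^] (p - 1) \<otimes> t = \<one> \<otimes> t" using tp t by simp
    then have "t [^] (p - 1) = \<one>" using t False m_rcancel[of t "t [^] (p - 1)" \<one>] by simp
    then show ?thesis using t by simp
  qed simp
  ultimately have "t \<in> ?A" by simp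
  then show thesis using that by blast
qed

text \<open>The linearized polynomial with coefficients u, an additive map; exponents stop at
  p^(r-1) since z^q = z.\<close>

definition lam :: "(nat \<Rightarrow> 'a) \<Rightarrow> 'a \<Rightarrow> 'a" where
  "lam u z = (\<Oplus>i\<in>{..<r}. u i \<otimes> z [^] (p ^ i))"

context
  fixes u :: "nat \<Rightarrow> 'a" assumes u: "\<And>i. u i \<in> carrier R"
begin

lemma lam_closed: "z \<in> carrier R \<Longrightarrow> lam u z \<in> carrier R"
  unfolding lam_def using u by (intro finsum_closed) auto

lemma lam_add:
  assumes "x \<in> carrier R" "y \<in> carrier R"
  shows "lam u (x \<oplus> y) = lam u x \<oplus> lam u y"
proof -
  have "lam u x \<oplus> lam u y = (\<Oplus>i\<in>{..<r}. u i \<otimes> x [^] (p ^ i) \<oplus> u i \<otimes> y [^] (p ^ i))"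
    unfolding lam_def using u assms by (subst finsum_addf) auto
  also have "\<dots> = lam u (x \<oplus> y)" unfolding lam_def using u assms
    by (intro finsum_cong') (auto simp: frobenius_add[OF prime_p char_p] r_distr)
  finally show ?thesis by simp
qed

lemma lam_zero: "lam u \<zero> = \<zero>"
  unfolding lam_def using u p_pos by (simp add: nat_pow_zero)

lemma lam_add_pow: "x \<in> carrier R \<Longrightarrow> lam u (add_pow R (n::nat) x) = add_pow R n (lam u x)"
  by (induction n) (simp_all add: lam_zero lam_add lam_closed)

text \<open>The top term z^(p^r) wraps round to z, so the coefficients move cyclically. The index (i
  + r - 1) mod r is i - 1 modulo r, protected against truncated subtraction at i = 0.\<close>

lemma lam_frobenius:
  assumes z: "z \<in> carrier R"
  shows "lam u z [^] p = lam (\<lambda>i. u ((i + r - 1) mod r) [^] p) z"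
proof -
  obtain n where n: "r = Suc n" using r_pos by (cases r) auto
  have ri: "{..<r} = {..n}" using n by auto
  have idx0: "(0 + r - 1) mod r = n" using n by simp
  have idxS: "(Suc i + r - 1) mod r = i" if "i < n" for i
  proof -
    have "Suc i + r - 1 = i + r" by simp
    then show ?thesis using that n by (simp only: mod_add_self2) simp
  qed
  note idx = idx0 idxS
  have pw: "x [^] (p ^ i * p) = (x [^] (p ^ i)) [^] p" if "x \<in> carrier R" for x i
    using that by (simp add: nat_pow_pow)
  have "lam u z [^] p = (\<Oplus>i\<in>{..n}. u i [^] p \<otimes> z [^] (p ^ Suc i))"
    unfolding lam_def ri using u z
    by (subst frobenius_finsum) (auto intro!: finsum_cong' simp: nat_pow_distrib pw mult.commute[of p])
  also have "\<dots> = (\<Oplus>i\<in>{..n}. u ((i + r - 1) mod r) [^] p \<otimes> z [^] (p ^ i))"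
  proof (cases n)
    case 0
    then show ?thesis using n u z pow_q q_def by simp
  next
    case (Suc m)
    have zz: "z [^] (p ^ Suc n) = z" using pow_q[OF z] q_def n by simp
    have "(\<Oplus>i\<in>{..Suc m}. u i [^] p \<otimes> z [^] (p ^ Suc i)) =
        u (Suc m) [^] p \<otimes> z [^] (p ^ Suc n) \<oplus> (\<Oplus>i\<in>{..m}. u i [^] p \<otimes> z [^] (p ^ Suc i))"
      using u z Suc by (subst finsum_Suc) auto
    also have "\<dots> = (\<Oplus>i\<in>{..m}. u ((Suc i + r - 1) mod r) [^] p \<otimes> z [^] (p ^ Suc i)) \<oplus>
        u ((0 + r - 1) mod r) [^] p \<otimes> z [^] (p ^ 0)"
      unfolding zz using u z Suc idx
      by (subst a_comm) (auto intro!: arg_cong2[of _ _ _ _ "(\<oplus>)"] finsum_cong' finsum_closed)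
    also have "\<dots> = (\<Oplus>i\<in>{..Suc m}. u ((i + r - 1) mod r) [^] p \<otimes> z [^] (p ^ i))"
      using u z by (subst finsum_Suc2) auto
    finally show ?thesis unfolding Suc .
  qed
  finally show ?thesis unfolding lam_def ri .
qed

lemma lam_combine:
  assumes v: "\<And>i. v i \<in> carrier R" and b: "b \<in> carrier R" and z: "z \<in> carrier R"
  shows "lam (\<lambda>i. v i \<ominus> b \<otimes> u i) z = lam v z \<ominus> b \<otimes> lam u z"
proof -
  have vl: "lam v z \<in> carrier R" using v z unfolding lam_def by (intro finsum_closed) auto
  have wl: "lam (\<lambda>i. v i \<ominus> b \<otimes> u i) z \<in> carrier R"
    using u v z b unfolding lam_def by (intro finsum_closed) auto
  have "lam (\<lambda>i. v i \<ominus> b \<otimes> u i) z \<oplus> b \<otimes> lam u z =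
      (\<Oplus>i\<in>{..<r}. (v i \<ominus> b \<otimes> u i) \<otimes> z [^] (p ^ i)) \<oplus> (\<Oplus>i\<in>{..<r}. b \<otimes> (u i \<otimes> z [^] (p ^ i)))"
    unfolding lam_def using u v z b by (subst finsum_rdistr) auto
  also have "\<dots> = (\<Oplus>i\<in>{..<r}. (v i \<ominus> b \<otimes> u i) \<otimes> z [^] (p ^ i) \<oplus> b \<otimes> (u i \<otimes> z [^] (p ^ i)))"
    using u v z b by (subst finsum_addf) auto
  also have "\<dots> = lam v z" unfolding lam_def
  proof (rule finsum_cong'[OF refl])
    fix i
    define s t w where "s = v i" "t = u i" "w = z [^] (p ^ i)"
    have stw: "s \<in> carrier R" "t \<in> carrier R" "w \<in> carrier R" using u v z by (auto simp: s_t_w_def)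
    have "(s \<ominus> b \<otimes> t) \<otimes> w \<oplus> b \<otimes> (t \<otimes> w) = s \<otimes> w" using stw b by algebra
    then show "(v i \<ominus> b \<otimes> u i) \<otimes> z [^] (p ^ i) \<oplus> b \<otimes> (u i \<otimes> z [^] (p ^ i)) = v i \<otimes> z [^] (p ^ i)"
      unfolding s_t_w_def .
  qed (use v z in auto)
  finally have "lam v z = lam (\<lambda>i. v i \<ominus> b \<otimes> u i) z \<oplus> b \<otimes> lam u z" by simp
  then show ?thesis using vl wl b z lam_closed[OF z] by (simp add: minus_eq a_assoc r_neg)
qed

end

text \<open>Among linearized polynomials with kernel inside H one takes a largest kernel. An element
  e of H outside it could be adjoined together with its multiples, so the kernel is H itself;
  properness of H then rules out the zero polynomial.\<close>

lemma linearized_annihilator: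
  assumes H: "additive_subgroup H R" and proper: "H \<noteq> carrier R"
  obtains u i where "\<And>i. u i \<in> carrier R" "i < r" "u i \<noteq> \<zero>" "\<And>h. h \<in> H \<Longrightarrow> lam u h = \<zero>"
proof -
  interpret H: additive_subgroup H R by (rule H)
  define ker where "ker u = {z \<in> carrier R. lam u z = \<zero>}" for u
  define U where "U = {u. (\<forall>i. u i \<in> carrier R) \<and> ker u \<subseteq> H}"
  have finH: "finite H" using H.a_subset finite_carrier finite_subset by blast
  \<comment> \<open>\<open>lam d\<close> is the identity, whose zero kernel lies in H; it starts the
    maximality argument.\<close>
  define d where "d i = (if i = 0 then \<one> else \<zero>)" for i :: nat
  have "lam d z = z" if "z \<in> carrier R" for z
    unfolding lam_def d_def using that r_pos by (subst finsum_single[of _ 0]) auto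
  then have "d \<in> U" by (auto simp: U_def ker_def d_def)
  moreover have bd: "card (ker u) < Suc (card H)" if "u \<in> U" for u
    using that finH by (auto simp: U_def less_Suc_eq_le intro: card_mono)
  ultimately obtain u where u: "u \<in> U" and max: "\<And>v. v \<in> U \<Longrightarrow> card (ker v) \<le> card (ker u)"
    using ex_has_greatest_nat[of "\<lambda>u. u \<in> U" d "\<lambda>u. card (ker u)" "Suc (card H)"]
    by (metis less_imp_le)
  have uc: "u i \<in> carrier R" for i using u by (simp add: U_def)
  have "ker u = H"
  proof (rule ccontr)
    assume "ker u \<noteq> H"
    then obtain e where e: "e \<in> H" "e \<notin> ker u" using u by (auto simp: U_def)
    have ec: "e \<in> carrier R" using e(1) H.a_subset by blast
    define b where "b = lam u e"
    have b: "b \<in> carrier R" "b \<noteq> \<zero>" using lam_closed[OF uc ec] e ec by (auto simp: b_def ker_def)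
    \<comment> \<open>With y = \<open>lam u z\<close>, the value of \<open>lam v\<close> at z is y^p
      - b^(p-1) y. It vanishes only when y/b lies in the prime field, so z then differs from a
      multiple of e by an element of the old kernel.\<close>
    define v where "v i = u ((i + r - 1) mod r) [^] p \<ominus> b [^] (p - 1) \<otimes> u i" for i
    have vc: "v i \<in> carrier R" for i using uc b by (simp add: v_def)
    have lv: "lam v z = lam u z [^] p \<ominus> b [^] (p - 1) \<otimes> lam u z" if z: "z \<in> carrier R" for z
      unfolding v_def lam_frobenius[OF uc z] using uc b z by (intro lam_combine) auto
    have bp: "b [^] p = b [^] (p - 1) \<otimes> b" using p_pos b by (cases p) simp_all
    have kv: "z \<in> H" if z: "z \<in> ker v" for z
    proof -
      have zc: "z \<in> carrier R" using z by (simp add: ker_def)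
      define y where "y = lam u z"
      have y: "y \<in> carrier R" using lam_closed[OF uc zc] by (simp add: y_def)
      have yp: "y [^] p = b [^] (p - 1) \<otimes> y" using z lv[OF zc] y b by (simp add: ker_def y_def)
      define t where "t = y \<otimes> inv b"
      have ib: "inv b \<in> carrier R" "b \<otimes> inv b = \<one>" using b field_Units by auto
      have tb: "y = t \<otimes> b" using ib b y unfolding t_def by (simp add: m_assoc m_comm[of "inv b" b])
      have t: "t \<in> carrier R" using y ib by (simp add: t_def)
      have "t [^] p \<otimes> b [^] p = t \<otimes> b [^] p"
        using yp unfolding tb bp using t b by (simp add: nat_pow_distrib bp m_ac)
      then have "t [^] p = t"
        using t b pow_nonzero[OF b, of p] m_rcancel[of "b [^] p" "t [^] p" t] by simp
      then obtain k where k: "t = add_pow R (k::nat) \<one>" using prime_field_element[OF t] by blast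
      have ke: "add_pow R k e \<in> carrier R" "add_pow R k e \<in> H"
      proof -
        show "add_pow R k e \<in> H" by (induction k) (use e(1) in \<open>auto\<close>)
        show "add_pow R k e \<in> carrier R" using ec by simp
      qed
      have "y = lam u (add_pow R k e)"
        using tb b ec unfolding k by (simp add: lam_add_pow[OF uc] b_def add_pow_ldistr)
      moreover have "z = (z \<ominus> add_pow R k e) \<oplus> add_pow R k e" using zc ke by (simp add: minus_eq a_assoc l_neg)
      then have "y = lam u (z \<ominus> add_pow R k e) \<oplus> lam u (add_pow R k e)"
        unfolding y_def using lam_add[OF uc, of "z \<ominus> add_pow R k e" "add_pow R k e"] zc ke by simp
      ultimately have "lam u (z \<ominus> add_pow R k e) = \<zero>"
        using y zc ke lam_closed[OF uc] add.r_cancel_one'[of y "lam u (z \<ominus> add_pow R k e)"] by simp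
      then have "z \<ominus> add_pow R k e \<in> H" using u zc ke by (auto simp: U_def ker_def)
      then have "(z \<ominus> add_pow R k e) \<oplus> add_pow R k e \<in> H" using ke by (intro H.a_closed)
      then show ?thesis using \<open>z = _ \<oplus> _\<close> by simp
    qed
    then have "v \<in> U" using vc by (auto simp: U_def)
    moreover have "card (ker u) < card (ker v)"
    proof (rule psubset_card_mono)
      show "finite (ker v)" using finite_carrier by (simp add: ker_def)
      have "ker u \<subseteq> ker v" using lv b p_pos by (auto simp: ker_def nat_pow_zero)
      moreover have "e \<in> ker v" using lv[OF ec] ec b bp by (simp add: ker_def b_def[symmetric])
      ultimately show "ker u \<subset> ker v" using e by blast
    qed
    ultimately show False using max by (simp add: leD)
  qed
  then have ann: "lam u h = \<zero>" if "h \<in> H" for h using that by (auto simp: ker_def)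
  have "\<exists>i<r. u i \<noteq> \<zero>"
  proof (rule ccontr)
    assume no: "\<not> ?thesis"
    then have "lam u z = \<zero>" if "z \<in> carrier R" for z
    proof -
      have "lam u z = (\<Oplus>i\<in>{..<r}. \<zero>)" unfolding lam_def using no that by (intro finsum_cong') auto
      then show ?thesis by simp
    qed
    then have "ker u = carrier R" by (auto simp: ker_def)
    then show False using \<open>ker u = H\<close> proper by simp
  qed
  then obtain i where "i < r" "u i \<noteq> \<zero>" by blast
  then show thesis using uc ann by (intro that)
qed

end

section \<open>Rigidity of functions from their difference quotients\<close>

context odd_finite_field begin

lemma coef_mult_power:
  assumes h: "h \<in> carrier R \<rightarrow> carrier R" and lt: "\<And>i. coef h i \<noteq> \<zero> \<Longrightarrow> i + m < q" and m: "m < q"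
  shows "coef (\<lambda>x. h x \<otimes> x [^] m) (k + m) = coef h k"
    and "coef (\<lambda>x. h x \<otimes> x [^] m) n \<noteq> \<zero> \<Longrightarrow> \<exists>i. n = i + m \<and> coef h i \<noteq> \<zero>"
proof -
  have g: "(\<lambda>x. x [^] m) \<in> carrier R \<rightarrow> carrier R" by simp
  have cg: "coef (\<lambda>x. x [^] m) k = (if k = m then \<one> else \<zero>)" for k
  proof -
    have "coef (\<lambda>x. x [^] m) k = coef (\<lambda>x. \<one> \<otimes> x [^] m) k" by (intro coef_cong) auto
    then show ?thesis using coef_monom[OF m, of \<one>] by simp
  qed
  have lt': "i + j < q" if "coef h i \<noteq> \<zero>" "coef (\<lambda>x. x [^] m) j \<noteq> \<zero>" for i j
    using that lt unfolding cg by (auto split: if_splits)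
  have "coef (\<lambda>x. h x \<otimes> x [^] m) (k + m) = (\<Oplus>i\<in>{..k + m}. coef h i \<otimes> coef (\<lambda>x. x [^] m) (k + m - i))"
    using coef_mult[OF h g lt'] .
  also have "\<dots> = coef h k \<otimes> coef (\<lambda>x. x [^] m) (k + m - k)"
  proof (rule finsum_single)
    fix i assume "i \<in> {..k + m}" "i \<noteq> k"
    then have "k + m - i \<noteq> m" by auto
    then show "coef h i \<otimes> coef (\<lambda>x. x [^] m) (k + m - i) = \<zero>" using coef_closed[OF h] by (simp add: cg)
  qed (use coef_closed[OF h] in \<open>auto simp: cg\<close>)
  finally show "coef (\<lambda>x. h x \<otimes> x [^] m) (k + m) = coef h k" using coef_closed[OF h] by (simp add: cg)
  assume "coef (\<lambda>x. h x \<otimes> x [^] m) n \<noteq> \<zero>"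
  then obtain i j where "n = i + j" "coef h i \<noteq> \<zero>" "coef (\<lambda>x. x [^] m) j \<noteq> \<zero>"
    using coef_mult_nonzeroD[OF h g lt'] by blast
  then show "\<exists>i. n = i + m \<and> coef h i \<noteq> \<zero>" by (auto simp: cg split: if_splits)
qed

text \<open>A linearized polynomial killing H turns the hypothesis into an equation; multiplying by
  (y - x)^N, N = 1 + p + ... + p^(r-1), clears denominators and yields an identity whose two sides
  are u_i E(y)^(p^i) (y - x)^(N - p^i) and u_i E(x)^(p^i) (y - x)^(N - p^i), summed over i.
  Comparing coefficients reduces E^(p^j0) to a multiple of y^(p^j0), and E 1 = 0 removes
  that.\<close>

theorem additive_difference_quotients:
  assumes H: "additive_subgroup H R" and proper: "H \<noteq> carrier R"
    and E: "E \<in> carrier R \<rightarrow> carrier R"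
    and dq: "\<And>x y. x \<in> carrier R \<Longrightarrow> y \<in> carrier R \<Longrightarrow> x \<noteq> y \<Longrightarrow> (E y \<ominus> E x) \<otimes> inv (y \<ominus> x) \<in> H"
    and E0: "E \<zero> = \<zero>" and E1: "E \<one> = \<zero>" and x: "x \<in> carrier R"
  shows "E x = \<zero>"
proof -
  obtain u j0 where u: "\<And>i. u i \<in> carrier R" and j0: "j0 < r" "u j0 \<noteq> \<zero>"
    and ann: "\<And>h. h \<in> H \<Longrightarrow> lam u h = \<zero>"
    using linearized_annihilator[OF H proper] by metis
  have Ec [simp]: "E x \<in> carrier R" if "x \<in> carrier R" for x using E that by auto
  define EE where "EE i y = E y [^] (p ^ i)" for i :: nat and y
  have EEc [simp]: "EE i y \<in> carrier R" if "y \<in> carrier R" for i y using that by (simp add: EE_def)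
  have EEf: "EE i \<in> carrier R \<rightarrow> carrier R" for i by auto
  \<comment> \<open>The exponents N - p^i: digit 1 in the first r places except for a 0 in place
    i.\<close>
  define n where "n i = (\<Sum>l<r. (if l = i then 0 else 1) * p ^ l)" for i :: nat
  define N where "N = (\<Sum>l<r. 1 * p ^ l)"
  have dn: "dig p (n i) l = (if l < r \<and> l \<noteq> i then 1 else 0)" for i l
    unfolding n_def using p_gt_1 by (subst dig_sum) auto
  have nq: "n i < q" for i unfolding q_def by (rule dig_less_power[OF p_gt_1]) (simp add: dn)
  have nN: "N = n i + p ^ i" if "i < r" for i
  proof -
    have "N = (\<Sum>l<r. (if l = i then 0 else 1) * p ^ l + (if l = i then p ^ i else 0))"
      unfolding N_def by (intro sum.cong) auto
    then show ?thesis using that unfolding n_def by (simp add: sum.distrib)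
  qed
  define c where "c i y = u i \<otimes> EE i y" for i y
  have cc [simp]: "c i y \<in> carrier R" if "y \<in> carrier R" for i y using that u by (simp add: c_def)
  define G where "G k y = (\<Oplus>i\<in>{..<r}. c i y \<otimes> (bc (n i) k \<otimes> y [^] (n i - k)))" for k y
  define W where "W j x = (\<Oplus>i\<in>{..<r}. c i x \<otimes> add_pow R (n i choose j) ((\<ominus> x) [^] (n i - j)))" for j x
  have G: "G k y \<in> carrier R" if "y \<in> carrier R" for k y
    unfolding G_def using that by (intro finsum_closed) auto
  have W: "W j x \<in> carrier R" if "x \<in> carrier R" for j x
    unfolding W_def using that by (intro finsum_closed) auto
  have key: "(\<Oplus>i\<in>{..<r}. c i y \<otimes> (y \<ominus> x) [^] n i) = (\<Oplus>i\<in>{..<r}. c i x \<otimes> (y \<ominus> x) [^] n i)"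
    if xy: "x \<in> carrier R" "y \<in> carrier R" for x y
  proof (cases "x = y")
    case False
    define w where "w = y \<ominus> x"
    have w: "w \<in> carrier R" "w \<noteq> \<zero>" using False xy by (auto simp: w_def)
    then have iw: "inv w \<in> carrier R" "inv w \<otimes> w = \<one>" using field_Units by auto
    define t where "t = (E y \<ominus> E x) \<otimes> inv w"
    have t: "t \<in> carrier R" using xy iw by (simp add: t_def)
    have tw: "t \<otimes> w = E y \<ominus> E x" using xy iw w by (simp add: t_def m_assoc)
    have summand: "c i y \<otimes> w [^] n i = w [^] N \<otimes> (u i \<otimes> t [^] (p ^ i)) \<oplus> c i x \<otimes> w [^] n i" if i: "i < r" for i
    proof -
      have "t [^] (p ^ i) \<otimes> w [^] (p ^ i) = EE i y \<ominus> EE i x"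
        using t w xy by (simp add: nat_pow_distrib[symmetric] tw EE_def frobenius_minus[OF prime_p char_p])
      moreover have "w [^] N = w [^] n i \<otimes> w [^] (p ^ i)" using w nN[OF i] by (simp add: nat_pow_mult)
      moreover define a b v s f g where "a = t [^] (p ^ i)" "b = w [^] (p ^ i)" "v = w [^] n i" "s = u i" "f = EE i y" "g = EE i x"
      moreover have cl: "a \<in> carrier R" "b \<in> carrier R" "v \<in> carrier R" "s \<in> carrier R" "f \<in> carrier R" "g \<in> carrier R"
        using t w u xy by (auto simp: a_b_v_s_f_g_def)
      ultimately have 1: "a \<otimes> b = f \<ominus> g" and 2: "w [^] N = v \<otimes> b" by auto
      have "(v \<otimes> b) \<otimes> (s \<otimes> a) = s \<otimes> v \<otimes> (a \<otimes> b)" using cl by (simp add: m_ac)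
      also have "\<dots> \<oplus> (s \<otimes> g) \<otimes> v = s \<otimes> v \<otimes> (f \<ominus> g) \<oplus> (s \<otimes> g) \<otimes> v" unfolding 1 ..
      also have "\<dots> = s \<otimes> v \<otimes> f" using cl by algebra
      also have "\<dots> = (s \<otimes> f) \<otimes> v" using cl by (simp add: m_ac)
      finally show ?thesis unfolding c_def 2 using cl unfolding a_b_v_s_f_g_def by simp
    qed
    have "(\<Oplus>i\<in>{..<r}. c i y \<otimes> w [^] n i) =
        (\<Oplus>i\<in>{..<r}. w [^] N \<otimes> (u i \<otimes> t [^] (p ^ i)) \<oplus> c i x \<otimes> w [^] n i)"
      using summand w xy u t by (intro finsum_cong') auto
    also have "\<dots> = (\<Oplus>i\<in>{..<r}. w [^] N \<otimes> (u i \<otimes> t [^] (p ^ i))) \<oplus> (\<Oplus>i\<in>{..<r}. c i x \<otimes> w [^] n i)"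
      using w xy u t by (intro finsum_addf) auto
    also have "(\<Oplus>i\<in>{..<r}. w [^] N \<otimes> (u i \<otimes> t [^] (p ^ i))) = w [^] N \<otimes> lam u t"
      unfolding lam_def using w u t by (intro finsum_rdistr[symmetric]) auto
    also have "lam u t = \<zero>" using ann dq[OF xy False] by (simp add: t_def w_def)
    finally show ?thesis using w xy by (simp add: w_def finsum_closed)
  qed simp
  have ex: "(\<Oplus>k\<in>{..<q}. G k y \<otimes> x [^] k) = (\<Oplus>j\<in>{..<q}. W j x \<otimes> y [^] j)"
    if xy: "x \<in> carrier R" "y \<in> carrier R" for x y
  proof -
    have "(\<Oplus>k\<in>{..<q}. G k y \<otimes> x [^] k) =
        (\<Oplus>k\<in>{..<q}. \<Oplus>i\<in>{..<r}. c i y \<otimes> ((bc (n i) k \<otimes> y [^] (n i - k)) \<otimes> x [^] k))"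
      unfolding G_def using xy by (intro finsum_cong') (auto simp: finsum_ldistr m_assoc intro!: finsum_closed)
    also have "\<dots> = (\<Oplus>i\<in>{..<r}. \<Oplus>k\<in>{..<q}. c i y \<otimes> ((bc (n i) k \<otimes> y [^] (n i - k)) \<otimes> x [^] k))"
      using xy by (intro finsum_swap) auto
    also have "\<dots> = (\<Oplus>i\<in>{..<r}. c i y \<otimes> (y \<ominus> x) [^] n i)"
      using xy by (intro finsum_cong') (auto simp: minus_pow_expansion_right[OF xy nq] finsum_rdistr)
    also have "\<dots> = (\<Oplus>i\<in>{..<r}. c i x \<otimes> (y \<ominus> x) [^] n i)" by (rule key[OF xy])
    also have "\<dots> = (\<Oplus>i\<in>{..<r}. \<Oplus>j\<in>{..<q}. c i x \<otimes> (add_pow R (n i choose j) ((\<ominus> x) [^] (n i - j)) \<otimes> y [^] j))"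
      using xy by (intro finsum_cong') (auto simp: minus_pow_expansion_left[OF xy(2,1) nq] finsum_rdistr intro!: finsum_closed)
    also have "\<dots> = (\<Oplus>j\<in>{..<q}. \<Oplus>i\<in>{..<r}. c i x \<otimes> (add_pow R (n i choose j) ((\<ominus> x) [^] (n i - j)) \<otimes> y [^] j))"
      using xy by (intro finsum_swap) auto
    also have "\<dots> = (\<Oplus>j\<in>{..<q}. W j x \<otimes> y [^] j)"
      unfolding W_def using xy by (intro finsum_cong') (auto simp: finsum_ldistr m_assoc intro!: finsum_closed)
    finally show ?thesis .
  qed
  \<comment> \<open>The exponents of y that the right-hand side allows. Their digits are 0 or 1,
    because those of each \<open>n i\<close> are.\<close>
  define B where "B = {j. \<exists>i<r. dominated p j (n i)}"
  have coefG: "coef (G k) j = \<zero>" if k: "k < q" and j: "j < q" "j \<notin> B" for k j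
  proof -
    have "coef (G k) j = coef (W j) k" by (rule coef_exchange[OF G W ex k j(1)])
    also have "\<dots> = coef (\<lambda>x. \<zero>) k"
    proof (rule coef_cong)
      fix x assume x: "x \<in> carrier R"
      have "W j x = (\<Oplus>i\<in>{..<r}. \<zero>)" unfolding W_def
      proof (rule finsum_cong'[OF refl])
        fix i assume "i \<in> {..<r}"
        then have "p dvd (n i choose j)" using j(2) prime_dvd_choose_iff[OF prime_p] by (auto simp: B_def)
        then show "c i x \<otimes> add_pow R (n i choose j) ((\<ominus> x) [^] (n i - j)) = \<zero>"
          using x by (simp add: add_pow_dvd_zero[OF char_p])
      qed auto
      then show "W j x = \<zero>" by simp
    qed simp
    finally show ?thesis by (simp add: coef_const_zero)
  qed
  have B_dig: "dig p k l \<le> 1" "r \<le> l \<Longrightarrow> dig p k l = 0" if kB: "k \<in> B" for k l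
  proof -
    obtain i where "dig p k l \<le> dig p (n i) l" using kB unfolding B_def dominated_def by blast
    then show "dig p k l \<le> 1" "r \<le> l \<Longrightarrow> dig p k l = 0" by (auto simp: dn split: if_splits)
  qed
  \<comment> \<open>The coefficient of x^(n i) isolates one summand, since among the l < r the
    number \<open>n i\<close> is digitwise below \<open>n l\<close> only for l = i.\<close>
  have suppE: "j \<in> B" if i: "i < r" "u i \<noteq> \<zero>" and nz: "coef (EE i) j \<noteq> \<zero>" for i j
  proof (rule ccontr)
    assume nB: "j \<notin> B"
    have j: "j < q" using coef_ge[OF EEf] nz not_less by blast
    have bc0: "bc (n l) (n i) = \<zero>" if "l < r" "l \<noteq> i" for l
      unfolding bc_eq_zero_iff dominated_def using that by (auto simp: dn intro!: exI[of _ l])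
    have "G (n i) y = (u i \<otimes> bc (n i) (n i)) \<otimes> EE i y" if y: "y \<in> carrier R" for y
      unfolding G_def using i y bc0 u by (subst finsum_single[of _ i]) (auto simp: c_def m_ac)
    then have "coef (G (n i)) j = coef (\<lambda>y. (u i \<otimes> bc (n i) (n i)) \<otimes> EE i y) j"
      using u by (intro coef_cong) auto
    also have "\<dots> = (u i \<otimes> bc (n i) (n i)) \<otimes> coef (EE i) j" using u by (intro coef_smult EEf) auto
    finally have "(u i \<otimes> bc (n i) (n i)) \<otimes> coef (EE i) j = \<zero>" using coefG[OF nq j nB] by simp
    moreover have "bc (n i) (n i) \<noteq> \<zero>" by (simp add: bc_eq_zero_iff dominated_def)
    ultimately show False using i nz u coef_closed[OF EEf] by (simp add: integral_iff)
  qed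
  have B_add: "k + p ^ l < q" "dig p (k + p ^ l) m = dig p k m + (if m = l then 1 else 0)" if "k \<in> B" "l < r" for k l m
  proof -
    have d: "dig p (k + p ^ l) m = dig p k m + dig p (p ^ l) m" for m
    proof (rule dig_add[OF p_pos])
      show "dig p k i + dig p (p ^ l) i < p" for i
        using B_dig(1)[OF that(1), of i] odd_p by (auto simp: dig_power[OF p_gt_1])
    qed
    then show "dig p (k + p ^ l) m = dig p k m + (if m = l then 1 else 0)" by (simp add: dig_power[OF p_gt_1])
    show "k + p ^ l < q" unfolding q_def
      by (rule dig_less_power[OF p_gt_1]) (use B_dig(2)[OF that(1)] that(2) in \<open>auto simp: d dig_power[OF p_gt_1]\<close>)
  qed
  have pq: "p ^ l < q" if "l < r" for l unfolding q_def using that p_gt_1 by simp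
  have dig0: "dig p k l = 0" if nz: "coef (EE j0) k \<noteq> \<zero>" and l: "l \<noteq> j0" "l < r" for k l
  proof (rule ccontr)
    assume nd: "dig p k l \<noteq> 0"
    have kB: "k \<in> B" using suppE[OF j0 nz] .
    have dkl: "dig p k l = 1" using B_dig(1)[OF kB, of l] nd by simp
    \<comment> \<open>Zero digits at l and j0, digit 1 in the other places below r: the coefficient
      of x^m sees just the summands j0 and l, with cofactors y^(p^l) and y^(p^j0) because n j0 = m +
      p^l and n l = m + p^j0.\<close>
    define m where "m = (\<Sum>i<r. (if i = l \<or> i = j0 then 0 else 1) * p ^ i)"
    have dm: "dig p m i = (if i < r \<and> i \<noteq> l \<and> i \<noteq> j0 then 1 else 0)" for i
      unfolding m_def using p_gt_1 by (subst dig_sum) auto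
    have mq: "m < q" unfolding q_def by (rule dig_less_power[OF p_gt_1]) (simp add: dm)
    have nm: "n i = m + p ^ (if i = j0 then l else j0)" if "i = j0 \<or> i = l" for i
    proof (rule dig_eqI[OF p_gt_1])
      fix s
      define e where "e = (if i = j0 then l else j0)"
      have "dig p (m + p ^ e) s = dig p m s + dig p (p ^ e) s"
        using p_gt_1 odd_p by (intro dig_add) (auto simp: dm dig_power[OF p_gt_1])
      then show "dig p (n i) s = dig p (m + p ^ (if i = j0 then l else j0)) s"
        using that l j0(1) unfolding e_def[symmetric] by (auto simp: dn dm dig_power[OF p_gt_1] e_def)
    qed
    have bcm: "bc (n i) m = \<zero>" if "i < r" "i \<noteq> j0" "i \<noteq> l" for i
      unfolding bc_eq_zero_iff dominated_def using that by (auto simp: dn dm intro!: exI[of _ i])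
    have bcj: "bc (n j0) m \<noteq> \<zero>" unfolding bc_eq_zero_iff dominated_def by (auto simp: dn dm)
    define a b where "a = u j0 \<otimes> bc (n j0) m" "b = u l \<otimes> bc (n l) m"
    have ab: "a \<in> carrier R" "b \<in> carrier R" "a \<noteq> \<zero>" using u j0 bcj by (auto simp: a_b_def integral_iff)
    define h1 h2 where "h1 y = EE j0 y \<otimes> y [^] (p ^ l)" "h2 y = EE l y \<otimes> y [^] (p ^ j0)" for y
    have hf: "h1 \<in> carrier R \<rightarrow> carrier R" "h2 \<in> carrier R \<rightarrow> carrier R" by (auto simp: h1_h2_def)
    have Gm: "G m y = a \<otimes> h1 y \<oplus> b \<otimes> h2 y" if y: "y \<in> carrier R" for y
    proof -
      let ?t = "\<lambda>i. c i y \<otimes> (bc (n i) m \<otimes> y [^] (n i - m))"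
      have "G m y = (\<Oplus>i\<in>{j0, l}. ?t i)" unfolding G_def
        using l j0(1) y bcm by (intro finsum_extend[symmetric]) auto
      also have "\<dots> = ?t j0 \<oplus> ?t l" using l y by (simp add: finsum_insert)
      also have "?t j0 = a \<otimes> h1 y" using y u nm[of j0] by (simp add: a_b_def h1_h2_def c_def m_ac)
      also have "?t l = b \<otimes> h2 y" using y u nm[of l] l by (simp add: a_b_def h1_h2_def c_def m_ac)
      finally show ?thesis .
    qed
    \<comment> \<open>This exponent has digit 2 at place l, with no carry as p > 2. It lies outside
      \<open>B\<close>, and the summand l cannot cancel it, since the shift by p^j0 leaves the digit
      at l at most 1.\<close>
    let ?K = "k + p ^ l"
    have Kq: "?K < q" using B_add(1)[OF kB l(2)] .
    have dK: "dig p ?K l = 2" using B_add(2)[OF kB l(2), of l] dkl by simp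
    have KB: "?K \<notin> B" using B_dig(1)[of ?K l] dK by auto
    have "coef (G m) ?K = coef (\<lambda>y. a \<otimes> h1 y \<oplus> b \<otimes> h2 y) ?K"
      using ab hf Gm by (intro coef_cong) auto
    also have "\<dots> = coef (\<lambda>y. a \<otimes> h1 y) ?K \<oplus> coef (\<lambda>y. b \<otimes> h2 y) ?K"
      using ab hf by (intro coef_add) auto
    also have "coef (\<lambda>y. a \<otimes> h1 y) ?K = a \<otimes> coef h1 ?K" using ab hf by (intro coef_smult) auto
    also have "coef h1 ?K = coef (EE j0) k" unfolding h1_h2_def
      using suppE[OF j0] B_add(1)[OF _ l(2)] pq[OF l(2)] by (intro coef_mult_power EEf) auto
    also have "coef (\<lambda>y. b \<otimes> h2 y) ?K = b \<otimes> coef h2 ?K" using ab hf by (intro coef_smult) auto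
    also have "b \<otimes> coef h2 ?K = \<zero>"
    proof (cases "u l = \<zero>")
      case True
      then show ?thesis using coef_closed[OF hf(2)] by (simp add: a_b_def)
    next
      case False
      have lt: "i + p ^ j0 < q" if "coef (EE l) i \<noteq> \<zero>" for i
        using suppE[OF l(2) False that] B_add(1) j0(1) by blast
      have "coef h2 ?K = \<zero>"
      proof (rule ccontr)
        assume "coef h2 ?K \<noteq> \<zero>"
        then obtain i where i: "?K = i + p ^ j0" "coef (EE l) i \<noteq> \<zero>"
          unfolding h1_h2_def using coef_mult_power(2)[OF EEf lt pq[OF j0(1)]] by blast
        have iB: "i \<in> B" using suppE[OF l(2) False i(2)] .
        have "dig p ?K l \<le> 1" unfolding i(1) using B_add(2)[OF iB j0(1), of l] l(1) B_dig(1)[OF iB, of l] by simp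
        then show False using dK by simp
      qed
      then show ?thesis using ab by simp
    qed
    finally have "a \<otimes> coef (EE j0) k = \<zero>"
      using coefG[OF mq Kq KB] ab coef_closed[OF EEf] by simp
    then show False using ab nz coef_closed[OF EEf] by (simp add: integral_iff)
  qed
  have only: "k = p ^ j0" if nz: "coef (EE j0) k \<noteq> \<zero>" for k
  proof (rule dig_eqI[OF p_gt_1])
    have kB: "k \<in> B" using suppE[OF j0 nz] .
    have "k \<noteq> 0" using nz coef_0[OF EEf, of j0] E0 p_pos by (cases "k = 0") (auto simp: EE_def nat_pow_zero)
    have d: "dig p k i = 0" if "i \<noteq> j0" for i
      using dig0[OF nz that] B_dig(2)[OF kB, of i] by (cases "i < r") auto
    have "dig p k j0 \<noteq> 0"
    proof
      assume "dig p k j0 = 0"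
      then have "dig p k i = dig p 0 i" for i using d by (cases "i = j0") auto
      then have "k = 0" by (rule dig_eqI[OF p_gt_1])
      with \<open>k \<noteq> 0\<close> show False ..
    qed
    then have "dig p k j0 = 1" using B_dig(1)[OF kB, of j0] by simp
    then show "dig p k i = dig p (p ^ j0) i" for i using d[of i] by (simp add: dig_power[OF p_gt_1])
  qed
  have EE: "EE j0 y = coef (EE j0) (p ^ j0) \<otimes> y [^] (p ^ j0)" if y: "y \<in> carrier R" for y
  proof -
    have "EE j0 y = pol (coef (EE j0)) y" using pol_coef[OF EEf y] by simp
    also have "\<dots> = pol (\<lambda>k. if k = p ^ j0 then coef (EE j0) (p ^ j0) else \<zero>) y"
      using only coef_closed[OF EEf] y by (intro pol_cong) auto
    also have "\<dots> = coef (EE j0) (p ^ j0) \<otimes> y [^] (p ^ j0)"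
      using coef_closed[OF EEf] y by (intro pol_single pq j0(1)) auto
    finally show ?thesis .
  qed
  have "coef (EE j0) (p ^ j0) = \<zero>"
    using EE[of \<one>] E1 p_pos coef_closed[OF EEf] by (simp add: EE_def nat_pow_zero)
  then have "E x [^] (p ^ j0) = \<zero>" using EE[OF x] x by (simp add: EE_def)
  then show ?thesis using pow_nonzero[of "E x" "p ^ j0"] x by (cases "E x = \<zero>") auto
qed

end

section \<open>Hua-type characterisation of field automorphisms\<close>

context field begin

lemma inv_nonzero:
  assumes "x \<in> carrier R" "x \<noteq> \<zero>"
  shows "inv x \<in> carrier R" "inv x \<noteq> \<zero>" "x \<otimes> inv x = \<one>" "inv x \<otimes> x = \<one>" "inv (inv x) = x"
proof -
  have x: "x \<in> Units R" using assms field_Units by auto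
  then show i: "inv x \<in> carrier R" "x \<otimes> inv x = \<one>" "inv x \<otimes> x = \<one>" "inv (inv x) = x" by auto
  show "inv x \<noteq> \<zero>"
  proof
    assume "inv x = \<zero>"
    with i(2) assms(1) show False by simp
  qed
qed

lemma inv_minus:
  assumes "x \<in> carrier R" "x \<noteq> \<zero>"
  shows "inv (\<ominus> x) = \<ominus> (inv x)"
  by (rule comm_inv_char) (use inv_nonzero[OF assms] assms in \<open>auto simp: l_minus r_minus\<close>)

text \<open>Only y = 0 and y = 1 are needed. At y = 0 the hypothesis says that inversion, g,
  inversion in succession give an additive map k; comparing with y = 1 identifies
  \<open>P \<one>\<close> with g, so g is additive as well. Additivity of both g and k gives
  squares, and polarisation with 2 \<noteq> 0 gives products.\<close>

theorem hua:
  assumes two: "\<one> \<oplus> \<one> \<noteq> \<zero>"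
    and g: "\<And>x. x \<in> carrier R \<Longrightarrow> g x \<in> carrier R" and inj: "inj_on g (carrier R)"
    and g0: "g \<zero> = \<zero>" and g1: "g \<one> = \<one>"
    and P: "\<And>y a. P y a = inv (g y \<ominus> g (y \<ominus> inv a))"
    and P_add: "\<And>y a b. y \<in> carrier R \<Longrightarrow> a \<in> carrier R \<Longrightarrow> b \<in> carrier R \<Longrightarrow> a \<noteq> \<zero> \<Longrightarrow> b \<noteq> \<zero> \<Longrightarrow>
      a \<oplus> b \<noteq> \<zero> \<Longrightarrow> P y (a \<oplus> b) = P y a \<oplus> P y b"
    and P_minus: "\<And>y a. y \<in> carrier R \<Longrightarrow> a \<in> carrier R \<Longrightarrow> a \<noteq> \<zero> \<Longrightarrow> P y (\<ominus> a) = \<ominus> P y a"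
    and x: "x \<in> carrier R" and y: "y \<in> carrier R"
  shows "g (x \<oplus> y) = g x \<oplus> g y" and "g (x \<otimes> y) = g x \<otimes> g y"
proof -
  have exchange: "a \<otimes> b \<otimes> (c \<otimes> d) = (a \<otimes> d) \<otimes> (b \<otimes> c)"
    if "a \<in> carrier R" "b \<in> carrier R" "c \<in> carrier R" "d \<in> carrier R" for a b c d
    using that by (simp add: m_ac)
  have gnz: "g z \<noteq> \<zero>" if "z \<in> carrier R" "z \<noteq> \<zero>" for z
    using inj_onD[OF inj, of z \<zero>] that g0 by auto
  have mnz: "\<ominus> z \<noteq> \<zero>" if "z \<in> carrier R" "z \<noteq> \<zero>" for z using that by (metis minus_minus minus_zero)
  have Pc: "P u a \<in> carrier R" if "u \<in> carrier R" "a \<in> carrier R" "a \<noteq> \<zero>" for u a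
  proof -
    have i: "inv a \<in> carrier R" "inv a \<noteq> \<zero>" using inv_nonzero that by auto
    have "u \<ominus> inv a \<noteq> u"
    proof
      assume "u \<ominus> inv a = u"
      then have "(u \<ominus> inv a) \<ominus> u = u \<ominus> u" by simp
      moreover have "(u \<ominus> w) \<ominus> u = \<ominus> w" if "w \<in> carrier R" for w
        using \<open>u \<in> carrier R\<close> that by algebra
      ultimately show False using mnz[of "inv a"] i that by simp
    qed
    then have "g u \<noteq> g (u \<ominus> inv a)" using inj_onD[OF inj, of u "u \<ominus> inv a"] that i by auto
    then have "g u \<ominus> g (u \<ominus> inv a) \<noteq> \<zero>" using g that i by simp
    then show ?thesis unfolding P using g that i inv_nonzero(1) by simp
  qed
  define k where "k z = inv (g (inv z))" for z
  have kP: "P \<zero> z = k z" if z: "z \<in> carrier R" "z \<noteq> \<zero>" for z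
  proof -
    have i: "inv z \<in> carrier R" "inv z \<noteq> \<zero>" using inv_nonzero z by auto
    have "P \<zero> (\<ominus> z) = inv (\<ominus> g (inv z))"
      unfolding P inv_minus[OF z] g0 using i g by (simp add: minus_eq)
    also have "\<dots> = \<ominus> k z" unfolding k_def using i g gnz by (intro inv_minus) auto
    finally have "\<ominus> P \<zero> z = \<ominus> k z" using P_minus[of \<zero> z] z by simp
    moreover have "k z \<in> carrier R" unfolding k_def using i g gnz inv_nonzero(1) by simp
    ultimately show ?thesis using Pc[of \<zero> z] z by (metis minus_minus zero_closed)
  qed
  have kc: "k z \<in> carrier R" "k z \<noteq> \<zero>" and gk: "g (inv z) = inv (k z)" if z: "z \<in> carrier R" "z \<noteq> \<zero>" for z
    unfolding k_def using inv_nonzero[OF z] g gnz inv_nonzero by auto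
  have k_add: "k (a \<oplus> b) = k a \<oplus> k b"
    if "a \<in> carrier R" "b \<in> carrier R" "a \<noteq> \<zero>" "b \<noteq> \<zero>" "a \<oplus> b \<noteq> \<zero>" for a b
    using P_add[of \<zero> a b] that by (simp add: kP)
  have k1: "k \<one> = \<one>" by (simp add: k_def g1)
  have "\<one> \<ominus> \<one> = \<zero>" by simp
  then have P11: "P \<one> \<one> = \<one>" unfolding P by (simp add: g0 g1 minus_eq)
  have gm1: "g (\<ominus> \<one>) = \<ominus> \<one>"
  proof -
    have m1: "\<ominus> \<one> \<in> carrier R" "\<ominus> \<one> \<noteq> \<zero>" using mnz[of \<one>] by auto
    have "k (\<ominus> \<one>) = \<ominus> \<one>" using P_minus[of \<zero> \<one>] kP[of \<one>] kP[OF m1] k1 by simp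
    then have "g (inv (\<ominus> \<one>)) = inv (\<ominus> \<one>)" using gk[OF m1] by simp
    then show ?thesis using inv_minus[of \<one>] by simp
  qed
  have gP: "g V = P \<one> V" if V: "V \<in> carrier R" "V \<noteq> \<zero>" for V
  proof (cases "V = \<ominus> \<one>")
    \<comment> \<open>For V = -1 the auxiliary element 1 + V vanishes, so this value comes directly
      from oddness.\<close>
    case True
    then show ?thesis using P_minus[of \<one> \<one>] P11 gm1 by simp
  next
    case False
    define W where "W = inv V"
    have W: "W \<in> carrier R" "W \<noteq> \<zero>" "V \<otimes> W = \<one>" "W \<otimes> V = \<one>" "inv W = V"
      using inv_nonzero[OF V] by (auto simp: W_def)
    \<comment> \<open>Since 1 - 1/(1 + V) = 1/(1 + 1/V), the value of \<open>P \<one>\<close> at 1 +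
      V is expressed through k (1 + 1/V) = 1 + t with t = k (1/V); it equals 1 + 1/t, and additivity
      of \<open>P \<one>\<close> leaves 1/t = g V.\<close>
    define a where "a = \<one> \<oplus> V"
    define Z where "Z = \<one> \<oplus> W"
    have ac: "a \<in> carrier R" and Zc: "Z \<in> carrier R" using V W by (auto simp: a_def Z_def)
    have a0: "a \<noteq> \<zero>"
    proof
      assume "a = \<zero>"
      then have "V = \<ominus> \<one>" using V minus_equality[of V \<one>] by (simp add: a_def a_comm)
      with False show False ..
    qed
    have ZV: "Z = a \<otimes> W" using V W by (simp add: a_def Z_def l_distr a_comm)
    have Z0: "Z \<noteq> \<zero>" unfolding ZV using a0 ac W by (simp add: integral_iff)
    note iZ = inv_nonzero[OF Zc Z0]
    have ia: "inv a = W \<otimes> inv Z"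
      by (rule comm_inv_char) (use ac W iZ ZV in \<open>auto simp: m_assoc[symmetric]\<close>)
    have "\<one> \<ominus> inv a = inv Z"
    proof -
      have "\<one> \<ominus> inv a = Z \<otimes> inv Z \<ominus> W \<otimes> inv Z" unfolding ia iZ(3) ..
      also have "\<dots> = (Z \<ominus> W) \<otimes> inv Z" using Zc W iZ by (simp add: minus_eq l_distr l_minus)
      also have "Z \<ominus> W = \<one>" using W unfolding Z_def by (simp add: minus_eq a_assoc r_neg)
      finally show ?thesis using iZ by simp
    qed
    then have Pa: "P \<one> a = inv (\<one> \<ominus> inv (k Z))" unfolding P using gk[OF Zc Z0] g1 by simp
    define t where "t = k W"
    have t: "t \<in> carrier R" "t \<noteq> \<zero>" using kc W by (auto simp: t_def)
    have kZ: "k Z = \<one> \<oplus> t" unfolding t_def Z_def using k_add[of \<one> W] k1 W Z0 by (simp add: Z_def)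
    note it = inv_nonzero[OF t]
    have s: "\<one> \<oplus> t \<in> carrier R" "\<one> \<oplus> t \<noteq> \<zero>" using kc[OF Zc Z0] by (auto simp: kZ)
    note ins = inv_nonzero[OF s]
    have e1: "\<one> \<ominus> inv (\<one> \<oplus> t) = t \<otimes> inv (\<one> \<oplus> t)"
    proof -
      have "\<one> \<ominus> inv (\<one> \<oplus> t) = (\<one> \<oplus> t) \<otimes> inv (\<one> \<oplus> t) \<ominus> \<one> \<otimes> inv (\<one> \<oplus> t)" using ins by simp
      also have "\<dots> = ((\<one> \<oplus> t) \<ominus> \<one>) \<otimes> inv (\<one> \<oplus> t)" using s ins by (simp add: minus_eq l_distr l_minus)
      also have "(\<one> \<oplus> t) \<ominus> \<one> = t" using t by (simp add: minus_eq a_ac r_neg)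
      finally show ?thesis .
    qed
    have "inv (t \<otimes> inv (\<one> \<oplus> t)) = (\<one> \<oplus> t) \<otimes> inv t"
    proof (rule comm_inv_char)
      have "t \<otimes> inv (\<one> \<oplus> t) \<otimes> ((\<one> \<oplus> t) \<otimes> inv t) = (t \<otimes> inv t) \<otimes> (inv (\<one> \<oplus> t) \<otimes> (\<one> \<oplus> t))"
        by (rule exchange[OF t(1) ins(1) s(1) it(1)])
      then show "t \<otimes> inv (\<one> \<oplus> t) \<otimes> ((\<one> \<oplus> t) \<otimes> inv t) = \<one>" using it ins by simp
    qed (use t it s ins in auto)
    also have "\<dots> = inv t \<oplus> \<one>" using t it by (simp add: l_distr)
    finally have "P \<one> a = inv t \<oplus> \<one>" using Pa kZ e1 by simp
    moreover have "P \<one> a = \<one> \<oplus> P \<one> V" unfolding a_def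
      using P_add[of \<one> \<one> V] V a0 P11 by (simp add: a_def)
    ultimately have "P \<one> V = inv t" using Pc[of \<one> V] V it by (simp add: a_comm)
    then show ?thesis using gk[of W] W by (simp add: t_def)
  qed
  have g_minus: "g (\<ominus> z) = \<ominus> g z" if z: "z \<in> carrier R" for z
  proof (cases "z = \<zero>")
    case False
    then show ?thesis using gP[of z] gP[of "\<ominus> z"] P_minus[of \<one> z] z mnz by simp
  qed (simp add: g0)
  have g_add: "g (a \<oplus> b) = g a \<oplus> g b" if ab: "a \<in> carrier R" "b \<in> carrier R" for a b
  proof (cases "a = \<zero> \<or> b = \<zero> \<or> a \<oplus> b = \<zero>")
    case True
    then consider "a = \<zero>" | "b = \<zero>" | "a \<oplus> b = \<zero>" by blast
    then show ?thesis
    proof cases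
      case 3
      then have "b = \<ominus> a" using ab minus_equality[of b a] by (simp add: a_comm)
      then show ?thesis using 3 g0 g_minus[OF ab(1)] g[OF ab(1)] by (simp add: r_neg)
    qed (use ab g g0 in auto)
  next
    case False
    then show ?thesis using gP[of a] gP[of b] gP[of "a \<oplus> b"] P_add[of \<one> a b] ab by simp
  qed
  have g_diff: "g (a \<ominus> b) = g a \<ominus> g b" if "a \<in> carrier R" "b \<in> carrier R" for a b
    unfolding minus_eq using that by (simp add: g_add g_minus)
  have g_sq: "g (s \<otimes> s) = g s \<otimes> g s" if s: "s \<in> carrier R" for s
  proof (cases "s = \<zero> \<or> s = \<one>")
    case False
    define s' where "s' = \<one> \<ominus> s"
    have s': "s' \<in> carrier R" "s' \<noteq> \<zero>" using s False by (auto simp: s'_def)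
    have s0: "s \<noteq> \<zero>" using False by simp
    note ins = inv_nonzero[OF s s0] and ins' = inv_nonzero[OF s']
    \<comment> \<open>Partial fractions 1/a + 1/b = 1/(a b) for a + b = 1, used for s and 1 - s and
      again for their images; the map k links the two instances.\<close>
    have sum: "inv a \<oplus> inv b = inv (a \<otimes> b)"
      if ab: "a \<in> carrier R" "a \<noteq> \<zero>" "b \<in> carrier R" "b \<noteq> \<zero>" "b \<oplus> a = \<one>" for a b
    proof -
      note ia = inv_nonzero[OF ab(1,2)] and ib = inv_nonzero[OF ab(3,4)]
      have "inv (a \<otimes> b) = inv a \<oplus> inv b"
      proof (rule comm_inv_char)
        have "a \<otimes> b \<otimes> (c \<oplus> d) = b \<otimes> (a \<otimes> c) \<oplus> a \<otimes> (b \<otimes> d)"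
          if "c \<in> carrier R" "d \<in> carrier R" for c d
          using ab that by (simp add: r_distr m_ac)
        from this[OF ia(1) ib(1)] show "a \<otimes> b \<otimes> (inv a \<oplus> inv b) = \<one>"
          unfolding ia(3) ib(3) using ab by simp
      qed (use ab ia ib in auto)
      then show ?thesis by simp
    qed
    have ss: "s' \<oplus> s = \<one>" using s unfolding s'_def by (simp add: minus_eq a_assoc l_neg)
    define m where "m = s \<otimes> s'"
    have m: "m \<in> carrier R" "m \<noteq> \<zero>" using s s' s0 by (auto simp: m_def integral_iff)
    note im = inv_nonzero[OF m]
    have "inv s \<oplus> inv s' = inv m" unfolding m_def using sum[of s s'] s s' s0 ss by simp
    then have "k (inv m) = k (inv s) \<oplus> k (inv s')"
      using k_add[of "inv s" "inv s'"] ins ins' im by simp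
    moreover have "k (inv z) = inv (g z)" if "z \<in> carrier R" "z \<noteq> \<zero>" for z
      unfolding k_def using inv_nonzero[OF that] by simp
    ultimately have "inv (g m) = inv (g s) \<oplus> inv (g s')" using s s' m s0 by simp
    also have "\<dots> = inv (g s \<otimes> g s')"
      using sum[of "g s" "g s'"] g gnz s s' s0 ss g_add[of s' s] g1 by simp
    finally have "inv (inv (g m)) = inv (inv (g s \<otimes> g s'))" by simp
    then have "g m = g s \<otimes> g s'"
      using inv_nonzero(5)[of "g m"] inv_nonzero(5)[of "g s \<otimes> g s'"] g gnz s s' s0 m by (simp add: integral_iff)
    moreover have "m = s \<ominus> s \<otimes> s" unfolding m_def s'_def using s by (simp add: minus_eq r_distr r_minus)
    then have "g m = g s \<ominus> g (s \<otimes> s)" using s by (simp add: g_diff)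
    moreover have "g s' = \<one> \<ominus> g s" unfolding s'_def using s by (simp add: g_diff g1)
    moreover define G Q where "G = g s" "Q = g (s \<otimes> s)"
    moreover have GQ: "G \<in> carrier R" "Q \<in> carrier R" using g s by (auto simp: G_Q_def)
    ultimately have e: "G \<ominus> Q = G \<otimes> (\<one> \<ominus> G)" by simp
    have "Q = G \<ominus> (G \<ominus> Q)" using GQ by (simp add: minus_eq minus_add a_assoc[symmetric] r_neg)
    also have "\<dots> = G \<ominus> G \<otimes> (\<one> \<ominus> G)" by (simp only: e)
    also have "\<dots> = G \<otimes> G" using GQ(1) by (simp add: minus_eq r_distr r_minus minus_add a_assoc[symmetric] r_neg)
    finally show ?thesis by (simp add: G_Q_def)
  qed (auto simp: g0 g1)
  show "g (x \<oplus> y) = g x \<oplus> g y" using g_add x y .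
  define a b c where "a = g x" "b = g y" "c = g (x \<otimes> y)"
  have abc: "a \<in> carrier R" "b \<in> carrier R" "c \<in> carrier R" using g x y by (auto simp: a_b_c_def)
  have "(x \<oplus> y) \<otimes> (x \<oplus> y) = x \<otimes> x \<oplus> (x \<otimes> y \<oplus> x \<otimes> y) \<oplus> y \<otimes> y" using x y by algebra
  then have "(a \<oplus> b) \<otimes> (a \<oplus> b) = a \<otimes> a \<oplus> (c \<oplus> c) \<oplus> b \<otimes> b"
    using g_sq[of "x \<oplus> y"] g_sq[of x] g_sq[of y] x y by (simp add: g_add a_b_c_def)
  moreover have "(\<one> \<oplus> \<one>) \<otimes> (a \<otimes> b \<ominus> c) =
      (a \<oplus> b) \<otimes> (a \<oplus> b) \<ominus> (a \<otimes> a \<oplus> (c \<oplus> c) \<oplus> b \<otimes> b)" using abc by algebra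
  ultimately have "(\<one> \<oplus> \<one>) \<otimes> (a \<otimes> b \<ominus> c) = \<zero>" using abc by simp
  then have "a \<otimes> b = c" using two abc by (simp add: integral_iff)
  then show "g (x \<otimes> y) = g x \<otimes> g y" by (simp add: a_b_c_def)
qed

end

section \<open>Automorphisms of cyclotomic schemes\<close>

lemma (in ring) diff_zeroI: "x \<ominus> y = \<zero> \<Longrightarrow> x \<in> carrier R \<Longrightarrow> y \<in> carrier R \<Longrightarrow> x = y"
  by simp

locale finite_cring_unit_subgroup = cring R for R (structure) +
  fixes K :: "'a set"
  assumes fin: "finite (carrier R)" and K: "subgroup K (units_of R)"
begin

lemma K_Units: "k \<in> K \<Longrightarrow> k \<in> Units R"
  using subgroup.subset[OF K] by (auto simp: units_of_carrier)

lemma K_closed [simp]: "k \<in> K \<Longrightarrow> k \<in> carrier R"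
  using K_Units by (rule Units_closed)

lemma K_one: "\<one> \<in> K"
  using subgroup.one_closed[OF K] by (simp add: units_of_one)

lemma K_mult: "k \<in> K \<Longrightarrow> l \<in> K \<Longrightarrow> k \<otimes> l \<in> K"
  using subgroup.m_closed[OF K] by (simp add: units_of_mult)

lemma K_inv: "k \<in> K \<Longrightarrow> inv k \<in> K"
  using subgroup.m_inv_closed[OF K] units_of_inv[OF K_Units] by simp

lemma K_pow: "k \<in> K \<Longrightarrow> k [^] (n::nat) \<in> K"
  by (induction n) (auto simp: K_one K_mult)

lemma K_cancel: "k \<in> K \<Longrightarrow> x \<in> carrier R \<Longrightarrow> x \<otimes> k \<otimes> inv k = x"
  using K_Units[of k] by (simp add: m_assoc)

text \<open>The pointwise form of being an automorphism of the scheme; it makes composition,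
  inversion and passage to a larger K immediate.\<close>

definition cyc_map :: "('a \<Rightarrow> 'a) \<Rightarrow> bool" where
  "cyc_map f \<longleftrightarrow> bij_betw f (carrier R) (carrier R) \<and>
     (\<forall>x\<in>carrier R. \<forall>y\<in>carrier R. \<exists>k\<in>K. f y \<ominus> f x = (y \<ominus> x) \<otimes> k)"

lemma cyc_map_bij: "cyc_map f \<Longrightarrow> bij_betw f (carrier R) (carrier R)"
  by (simp add: cyc_map_def)

lemma cyc_map_closed: "cyc_map f \<Longrightarrow> x \<in> carrier R \<Longrightarrow> f x \<in> carrier R"
  unfolding cyc_map_def by (blast dest: bij_betwE)

lemma cyc_mapE:
  assumes "cyc_map f" "x \<in> carrier R" "y \<in> carrier R"
  obtains k where "k \<in> K" "f y \<ominus> f x = (y \<ominus> x) \<otimes> k"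
  using assms unfolding cyc_map_def by blast

text \<open>The pair (x, y) lies in the relation of s = y - x because 1 is in K, which gives the
  factor k. Conversely each relation is mapped into itself injectively, hence onto by
  finiteness.\<close>

lemma cyc_aut_iff: "f \<in> cyc_aut R K \<longleftrightarrow> cyc_map f"
proof
  assume f: "f \<in> cyc_aut R K"
  have "\<exists>k\<in>K. f y \<ominus> f x = (y \<ominus> x) \<otimes> k" if xy: "x \<in> carrier R" "y \<in> carrier R" for x y
  proof -
    let ?S = "cyc_rel R K (y \<ominus> x)"
    have "?S \<in> cyc_rels R K" using xy by (simp add: cyc_rels_def)
    then have eq: "(\<lambda>(x, y). (f x, f y)) ` ?S = ?S" using f by (simp add: cyc_aut_def)
    have "y \<ominus> x = (y \<ominus> x) \<otimes> \<one>" using xy by simp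
    then have "(x, y) \<in> ?S" using xy K_one unfolding cyc_rel_def by blast
    then have "(f x, f y) \<in> ?S" using eq by force
    then show ?thesis by (auto simp: cyc_rel_def)
  qed
  then show "cyc_map f" using f by (simp add: cyc_map_def cyc_aut_def)
next
  assume f: "cyc_map f"
  have "(\<lambda>(x, y). (f x, f y)) ` S = S" if S: "S \<in> cyc_rels R K" for S
  proof (rule card_subset_eq)
    obtain s where s: "s \<in> carrier R" "S = cyc_rel R K s" using S by (auto simp: cyc_rels_def)
    have SC: "S \<subseteq> carrier R \<times> carrier R" by (auto simp: s cyc_rel_def)
    then show "finite S" using fin finite_subset by blast
    show "(\<lambda>(x, y). (f x, f y)) ` S \<subseteq> S"
    proof clarify
      fix x y assume "(x, y) \<in> S"
      then obtain k where k: "k \<in> K" "y \<ominus> x = s \<otimes> k" and xy: "x \<in> carrier R" "y \<in> carrier R"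
        by (auto simp: s cyc_rel_def)
      obtain l where l: "l \<in> K" "f y \<ominus> f x = (y \<ominus> x) \<otimes> l" using cyc_mapE[OF f xy] .
      have "f y \<ominus> f x = s \<otimes> (k \<otimes> l)" using k l s by (simp add: m_assoc)
      then show "(f x, f y) \<in> S"
        using K_mult[OF k(1) l(1)] xy cyc_map_closed[OF f] unfolding s cyc_rel_def by blast
    qed
    have "inj_on (\<lambda>(x, y). (f x, f y)) S"
      using cyc_map_bij[OF f] SC by (auto simp: inj_on_def bij_betw_def)
    then show "card ((\<lambda>(x, y). (f x, f y)) ` S) = card S" by (rule card_image)
  qed
  then show "f \<in> cyc_aut R K" using cyc_map_bij[OF f] by (simp add: cyc_aut_def)
qed

lemma cyc_map_comp:
  assumes f: "cyc_map f" and g: "cyc_map g"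
  shows "cyc_map (\<lambda>x. f (g x))"
proof -
  have "\<exists>k\<in>K. f (g y) \<ominus> f (g x) = (y \<ominus> x) \<otimes> k" if xy: "x \<in> carrier R" "y \<in> carrier R" for x y
  proof -
    obtain k where k: "k \<in> K" "g y \<ominus> g x = (y \<ominus> x) \<otimes> k" using cyc_mapE[OF g xy] .
    obtain l where l: "l \<in> K" "f (g y) \<ominus> f (g x) = (g y \<ominus> g x) \<otimes> l"
      using cyc_mapE[OF f] cyc_map_closed[OF g] xy by metis
    have "f (g y) \<ominus> f (g x) = (y \<ominus> x) \<otimes> (k \<otimes> l)" using k l xy by (simp add: m_assoc)
    then show ?thesis using K_mult k l by blast
  qed
  moreover have "bij_betw (f \<circ> g) (carrier R) (carrier R)"
    using bij_betw_trans[OF cyc_map_bij[OF g] cyc_map_bij[OF f]] .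
  ultimately show ?thesis by (simp add: cyc_map_def comp_def)
qed

lemma cyc_map_inv_into:
  assumes f: "cyc_map f"
  shows "cyc_map (inv_into (carrier R) f)"
proof -
  let ?g = "inv_into (carrier R) f"
  note b = cyc_map_bij[OF f]
  have g: "?g x \<in> carrier R" "f (?g x) = x" if "x \<in> carrier R" for x
    using that b by (auto simp: bij_betw_def inv_into_into f_inv_into_f)
  have "\<exists>k\<in>K. ?g y \<ominus> ?g x = (y \<ominus> x) \<otimes> k" if xy: "x \<in> carrier R" "y \<in> carrier R" for x y
  proof -
    obtain k where k: "k \<in> K" "y \<ominus> x = (?g y \<ominus> ?g x) \<otimes> k"
      using cyc_mapE[OF f g(1)[OF xy(1)] g(1)[OF xy(2)]] g(2) xy by metis
    have "?g y \<ominus> ?g x \<in> carrier R" using g xy by simp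
    then have "?g y \<ominus> ?g x = (y \<ominus> x) \<otimes> inv k" unfolding k(2) using K_cancel[OF k(1)] by simp
    then show ?thesis using K_inv[OF k(1)] by blast
  qed
  then show ?thesis using bij_betw_inv_into[OF b] by (simp add: cyc_map_def)
qed

lemma cyc_map_affine:
  assumes a: "a \<in> K" and b: "b \<in> carrier R"
  shows "cyc_map (\<lambda>x. a \<otimes> x \<oplus> b)"
proof -
  have diff: "(a \<otimes> y \<oplus> b) \<ominus> (a \<otimes> x \<oplus> b) = (y \<ominus> x) \<otimes> a" if xy: "x \<in> carrier R" "y \<in> carrier R" for x y
  proof (rule diff_zeroI)
    have ac: "a \<in> carrier R" using a by simp
    show "((a \<otimes> y \<oplus> b) \<ominus> (a \<otimes> x \<oplus> b)) \<ominus> (y \<ominus> x) \<otimes> a = \<zero>" using xy ac b by algebra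
  qed (use a b xy in auto)
  have inj: "inj_on (\<lambda>x. a \<otimes> x \<oplus> b) (carrier R)"
  proof (rule inj_onI)
    fix x y assume xy: "x \<in> carrier R" "y \<in> carrier R" "a \<otimes> x \<oplus> b = a \<otimes> y \<oplus> b"
    then have "a \<otimes> x = a \<otimes> y" using a b by simp
    then show "x = y" using Units_l_cancel[OF K_Units[OF a]] xy by simp
  qed
  have "(\<lambda>x. a \<otimes> x \<oplus> b) ` carrier R = carrier R"
    using a b fin by (intro endo_inj_surj inj) auto
  then show ?thesis unfolding cyc_map_def using inj diff a by (auto simp: bij_betw_def)
qed

text \<open>The slope f 1 - f 0 lies in K because 1 - 0 = 1, so the affine normalisation is an
  automorphism of the scheme and stays within the hypothesis.\<close>

lemma cyc_normalI:
  assumes hom: "\<And>f. cyc_map f \<Longrightarrow> f \<zero> = \<zero> \<Longrightarrow> f \<one> = \<one> \<Longrightarrow> f \<in> ring_hom R R"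
  shows "cyc_normal R K"
  unfolding cyc_normal_def
proof
  fix f assume "f \<in> cyc_aut R K"
  then have f: "cyc_map f" by (simp add: cyc_aut_iff)
  define b where "b = f \<zero>"
  define a where "a = f \<one> \<ominus> b"
  have b: "b \<in> carrier R" using cyc_map_closed[OF f] by (simp add: b_def)
  obtain k where k: "k \<in> K" "f \<one> \<ominus> f \<zero> = (\<one> \<ominus> \<zero>) \<otimes> k" using cyc_mapE[OF f, of \<zero> \<one>] by auto
  then have a: "a \<in> K" by (simp add: a_def b_def minus_eq)
  have ac: "a \<in> carrier R" "inv a \<in> carrier R" "inv a \<otimes> a = \<one>" "a \<otimes> inv a = \<one>" using K_Units[OF a] by auto
  define g where "g x = inv a \<otimes> f x \<oplus> \<ominus> (inv a \<otimes> b)" for x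
  have g: "cyc_map g" unfolding g_def
    using cyc_map_comp[OF cyc_map_affine[OF K_inv[OF a], of "\<ominus> (inv a \<otimes> b)"] f] ac b by simp
  have g': "g x = inv a \<otimes> (f x \<ominus> b)" if "x \<in> carrier R" for x
    using cyc_map_closed[OF f that] ac b by (simp add: g_def minus_eq r_distr r_minus)
  have "g \<zero> = \<zero>" using g'[of \<zero>] ac b by (simp add: b_def[symmetric] minus_eq r_neg)
  moreover have "g \<one> = \<one>" using g'[of \<one>] ac by (simp add: a_def[symmetric])
  ultimately have "g \<in> ring_iso R R" using hom[OF g] cyc_map_bij[OF g] by (simp add: ring_iso_def)
  moreover have "f x = a \<otimes> g x \<oplus> b" if x: "x \<in> carrier R" for x
    unfolding g'[OF x] using cyc_map_closed[OF f x] ac b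
    by (simp add: m_assoc[symmetric]) (simp add: minus_eq a_assoc l_neg)
  ultimately show "f \<in> AGammaL1 R" unfolding AGammaL1_def using K_Units[OF a] b by blast
qed

end

section \<open>Cyclotomic schemes over a field\<close>

context monoid begin

lemma units_of_nat_pow: "x [^]\<^bsub>units_of G\<^esub> (n::nat) = x [^] n"
  by (induction n) (simp_all add: units_of_mult units_of_one)

lemma units_subgroup_pow_card:
  assumes K: "subgroup K (units_of G)" and fin: "finite K" and k: "k \<in> K"
  shows "k [^] card K = \<one>"
proof -
  interpret U: group "units_of G" by (rule units_group)
  interpret KG: group "units_of G\<lparr>carrier := K\<rparr>" by (rule subgroup.subgroup_is_group[OF K U.group_axioms])
  have "k [^]\<^bsub>units_of G\<lparr>carrier := K\<rparr>\<^esub> card K = \<one>\<^bsub>units_of G\<lparr>carrier := K\<rparr>\<^esub>"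
    using KG.pow_order_eq_1[of k] k by (simp add: order_def)
  then show ?thesis using U.nat_pow_consistent by (simp add: units_of_one units_of_nat_pow)
qed

end

context odd_finite_field begin

lemma minus_one_distinct: "\<ominus> \<one> \<noteq> \<one>" "\<ominus> \<one> \<noteq> \<zero>" "\<one> \<oplus> \<one> \<noteq> \<zero>"
proof -
  have "add_pow R (2::nat) \<one> \<noteq> \<zero>" using add_pow_one_eq_zero_iff[of 2] odd_p by (auto dest: dvd_imp_le)
  then show *: "\<one> \<oplus> \<one> \<noteq> \<zero>" by (simp add: numeral_2_eq_2)
  show "\<ominus> \<one> \<noteq> \<one>"
  proof
    assume "\<ominus> \<one> = \<one>"
    then have "\<one> \<oplus> \<one> = \<ominus> \<one> \<oplus> \<one>" by simp
    then show False using * by (simp add: l_neg)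
  qed
  show "\<ominus> \<one> \<noteq> \<zero>"
  proof
    assume "\<ominus> \<one> = \<zero>"
    then have "\<ominus> (\<ominus> \<one>) = \<ominus> \<zero>" by simp
    then show False by simp
  qed
qed

end

locale odd_finite_field_unit_subgroup = odd_finite_field +
  fixes K :: "'a set"
  assumes K_subgroup: "subgroup K (units_of R)"

sublocale odd_finite_field_unit_subgroup \<subseteq> finite_cring_unit_subgroup R K
  by (intro finite_cring_unit_subgroup.intro finite_cring_unit_subgroup_axioms.intro is_cring finite_carrier K_subgroup)

context odd_finite_field_unit_subgroup begin

lemma card_Units: "card (Units R) = q - 1"
  using finite_carrier by (simp add: field_Units card_Diff_singleton card_carrier)

text \<open>Raising differences to the power |K| removes the factor from K, and |K| is a proper
  divisor of q - 1: the hypotheses of McConnel's theorem.\<close>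

lemma field_proper_normal:
  assumes "K \<noteq> Units R"
  shows "cyc_normal R K"
proof (rule cyc_normalI)
  fix f assume f: "cyc_map f" "f \<zero> = \<zero>" "f \<one> = \<one>"
  interpret U: group "units_of R" by (rule units_group)
  define n where "n = card K"
  have fU: "finite (Units R)" using finite_carrier by (simp add: field_Units)
  have KU: "K \<subseteq> Units R" using K_Units by blast
  have fK: "finite K" using KU fU by (rule finite_subset)
  have "n dvd q - 1"
    using U.lagrange[OF K_subgroup] card_Units unfolding n_def order_def units_of_carrier by (metis dvd_triv_right)
  moreover have "n < q - 1"
    using psubset_card_mono[OF fU, of K] KU assms card_Units unfolding n_def by auto
  moreover have "(f x \<ominus> f y) [^] n = (x \<ominus> y) [^] n" if xy: "x \<in> carrier R" "y \<in> carrier R" for x y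
  proof -
    obtain k where k: "k \<in> K" "f x \<ominus> f y = (x \<ominus> y) \<otimes> k" using cyc_mapE[OF f(1) xy(2,1)] .
    have "k [^] n = \<one>" unfolding n_def by (rule units_subgroup_pow_card[OF K_subgroup fK k(1)])
    then show ?thesis using k xy by (simp add: nat_pow_distrib)
  qed
  ultimately obtain e where e: "\<And>x. x \<in> carrier R \<Longrightarrow> f x = x [^] (p ^ e)"
    using mcconnel[OF cyc_map_bij[OF f(1)] _ _ _ f(2,3)] by blast
  show "f \<in> ring_hom R R"
    by (rule ring_hom_memI)
      (auto simp: e nat_pow_distrib frobenius_add[OF prime_p char_p])
qed

text \<open>Once 0 and 1 are fixed, the third element -1 has nowhere else to go.\<close>

lemma field_three_normal:
  assumes "q = 3"
  shows "cyc_normal R K"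
proof (rule cyc_normalI)
  fix f assume f: "cyc_map f" "f \<zero> = \<zero>" "f \<one> = \<one>"
  have "card {\<zero>, \<one>, \<ominus> \<one>} = 3" using minus_one_distinct minus_one_distinct[symmetric] by auto
  then have "{\<zero>, \<one>, \<ominus> \<one>} = carrier R"
    using card_carrier assms finite_carrier by (intro card_subset_eq) auto
  then have C: "x = \<zero> \<or> x = \<one> \<or> x = \<ominus> \<one>" if "x \<in> carrier R" for x using that by blast
  have inj: "inj_on f (carrier R)" using cyc_map_bij[OF f(1)] by (simp add: bij_betw_def)
  have "f (\<ominus> \<one>) = \<ominus> \<one>"
    using C[OF cyc_map_closed[OF f(1), of "\<ominus> \<one>"]] inj_onD[OF inj, of "\<ominus> \<one>" \<zero>] inj_onD[OF inj, of "\<ominus> \<one>" \<one>]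
      f minus_one_distinct by auto
  then have "f x = x" if "x \<in> carrier R" for x using C[OF that] f by auto
  then show "f \<in> ring_hom R R" by (intro ring_hom_memI) auto
qed

text \<open>With K = R^x every permutation is an automorphism. An affine semilinear form of the swap
  of 1 and -1 must have intercept 0 and slope -1, hence s z = -z for every z other than 0, 1, -1;
  this clashes with s (z + 1) = s z + 1.\<close>

lemma field_full_not_normal:
  assumes KU: "K = Units R" and q: "4 \<le> q"
  shows "\<not> cyc_normal R K"
proof
  assume normal: "cyc_normal R K"
  define f where "f x = (if x = \<one> then \<ominus> \<one> else if x = \<ominus> \<one> then \<one> else x)" for x
  have fc: "f x \<in> carrier R" if "x \<in> carrier R" for x using that by (auto simp: f_def)
  have inj: "inj_on f (carrier R)" using minus_one_distinct by (auto simp: inj_on_def f_def)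
  have bij: "bij_betw f (carrier R) (carrier R)"
    unfolding bij_betw_def
    using inj endo_inj_surj[OF finite_carrier image_subsetI inj, OF fc] by (rule conjI)
  have "\<exists>k\<in>K. f y \<ominus> f x = (y \<ominus> x) \<otimes> k" if xy: "x \<in> carrier R" "y \<in> carrier R" for x y
  proof (cases "x = y")
    case True
    then show ?thesis using K_one xy fc by (intro bexI[of _ \<one>]) (auto simp: minus_eq r_neg)
  next
    case False
    define w where "w = y \<ominus> x"
    define v where "v = f y \<ominus> f x"
    have w: "w \<in> carrier R" "w \<noteq> \<zero>" using xy False by (auto simp: w_def)
    have "f y \<noteq> f x" using inj_onD[OF inj] xy False by metis
    then have v: "v \<in> carrier R" "v \<noteq> \<zero>" using xy fc by (auto simp: v_def)
    note iw = inv_nonzero[OF w]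
    have "v = w \<otimes> (inv w \<otimes> v)" using w v iw by (simp add: m_assoc[symmetric])
    moreover have "inv w \<otimes> v \<in> K" unfolding KU field_Units using v iw by (auto simp: integral_iff)
    ultimately show ?thesis unfolding w_def v_def by blast
  qed
  then have "f \<in> cyc_aut R K" using bij by (simp add: cyc_aut_iff cyc_map_def)
  then have "f \<in> AGammaL1 R" using normal unfolding cyc_normal_def by (rule bspec[rotated])
  then have "\<exists>a\<in>Units R. \<exists>b\<in>carrier R. \<exists>s\<in>ring_iso R R. \<forall>x\<in>carrier R. f x = a \<otimes> s x \<oplus> b"
    unfolding AGammaL1_def by (rule CollectD)
  then obtain a b s where a: "a \<in> Units R" and b: "b \<in> carrier R" and s: "s \<in> ring_iso R R"
    and eqs: "\<forall>x\<in>carrier R. f x = a \<otimes> s x \<oplus> b"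
    by (elim bexE)
  have eq: "f x = a \<otimes> s x \<oplus> b" if "x \<in> carrier R" for x using eqs that by (rule bspec)
  have ac: "a \<in> carrier R" using a by (rule Units_closed)
  have hom: "s \<in> ring_hom R R" using s by (simp add: ring_iso_def)
  have s0: "s \<zero> = \<zero>" using hom ring_axioms by (intro ring_hom_zero) 
  have s1: "s \<one> = \<one>" using ring_hom_one[OF hom] .
  have "f \<zero> = \<zero>" using minus_one_distinct(2)[symmetric] by (auto simp: f_def)
  then have b0: "b = \<zero>" using eq[of \<zero>] s0 ac b by simp
  have "f \<one> = a" using eq[of \<one>] s1 b0 ac by simp
  then have a: "a = \<ominus> \<one>" by (simp add: f_def)
  have sc: "s x \<in> carrier R" if "x \<in> carrier R" for x using ring_hom_closed[OF hom that] .
  have fs: "f x = \<ominus> (s x)" if "x \<in> carrier R" for x using eq[OF that] b0 a sc[OF that] by (simp add: l_minus)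
  have "\<not> carrier R \<subseteq> {\<zero>, \<one>, \<ominus> \<one>}"
  proof
    assume "carrier R \<subseteq> {\<zero>, \<one>, \<ominus> \<one>}"
    then have "q \<le> card {\<zero>, \<one>, \<ominus> \<one>}" unfolding card_carrier[symmetric] by (intro card_mono) auto
    also have "\<dots> \<le> 3" by (simp add: card_insert_if)
    finally show False using q by simp
  qed
  then obtain z where z: "z \<in> carrier R" "z \<noteq> \<zero>" "z \<noteq> \<one>" "z \<noteq> \<ominus> \<one>" by blast
  have sz: "s z = \<ominus> z" using fs[OF z(1)] z sc[OF z(1)] by (simp add: f_def) (metis minus_minus)
  define w where "w = z \<oplus> \<one>"
  have w: "w \<in> carrier R" "w \<noteq> \<one>" using z by (auto simp: w_def)
  have sw: "s w = \<ominus> z \<oplus> \<one>" unfolding w_def using ring_hom_add[OF hom, of z \<one>] z sz s1 by simp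
  have fw: "f w = z \<ominus> \<one>" using fs[OF w(1)] sw z by (simp add: minus_add minus_eq)
  show False
  proof (cases "w = \<ominus> \<one>")
    \<comment> \<open>Here z = -2, while f (-1) = 1 gives z = 2; together 4 = 0, impossible in odd
      characteristic.\<close>
    case True
    then have "z \<ominus> \<one> = \<one>" using fw minus_one_distinct by (simp add: f_def)
    then have "(z \<ominus> \<one>) \<oplus> \<one> = \<one> \<oplus> \<one>" by simp
    moreover have "(z \<ominus> \<one>) \<oplus> \<one> = z" using z(1) by (simp add: minus_eq a_assoc l_neg)
    ultimately have z2: "z = \<one> \<oplus> \<one>" by simp
    have "(\<one> \<oplus> \<one>) \<otimes> (\<one> \<oplus> \<one>) = (z \<oplus> \<one>) \<oplus> \<one>" unfolding z2 by algebra
    also have "\<dots> = \<zero>" using True by (simp add: w_def l_neg)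
    finally show False using minus_one_distinct(3) by (simp add: integral_iff)
  next
    case False
    then have "z \<oplus> \<one> = z \<ominus> \<one>" using fw w by (simp add: f_def w_def)
    then have "\<one> = \<ominus> \<one>" using z(1) by (simp add: minus_eq)
    then show False using minus_one_distinct(1) by simp
  qed
qed

end

section \<open>Galois rings\<close>

locale odd_galois_ring = cring R for R (structure) +
  fixes p d r :: nat
  assumes galois: "galois_ring R p d r" and odd: "2 < p"
begin

definition \<pi> :: 'a where "\<pi> = add_pow R p \<one>"

definition I :: "'a set" where "I = scaled_ring R \<pi>"

definition residue_ring :: "'a set ring" (\<open>F\<close>) where "F = R Quot I"

definition cls :: "'a \<Rightarrow> 'a set" where "cls x = I +> x"

lemma finite_R: "finite (carrier R)" and prime_p: "Factorial_Ring.prime p"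
  and d_pos: "1 \<le> d" and r_pos: "1 \<le> r" and hc: "has_char R (p ^ d)"
  and max_iff: "maximalideal J R \<longleftrightarrow> J = I" and card_res: "card (carrier F) = p ^ r"
  using galois unfolding galois_ring_def I_def \<pi>_def residue_ring_def by auto

lemma max_I: "maximalideal I R" by (simp add: max_iff)

lemma ideal_I: "ideal I R" using max_I maximalideal.axioms(1) by blast

lemma additive_subgroup_I: "additive_subgroup I R"
  using ideal_I ideal.axioms(1) by blast

lemmas I_closed [simp] = additive_subgroup.a_Hcarr[OF additive_subgroup_I]
lemmas I_zero [simp] = additive_subgroup.zero_closed[OF additive_subgroup_I]
lemmas I_add = additive_subgroup.a_closed[OF additive_subgroup_I]
lemmas I_minus = additive_subgroup.a_inv_closed[OF additive_subgroup_I]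
lemmas I_lmult = ideal.I_l_closed[OF ideal_I]
lemmas I_rmult = ideal.I_r_closed[OF ideal_I]

lemma I_diff: "x \<in> I \<Longrightarrow> y \<in> I \<Longrightarrow> x \<ominus> y \<in> I"
  unfolding minus_eq by (intro I_add I_minus)

lemma pi_closed [simp]: "\<pi> \<in> carrier R" by (simp add: \<pi>_def)

lemma I_iff: "x \<in> I \<longleftrightarrow> (\<exists>y\<in>carrier R. x = \<pi> \<otimes> y)"
  by (auto simp: I_def scaled_ring_def)

lemma pi_in_I: "\<pi> \<in> I"
  unfolding I_iff by (intro bexI[of _ \<one>]) auto

lemma one_notin_I: "\<one> \<notin> I"
  using ideal.one_imp_carrier[OF ideal_I] maximalideal.I_notcarr[OF max_I] by auto

lemma Units_notin_I: "u \<in> Units R \<Longrightarrow> u \<notin> I"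
  using I_rmult[of u "inv u"] one_notin_I by auto

text \<open>A nonunit generates a proper ideal. By finiteness a proper ideal of largest cardinality
  containing it exists, is maximal and so equals \<open>I\<close>.\<close>

lemma notin_I_Units:
  assumes x: "x \<in> carrier R" and nI: "x \<notin> I"
  shows "x \<in> Units R"
proof (rule ccontr)
  assume nu: "x \<notin> Units R"
  define A where "A = {J. ideal J R \<and> x \<in> J \<and> J \<noteq> carrier R}"
  have "\<one> \<notin> PIdl x"
  proof
    assume "\<one> \<in> PIdl x"
    then obtain y where "y \<in> carrier R" "\<one> = y \<otimes> x" by (auto simp: cgenideal_def)
    then have "x \<in> Units R" using x m_comm[of x y] unfolding Units_def by force
    with nu show False ..
  qed
  then have "PIdl x \<in> A" unfolding A_def using x cgenideal_ideal[OF x] cgenideal_self[OF x] by auto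
  moreover have JC: "J \<subseteq> carrier R" if "ideal J R" for J
    using ideal.axioms(1)[OF that] additive_subgroup.a_subset by blast
  then have "card J < Suc (card (carrier R))" if "J \<in> A" for J
    using that card_mono[OF finite_R, of J] by (auto simp: A_def less_Suc_eq_le)
  ultimately obtain J where J: "J \<in> A" and max: "\<And>L. L \<in> A \<Longrightarrow> card L \<le> card J"
    using ex_has_greatest_nat[of "\<lambda>J. J \<in> A" "PIdl x" card "Suc (card (carrier R))"] by (metis less_imp_le)
  have "maximalideal J R"
  proof (rule maximalidealI)
    show "ideal J R" "carrier R \<noteq> J" using J by (auto simp: A_def)
    fix L assume L: "ideal L R" "J \<subseteq> L" "L \<subseteq> carrier R"
    show "L = J \<or> L = carrier R"
    proof (cases "L = carrier R")
      case False
      then have "card L \<le> card J" using max L J by (auto simp: A_def)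
      then have "J = L" using L finite_subset[OF L(3) finite_R] by (intro card_seteq) auto
      then show ?thesis by simp
    qed simp
  qed
  then have "J = I" by (simp add: max_iff)
  then show False using J nI by (simp add: A_def)
qed

lemma pi_power: "\<pi> [^] (n::nat) = add_pow R (p ^ n) \<one>"
proof (induction n)
  case (Suc n)
  have "add_pow R (p ^ n) \<one> \<otimes> \<pi> = add_pow R (p ^ n) \<pi>" by (simp add: add_pow_ldistr)
  then show ?case using Suc unfolding \<pi>_def by (simp add: add.nat_pow_pow)
qed simp

lemma pi_power_d: "\<pi> [^] d = \<zero>"
  using hc by (simp add: has_char_def pi_power)

lemma p_gt_1: "1 < p" using odd by simp

lemma pi_power_nonzero: "n < d \<Longrightarrow> \<pi> [^] n \<noteq> \<zero>"
  using hc p_gt_1 by (simp add: has_char_def pi_power)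

lemma pi_power_ge: "d \<le> n \<Longrightarrow> \<pi> [^] n = \<zero>"
  using nat_pow_mult[of \<pi> d "n - d"] pi_power_d by simp

lemma pi_power_annihilator:
  assumes "n < d" "x \<in> carrier R" "\<pi> [^] n \<otimes> x = \<zero>"
  shows "x \<in> I"
proof (rule ccontr)
  assume "x \<notin> I"
  then have u: "x \<in> Units R" using notin_I_Units assms by blast
  have "\<pi> [^] n = \<pi> [^] n \<otimes> x \<otimes> inv x" using u assms(2) by (simp add: m_assoc)
  then show False using assms pi_power_nonzero[of n] u by simp
qed

lemma pi_power_mult_I: "x \<in> I \<Longrightarrow> \<exists>y\<in>carrier R. \<pi> [^] (n::nat) \<otimes> x = \<pi> [^] Suc n \<otimes> y"
  unfolding I_iff by (auto simp: m_assoc)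

text \<open>Factors \<pi> are pulled out while the cofactor is a nonunit; reaching \<pi>^d = 0 would
  make x zero.\<close>

lemma valuation:
  assumes x: "x \<in> carrier R" "x \<noteq> \<zero>"
  obtains i u where "i < d" "u \<in> Units R" "x = \<pi> [^] i \<otimes> u"
proof -
  have "n \<le> d \<Longrightarrow> (\<exists>i u. i < d \<and> u \<in> Units R \<and> x = \<pi> [^] i \<otimes> u) \<or> (\<exists>y\<in>carrier R. x = \<pi> [^] n \<otimes> y)" for n
  proof (induction n)
    case 0
    then show ?case using x by auto
  next
    case (Suc n)
    show ?case
    proof (cases "\<exists>i u. i < d \<and> u \<in> Units R \<and> x = \<pi> [^] i \<otimes> u")
      case False
      then obtain y where y: "y \<in> carrier R" "x = \<pi> [^] n \<otimes> y" using Suc by auto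
      have "y \<notin> Units R"
      proof
        assume "y \<in> Units R"
        then have "\<exists>i u. i < d \<and> u \<in> Units R \<and> x = \<pi> [^] i \<otimes> u"
          using y(2) Suc.prems by (intro exI[of _ n] exI[of _ y]) simp
        with False show False ..
      qed
      then have "y \<in> I" using y notin_I_Units by blast
      then show ?thesis using pi_power_mult_I[of y n] y by auto
    qed simp
  qed
  from this[of d] have "\<exists>i u. i < d \<and> u \<in> Units R \<and> x = \<pi> [^] i \<otimes> u"
    using x pi_power_d by auto
  then show thesis using that by blast
qed

lemma ring_hom_cls: "cls \<in> ring_hom R F"
  unfolding residue_ring_def cls_def[abs_def] by (rule ideal.rcos_ring_hom[OF ideal_I])

lemma field_F: "field F"
  unfolding residue_ring_def by (rule maximalideal.quotient_is_field[OF max_I is_cring])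

lemma cls_eq_iff: "x \<in> carrier R \<Longrightarrow> y \<in> carrier R \<Longrightarrow> cls x = cls y \<longleftrightarrow> x \<ominus> y \<in> I"
  unfolding cls_def using quotient_eq_iff_same_a_r_cos[OF ideal_I] by blast

lemma cls_surj: "C \<in> carrier F \<Longrightarrow> \<exists>x\<in>carrier R. cls x = C"
  unfolding residue_ring_def cls_def FactRing_def A_RCOSETS_def' by auto

lemma cls_closed [simp]: "x \<in> carrier R \<Longrightarrow> cls x \<in> carrier F"
  and cls_add [simp]: "x \<in> carrier R \<Longrightarrow> y \<in> carrier R \<Longrightarrow> cls (x \<oplus> y) = cls x \<oplus>\<^bsub>F\<^esub> cls y"
  and cls_mult [simp]: "x \<in> carrier R \<Longrightarrow> y \<in> carrier R \<Longrightarrow> cls (x \<otimes> y) = cls x \<otimes>\<^bsub>F\<^esub> cls y"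
  and cls_one [simp]: "cls \<one> = \<one>\<^bsub>F\<^esub>"
  using ring_hom_closed[OF ring_hom_cls] ring_hom_add[OF ring_hom_cls] ring_hom_mult[OF ring_hom_cls]
    ring_hom_one[OF ring_hom_cls] by auto

lemma ring_F: "ring F"
  using field_F field.axioms(1) domain.axioms(1) cring.axioms(1) by blast

lemma ring_hom_ring_cls: "ring_hom_ring R F cls"
  using ring_axioms ring_F ring_hom_cls by (rule ring_hom_ringI2)

lemma cls_zero [simp]: "cls \<zero> = \<zero>\<^bsub>F\<^esub>"
  using ring_hom_zero[OF ring_hom_cls ring_axioms ring_F] .

lemma cls_eq_zero_iff: "x \<in> carrier R \<Longrightarrow> cls x = \<zero>\<^bsub>F\<^esub> \<longleftrightarrow> x \<in> I"
  using cls_eq_iff[of x \<zero>] by (simp add: minus_eq)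

lemma cls_uminus [simp]: "x \<in> carrier R \<Longrightarrow> cls (\<ominus> x) = \<ominus>\<^bsub>F\<^esub> cls x"
  using ring_hom_ring.axioms(1,2)[OF ring_hom_ring_cls] 
  by (metis abelian_group.minus_equality cls_add cls_closed cls_zero l_neg a_inv_closed ring.is_abelian_group ring_F)

lemma cls_minus [simp]: "x \<in> carrier R \<Longrightarrow> y \<in> carrier R \<Longrightarrow> cls (x \<ominus> y) = cls x \<ominus>\<^bsub>F\<^esub> cls y"
  by (simp add: a_minus_def)

lemma cls_pow [simp]: "x \<in> carrier R \<Longrightarrow> cls (x [^] (n::nat)) = cls x [^]\<^bsub>F\<^esub> n"
  by (induction n) simp_all

lemma cls_inv [simp]: "u \<in> Units R \<Longrightarrow> cls (inv u) = inv\<^bsub>F\<^esub> cls u"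
proof -
  interpret F: field F by (rule field_F)
  assume u: "u \<in> Units R"
  have "cls u \<otimes>\<^bsub>F\<^esub> cls (inv u) = \<one>\<^bsub>F\<^esub>" using cls_mult[of u "inv u"] u Units_closed[OF u] by simp
  then show ?thesis using u Units_closed[OF u] by (intro F.comm_inv_char[symmetric]) auto
qed

lemma odd_finite_field_F: "odd_finite_field F p r (p ^ r)"
proof -
  have "finite (carrier F)"
  proof (rule finite_subset)
    show "carrier F \<subseteq> cls ` carrier R" using cls_surj by blast
  qed (use finite_R in simp)
  moreover have "add_pow F p \<one>\<^bsub>F\<^esub> = \<zero>\<^bsub>F\<^esub>"
  proof -
    interpret F: field F by (rule field_F)
    have "cls (add_pow R n \<one>) = add_pow F n \<one>\<^bsub>F\<^esub>" for n :: nat by (induction n) simp_all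
    then show ?thesis using pi_in_I cls_eq_zero_iff[of \<pi>] by (simp add: \<pi>_def)
  qed
  ultimately show ?thesis
    using field_F prime_p odd card_res
    by (intro odd_finite_field.intro odd_finite_field_axioms.intro) auto
qed

text \<open>Expansion to second order with the remainder kept as a multiple of z^3, the precision
  required for p-th powers of 1 + \<pi>^j e.\<close>

lemma one_plus_pow:
  assumes z: "z \<in> carrier R"
  shows "\<exists>w\<in>carrier R. (\<one> \<oplus> z) [^] (n::nat) =
    \<one> \<oplus> add_pow R n \<one> \<otimes> z \<oplus> add_pow R (n choose 2) \<one> \<otimes> (z \<otimes> z) \<oplus> z \<otimes> z \<otimes> z \<otimes> w"
proof (induction n)
  case 0
  then show ?case using z by (intro bexI[of _ \<zero>]) (auto simp: binomial_eq_0)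
next
  case (Suc n)
  then obtain w where w: "w \<in> carrier R" "(\<one> \<oplus> z) [^] n =
    \<one> \<oplus> add_pow R n \<one> \<otimes> z \<oplus> add_pow R (n choose 2) \<one> \<otimes> (z \<otimes> z) \<oplus> z \<otimes> z \<otimes> z \<otimes> w" by blast
  define a where "a = add_pow R n \<one>"
  define b where "b = add_pow R (n choose 2) \<one>"
  have ab: "a \<in> carrier R" "b \<in> carrier R" by (auto simp: a_def b_def)
  have sn: "add_pow R (Suc n) \<one> = a \<oplus> \<one>" by (simp add: a_def)
  have c2: "Suc n choose 2 = n + (n choose 2)" by (simp add: numeral_2_eq_2)
  have sb: "add_pow R (Suc n choose 2) \<one> = a \<oplus> b" unfolding c2 a_def b_def by (simp add: add.nat_pow_mult)
  define v where "v = w \<oplus> b \<oplus> z \<otimes> w"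
  have v: "v \<in> carrier R" using ab w z by (simp add: v_def)
  have "(\<one> \<oplus> z) [^] Suc n = (\<one> \<oplus> a \<otimes> z \<oplus> b \<otimes> (z \<otimes> z) \<oplus> z \<otimes> z \<otimes> z \<otimes> w) \<otimes> (\<one> \<oplus> z)"
    using w by (simp add: a_def b_def)
  also have "\<dots> = \<one> \<oplus> (a \<oplus> \<one>) \<otimes> z \<oplus> (a \<oplus> b) \<otimes> (z \<otimes> z) \<oplus> z \<otimes> z \<otimes> z \<otimes> v"
    unfolding v_def using ab w(1) z by algebra
  finally show ?case unfolding sn sb using v by blast
qed

text \<open>With z = \<pi>^j e, the quadratic term gains a factor p from (p choose 2) since p is
  odd, and the cubic term has order at least 3j \<ge> j + 2. So only 1 + p z survives modulo
  \<pi>^(j+2).\<close>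

lemma one_plus_pi_power_step:
  assumes e: "e \<in> carrier R" and j: "1 \<le> j"
  shows "\<exists>w\<in>carrier R. (\<one> \<oplus> \<pi> [^] j \<otimes> e) [^] p = \<one> \<oplus> \<pi> [^] Suc j \<otimes> (e \<oplus> \<pi> \<otimes> w)"
proof -
  define z where "z = \<pi> [^] j \<otimes> e"
  have z: "z \<in> carrier R" using e by (simp add: z_def)
  obtain w where w: "w \<in> carrier R" "(\<one> \<oplus> z) [^] p =
    \<one> \<oplus> add_pow R p \<one> \<otimes> z \<oplus> add_pow R (p choose 2) \<one> \<otimes> (z \<otimes> z) \<oplus> z \<otimes> z \<otimes> z \<otimes> w"
    using one_plus_pow[OF z, of p] by blast
  have "p dvd (p choose 2)" using odd prime_p by (intro dvd_choose_prime) auto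
  then obtain m where m: "p choose 2 = p * m" by (rule dvdE)
  define c where "c = add_pow R m \<one>"
  have c: "c \<in> carrier R" by (simp add: c_def)
  have c2: "add_pow R (p choose 2) \<one> = \<pi> \<otimes> c"
    unfolding m \<pi>_def c_def by (simp add: add_pow_ldistr add.nat_pow_pow mult.commute)
  obtain i where i: "j = Suc i" using j by (cases j) auto
  define y where "y = \<pi> [^] i"
  have y: "y \<in> carrier R" by (simp add: y_def)
  have zy: "z = y \<otimes> \<pi> \<otimes> e" unfolding z_def y_def i by simp
  have pj: "\<pi> [^] Suc j = y \<otimes> \<pi> \<otimes> \<pi>" unfolding y_def i by simp
  define v where "v = y \<otimes> c \<otimes> e \<otimes> e \<oplus> y \<otimes> y \<otimes> e \<otimes> e \<otimes> e \<otimes> w"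
  have v: "v \<in> carrier R" using y c e w by (simp add: v_def)
  have "(\<one> \<oplus> z) [^] p = \<one> \<oplus> \<pi> \<otimes> z \<oplus> \<pi> \<otimes> c \<otimes> (z \<otimes> z) \<oplus> z \<otimes> z \<otimes> z \<otimes> w"
    unfolding w(2) c2 \<pi>_def[symmetric] ..
  also have "\<dots> = \<one> \<oplus> \<pi> [^] Suc j \<otimes> (e \<oplus> \<pi> \<otimes> v)"
  proof -
    have "\<one> \<oplus> t \<otimes> (y \<otimes> t \<otimes> e) \<oplus> t \<otimes> c \<otimes> ((y \<otimes> t \<otimes> e) \<otimes> (y \<otimes> t \<otimes> e)) \<oplus>
        (y \<otimes> t \<otimes> e) \<otimes> (y \<otimes> t \<otimes> e) \<otimes> (y \<otimes> t \<otimes> e) \<otimes> w =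
       \<one> \<oplus> (y \<otimes> t \<otimes> t) \<otimes> (e \<oplus> t \<otimes> (y \<otimes> c \<otimes> e \<otimes> e \<oplus> y \<otimes> y \<otimes> e \<otimes> e \<otimes> e \<otimes> w))"
      if "t \<in> carrier R" for t
      using that y e c w(1) by algebra
    from this[OF pi_closed] show ?thesis unfolding zy pj v_def .
  qed
  finally show ?thesis unfolding z_def using v by blast
qed

text \<open>Each p-th power pushes the layer up by one and preserves its leading coefficient modulo
  p.\<close>

lemma one_plus_pi_power:
  assumes e: "e \<in> carrier R" and j: "1 \<le> j"
  shows "\<exists>w\<in>carrier R. (\<one> \<oplus> \<pi> [^] j \<otimes> e) [^] (p ^ m) = \<one> \<oplus> \<pi> [^] (j + m) \<otimes> (e \<oplus> \<pi> \<otimes> w)"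
proof (induction m)
  case 0
  then show ?case using e by (intro bexI[of _ \<zero>]) auto
next
  case (Suc m)
  then obtain w where w: "w \<in> carrier R"
    "(\<one> \<oplus> \<pi> [^] j \<otimes> e) [^] (p ^ m) = \<one> \<oplus> \<pi> [^] (j + m) \<otimes> (e \<oplus> \<pi> \<otimes> w)" by blast
  obtain v where v: "v \<in> carrier R" "(\<one> \<oplus> \<pi> [^] (j + m) \<otimes> (e \<oplus> \<pi> \<otimes> w)) [^] p =
     \<one> \<oplus> \<pi> [^] Suc (j + m) \<otimes> ((e \<oplus> \<pi> \<otimes> w) \<oplus> \<pi> \<otimes> v)"
    using one_plus_pi_power_step[of "e \<oplus> \<pi> \<otimes> w" "j + m"] e w j by auto
  have "(\<one> \<oplus> \<pi> [^] j \<otimes> e) [^] (p ^ Suc m) = ((\<one> \<oplus> \<pi> [^] j \<otimes> e) [^] (p ^ m)) [^] p"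
    using e by (simp add: nat_pow_pow mult.commute)
  also have "\<dots> = \<one> \<oplus> \<pi> [^] (j + Suc m) \<otimes> (e \<oplus> \<pi> \<otimes> (w \<oplus> v))"
    unfolding w(2) v(2) using e w v by (simp add: r_distr a_assoc del: nat_pow_Suc)
  finally show ?case using w v by blast
qed

end

section \<open>The top layer of the unit group\<close>

lemma (in cring) m_exchange:
  assumes "a \<in> carrier R" "b \<in> carrier R" "c \<in> carrier R" "e \<in> carrier R"
  shows "(a \<otimes> b) \<otimes> (c \<otimes> e) = (a \<otimes> c) \<otimes> (e \<otimes> b)"
  using assms by (simp add: m_ac)

lemma (in cring) add_minus_cancel:
  assumes "x \<in> carrier R" "y \<in> carrier R"
  shows "x \<oplus> y \<ominus> x = y" and "x \<oplus> (y \<ominus> x) = y"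
proof -
  have "(x \<oplus> y \<ominus> x) \<ominus> y = \<zero>" using assms by algebra
  then show "x \<oplus> y \<ominus> x = y" using assms by simp
  have "(x \<oplus> (y \<ominus> x)) \<ominus> y = \<zero>" using assms by algebra
  then show "x \<oplus> (y \<ominus> x) = y" using assms by simp
qed

locale odd_galois_ring_unit_subgroup = odd_galois_ring +
  fixes K :: "'a set"
  assumes K_subgroup: "subgroup K (units_of R)" and d_ge_2: "2 \<le> d"

sublocale odd_galois_ring_unit_subgroup \<subseteq> finite_cring_unit_subgroup R K
  by (intro finite_cring_unit_subgroup.intro finite_cring_unit_subgroup_axioms.intro is_cring finite_R K_subgroup)

context odd_galois_ring_unit_subgroup begin

definition P :: 'a where "P = \<pi> [^] (d - 1)"

text \<open>The trace of K on the top layer, written additively. It is a union of residue classes,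
  and it is the whole ring exactly when 1 + p^(d-1) R lies in K.\<close>

definition H :: "'a set" where "H = {z \<in> carrier R. \<one> \<oplus> P \<otimes> z \<in> K}"

lemma P_closed [simp]: "P \<in> carrier R" by (simp add: P_def)

lemma P_square: "P \<otimes> P = \<zero>"
  unfolding P_def using d_ge_2 by (simp add: nat_pow_mult pi_power_ge)

lemma P_mult_I: "x \<in> I \<Longrightarrow> P \<otimes> x = \<zero>"
  using pi_power_mult_I[of x "d - 1"] d_pos pi_power_d unfolding P_def by auto

lemma P_annihilator: "x \<in> carrier R \<Longrightarrow> P \<otimes> x = \<zero> \<Longrightarrow> x \<in> I"
  unfolding P_def using d_pos by (intro pi_power_annihilator[of "d - 1"]) auto

lemma P_in_I: "P \<in> I"
  unfolding I_iff P_def using d_ge_2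
  by (intro bexI[of _ "\<pi> [^] (d - 2)"]) (auto simp: numeral_2_eq_2 m_comm[of \<pi>] nat_pow_Suc[symmetric] Suc_diff_Suc simp del: nat_pow_Suc)

text \<open>\<open>P\<close> squares to zero because 2(d - 1) \<ge> d for d \<ge> 2, so
  multiplication in the top layer is addition of coefficients.\<close>

lemma one_plus_P_mult:
  assumes z: "z \<in> carrier R" and w: "w \<in> carrier R"
  shows "(\<one> \<oplus> P \<otimes> z) \<otimes> (\<one> \<oplus> P \<otimes> w) = \<one> \<oplus> P \<otimes> (z \<oplus> w)"
proof -
  have "(\<one> \<oplus> P \<otimes> z) \<otimes> (\<one> \<oplus> P \<otimes> w) = \<one> \<oplus> P \<otimes> (z \<oplus> w) \<oplus> (P \<otimes> P) \<otimes> (z \<otimes> w)"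
  proof (rule diff_zeroI)
    have *: "\<And>t. t \<in> carrier R \<Longrightarrow> (\<one> \<oplus> t \<otimes> z) \<otimes> (\<one> \<oplus> t \<otimes> w) \<ominus> (\<one> \<oplus> t \<otimes> (z \<oplus> w) \<oplus> (t \<otimes> t) \<otimes> (z \<otimes> w)) = \<zero>"
    proof -
      fix t assume t: "t \<in> carrier R"
      show "(\<one> \<oplus> t \<otimes> z) \<otimes> (\<one> \<oplus> t \<otimes> w) \<ominus> (\<one> \<oplus> t \<otimes> (z \<oplus> w) \<oplus> (t \<otimes> t) \<otimes> (z \<otimes> w)) = \<zero>"
        using t z w by algebra
    qed
    show "(\<one> \<oplus> P \<otimes> z) \<otimes> (\<one> \<oplus> P \<otimes> w) \<ominus> (\<one> \<oplus> P \<otimes> (z \<oplus> w) \<oplus> (P \<otimes> P) \<otimes> (z \<otimes> w)) = \<zero>"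
      by (rule *) simp
  qed (use z w in auto)
  then show ?thesis using z w by (simp add: P_square)
qed

lemma H_closed: "z \<in> H \<Longrightarrow> z \<in> carrier R" by (simp add: H_def)

lemma I_subset_H: "x \<in> I \<Longrightarrow> x \<in> H"
  by (simp add: H_def P_mult_I K_one)

lemma H_add: "z \<in> H \<Longrightarrow> w \<in> H \<Longrightarrow> z \<oplus> w \<in> H"
  using one_plus_P_mult[of z w] K_mult[of "\<one> \<oplus> P \<otimes> z" "\<one> \<oplus> P \<otimes> w"] by (simp add: H_def)

lemma one_plus_P_inv:
  assumes z: "z \<in> carrier R"
  shows "(\<one> \<oplus> P \<otimes> z) \<otimes> (\<one> \<oplus> P \<otimes> (\<ominus> z)) = \<one>"
  using one_plus_P_mult[of z "\<ominus> z"] z by (simp add: r_neg)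

lemma H_minus:
  assumes "z \<in> H"
  shows "\<ominus> z \<in> H"
proof -
  have z: "z \<in> carrier R" "\<one> \<oplus> P \<otimes> z \<in> K" using assms by (auto simp: H_def)
  have "inv (\<one> \<oplus> P \<otimes> z) = \<one> \<oplus> P \<otimes> (\<ominus> z)"
    using one_plus_P_inv[OF z(1)] z by (intro comm_inv_char) auto
  then show ?thesis using K_inv[OF z(2)] z by (simp add: H_def)
qed

lemma H_diff: "z \<in> H \<Longrightarrow> w \<in> H \<Longrightarrow> z \<ominus> w \<in> H"
  unfolding minus_eq by (intro H_add H_minus)

lemma H_cong:
  assumes "z \<in> H" "x \<in> carrier R" "x \<ominus> z \<in> I"
  shows "x \<in> H"
proof -
  have "x = (x \<ominus> z) \<oplus> z" using assms(2) H_closed[OF assms(1)] by (simp add: minus_eq a_assoc l_neg)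
  then show ?thesis using H_add[OF I_subset_H[OF assms(3)] assms(1)] by simp
qed

text \<open>The power p^(d-1-j) lifts layer j to the top and keeps e modulo p. Hence one group
  \<open>H\<close> controls the leading coefficients of K in every layer, which drives the induction
  in \<open>rigid\<close>.\<close>

lemma layer_in_H:
  assumes e: "e \<in> carrier R" and j: "1 \<le> j" "j < d" and k: "\<one> \<oplus> \<pi> [^] j \<otimes> e \<in> K"
  shows "e \<in> H"
proof -
  obtain w where w: "w \<in> carrier R"
    "(\<one> \<oplus> \<pi> [^] j \<otimes> e) [^] (p ^ (d - 1 - j)) = \<one> \<oplus> \<pi> [^] (j + (d - 1 - j)) \<otimes> (e \<oplus> \<pi> \<otimes> w)"
    using one_plus_pi_power[OF e j(1)] by blast
  have "j + (d - 1 - j) = d - 1" using j by simp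
  then have "e \<oplus> \<pi> \<otimes> w \<in> H" using w e K_pow[OF k, of "p ^ (d - 1 - j)"] by (simp add: H_def P_def)
  moreover have "e \<ominus> (e \<oplus> \<pi> \<otimes> w) = \<pi> \<otimes> (\<ominus> w)"
    using e w by (simp add: minus_eq minus_add a_assoc[symmetric] r_neg r_minus)
  then have "e \<ominus> (e \<oplus> \<pi> \<otimes> w) \<in> I" using w by (auto simp: I_iff)
  ultimately show ?thesis using H_cong e by blast
qed

lemma cyc_map_diff_I_iff:
  assumes f: "cyc_map f" and x: "x \<in> carrier R" and y: "y \<in> carrier R"
  shows "f y \<ominus> f x \<in> I \<longleftrightarrow> y \<ominus> x \<in> I"
proof -
  obtain k where k: "k \<in> K" "f y \<ominus> f x = (y \<ominus> x) \<otimes> k" using cyc_mapE[OF f x y] .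
  have "y \<ominus> x = (f y \<ominus> f x) \<otimes> inv k" unfolding k(2) using K_cancel[OF k(1)] x y by simp
  then show ?thesis using k K_inv[OF k(1)] I_rmult K_closed by metis
qed

lemma cyc_map_diff_Units:
  assumes f: "cyc_map f" and x: "x \<in> carrier R" and y: "y \<in> carrier R" and u: "y \<ominus> x \<in> Units R"
  shows "f y \<ominus> f x \<in> Units R"
proof -
  have "f y \<ominus> f x \<notin> I" using cyc_map_diff_I_iff[OF f x y] Units_notin_I[OF u] by simp
  then show ?thesis using notin_I_Units cyc_map_closed[OF f] x y by simp
qed

lemma cyc_map_top_layer:
  assumes f: "cyc_map f" and y: "y \<in> carrier R" and w: "w \<in> carrier R"
  shows "\<exists>h\<in>carrier R. f (y \<oplus> P \<otimes> w) = f y \<oplus> P \<otimes> h"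
proof -
  obtain k where k: "k \<in> K" "f (y \<oplus> P \<otimes> w) \<ominus> f y = (y \<oplus> P \<otimes> w \<ominus> y) \<otimes> k"
    using cyc_mapE[OF f y, of "y \<oplus> P \<otimes> w"] y w by auto
  have fc: "f (y \<oplus> P \<otimes> w) \<in> carrier R" "f y \<in> carrier R" using cyc_map_closed[OF f] y w by auto
  have "y \<oplus> P \<otimes> w \<ominus> y = P \<otimes> w" using y w by (simp add: add_minus_cancel)
  then have "f (y \<oplus> P \<otimes> w) \<ominus> f y = P \<otimes> (w \<otimes> k)" using k w by (simp add: m_assoc)
  moreover have "f (y \<oplus> P \<otimes> w) = f y \<oplus> (f (y \<oplus> P \<otimes> w) \<ominus> f y)"
    using fc by (simp add: add_minus_cancel)
  ultimately show ?thesis using k w by (metis K_closed m_closed)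
qed

text \<open>The inverse permutation is again an automorphism, so it respects top layers too.\<close>

lemma cyc_map_top_layer_surj:
  assumes f: "cyc_map f" and y: "y \<in> carrier R" and v: "v \<in> carrier R"
  shows "\<exists>w\<in>carrier R. f (y \<oplus> P \<otimes> w) = f y \<oplus> P \<otimes> v"
proof -
  let ?g = "inv_into (carrier R) f"
  have b: "inj_on f (carrier R)" "f ` carrier R = carrier R"
    using cyc_map_bij[OF f] by (auto simp: bij_betw_def)
  obtain w where w: "w \<in> carrier R" "?g (f y \<oplus> P \<otimes> v) = ?g (f y) \<oplus> P \<otimes> w"
    using cyc_map_top_layer[OF cyc_map_inv_into[OF f] cyc_map_closed[OF f y] v] by blast
  have "f y \<oplus> P \<otimes> v \<in> f ` carrier R" using cyc_map_closed[OF f y] v b by simp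
  then have "f y \<oplus> P \<otimes> v = f (?g (f y \<oplus> P \<otimes> v))" by (simp only: f_inv_into_f)
  also have "\<dots> = f (y \<oplus> P \<otimes> w)" using w b y by (simp add: inv_into_f_f)
  finally show ?thesis using w by metis
qed

text \<open>Put A = f y - f x and B = y - x. Moving y by P w turns these into A (1 + P a) and B (1 +
  P b), and both A/B and the new ratio lie in K, so (1 + P a) / (1 + P b) = 1 + P (a - b) does. The
  pair (w, h) does not involve x, which remains free: this is the adjointness modulo H.\<close>

lemma top_layer_quotients:
  assumes f: "cyc_map f" and x: "x \<in> carrier R" and y: "y \<in> carrier R" and w: "w \<in> carrier R"
    and h: "h \<in> carrier R" "f (y \<oplus> P \<otimes> w) = f y \<oplus> P \<otimes> h" and u: "y \<ominus> x \<in> Units R"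
  shows "h \<otimes> inv (f y \<ominus> f x) \<ominus> w \<otimes> inv (y \<ominus> x) \<in> H"
proof -
  define A where "A = f y \<ominus> f x"
  define B where "B = y \<ominus> x"
  have A: "A \<in> Units R" "A \<in> carrier R" "inv A \<in> carrier R" "A \<otimes> inv A = \<one>"
    using cyc_map_diff_Units[OF f x y u] by (auto simp: A_def)
  have B: "B \<in> Units R" "B \<in> carrier R" "inv B \<in> carrier R" "B \<otimes> inv B = \<one>" "inv B \<otimes> B = \<one>"
    using u by (auto simp: B_def)
  have fc: "f x \<in> carrier R" "f y \<in> carrier R" using cyc_map_closed[OF f] x y by auto
  obtain k where k: "k \<in> K" "f (y \<oplus> P \<otimes> w) \<ominus> f x = (y \<oplus> P \<otimes> w \<ominus> x) \<otimes> k"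
    using cyc_mapE[OF f x, of "y \<oplus> P \<otimes> w"] y w by auto
  obtain l where l: "l \<in> K" "A = B \<otimes> l" using cyc_mapE[OF f x y] unfolding A_def B_def by blast
  note lu = K_Units[OF l(1)]
  define a where "a = h \<otimes> inv A"
  define b where "b = w \<otimes> inv B"
  have ab: "a \<in> carrier R" "b \<in> carrier R" using A B h w by (auto simp: a_def b_def)
  have e1: "f (y \<oplus> P \<otimes> w) \<ominus> f x = A \<otimes> (\<one> \<oplus> P \<otimes> a)"
  proof -
    have "A \<otimes> (\<one> \<oplus> P \<otimes> a) = A \<oplus> P \<otimes> h \<otimes> (A \<otimes> inv A)"
      unfolding a_def using A(2,3) h by (simp add: r_distr m_ac)
    also have "\<dots> = A \<oplus> P \<otimes> h" unfolding A(4) using A(2) h by simp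
    finally show ?thesis unfolding h(2) A_def using fc h by (simp add: minus_eq a_ac)
  qed
  have e2: "y \<oplus> P \<otimes> w \<ominus> x = B \<otimes> (\<one> \<oplus> P \<otimes> b)"
  proof -
    have "B \<otimes> (\<one> \<oplus> P \<otimes> b) = B \<oplus> P \<otimes> w \<otimes> (B \<otimes> inv B)"
      unfolding b_def using B(2,3) w by (simp add: r_distr m_ac)
    also have "\<dots> = B \<oplus> P \<otimes> w" unfolding B(4) using B(2) w by simp
    finally show ?thesis unfolding B_def using x y w by (simp add: minus_eq a_ac)
  qed
  define s where "s = \<one> \<oplus> P \<otimes> a"
  define t where "t = \<one> \<oplus> P \<otimes> b"
  define t' where "t' = \<one> \<oplus> P \<otimes> (\<ominus> b)"
  have XY: "s \<in> carrier R" "t \<in> carrier R" "t' \<in> carrier R" using ab by (auto simp: s_def t_def t'_def)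
  have "B \<otimes> (l \<otimes> s) = B \<otimes> (t \<otimes> k)"
    using e1 e2 k l XY B(2) unfolding s_def[symmetric] t_def[symmetric] by (simp add: m_assoc)
  then have lX: "l \<otimes> s = t \<otimes> k" using Units_l_cancel[OF B(1)] l k XY by simp
  have "s \<otimes> t' = (l \<otimes> inv l) \<otimes> (s \<otimes> t')" using lu XY by simp
  also have "\<dots> = (l \<otimes> s) \<otimes> (t' \<otimes> inv l)"
    using XY l Units_inv_closed[OF lu] by (intro m_exchange) auto
  also have "\<dots> = (t \<otimes> t') \<otimes> (inv l \<otimes> k)"
    unfolding lX using XY k Units_inv_closed[OF lu] by (intro m_exchange) auto
  also have "t \<otimes> t' = \<one>" unfolding t_def t'_def by (rule one_plus_P_inv[OF ab(2)])
  also have "\<one> \<otimes> (inv l \<otimes> k) = inv l \<otimes> k" using k Units_inv_closed[OF lu] by simp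
  finally have "s \<otimes> t' \<in> K" using K_mult[OF K_inv[OF l(1)] k(1)] by simp
  then have "\<one> \<oplus> P \<otimes> (a \<oplus> \<ominus> b) \<in> K"
    unfolding s_def t'_def using one_plus_P_mult[of a "\<ominus> b"] ab by simp
  then show ?thesis using ab unfolding a_def b_def A_def B_def H_def by (simp add: minus_eq)
qed

text \<open>If c were a unit, its multiples would fill the ring and \<open>H\<close> would be
  everything. This turns relations modulo \<open>H\<close> into congruences modulo p; the slack
  \<open>I\<close> costs nothing, as \<open>I\<close> lies in \<open>H\<close>.\<close>

lemma all_multiples_in_H:
  assumes proper: "H \<noteq> carrier R" and c: "c \<in> carrier R"
    and all: "\<And>v. v \<in> carrier R \<Longrightarrow> \<exists>i\<in>H. v \<otimes> c \<ominus> i \<in> I"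
  shows "c \<in> I"
proof (rule ccontr)
  assume "c \<notin> I"
  then have u: "c \<in> Units R" using c notin_I_Units by blast
  have "z \<in> H" if z: "z \<in> carrier R" for z
  proof -
    obtain i where i: "i \<in> H" "(z \<otimes> inv c) \<otimes> c \<ominus> i \<in> I" using all[of "z \<otimes> inv c"] z u by auto
    have "(z \<otimes> inv c) \<otimes> c = z" using z u c by (simp add: m_assoc)
    then show ?thesis using i z H_cong by simp
  qed
  then show False using proper H_closed by blast
qed

lemma additive_subgroup_image_H: "additive_subgroup (cls ` H) F"
proof -
  interpret F: field F by (rule field_F)
  show ?thesis
  proof (intro additive_subgroup.intro subgroup.intro)
    show "cls ` H \<subseteq> carrier (add_monoid F)" using H_closed by auto
    show "\<one>\<^bsub>add_monoid F\<^esub> \<in> cls ` H"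
      using imageI[OF I_subset_H[OF I_zero], of cls] by simp
  next
    fix C D assume "C \<in> cls ` H" "D \<in> cls ` H"
    then obtain z w where zw: "z \<in> H" "w \<in> H" "C = cls z" "D = cls w" by blast
    then have "C \<otimes>\<^bsub>add_monoid F\<^esub> D = cls (z \<oplus> w)" using H_closed by simp
    then show "C \<otimes>\<^bsub>add_monoid F\<^esub> D \<in> cls ` H" using H_add[OF zw(1,2)] by simp
  next
    fix C assume "C \<in> cls ` H"
    then obtain z where z: "z \<in> H" "C = cls z" by blast
    have "inv\<^bsub>add_monoid F\<^esub> C = \<ominus>\<^bsub>F\<^esub> C" by (simp add: a_inv_def)
    also have "\<dots> = cls (\<ominus> z)" using z H_closed by simp
    finally show "inv\<^bsub>add_monoid F\<^esub> C \<in> cls ` H" using H_minus[OF z(1)] by simp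
  qed
qed

text \<open>No information is lost in the residue field because \<open>H\<close> contains the whole
  ideal \<open>I\<close>.\<close>

lemma cls_in_image_H_iff:
  assumes x: "x \<in> carrier R"
  shows "cls x \<in> cls ` H \<longleftrightarrow> x \<in> H"
proof
  assume "cls x \<in> cls ` H"
  then obtain z where z: "z \<in> H" "cls x = cls z" by blast
  then show "x \<in> H" using H_cong[OF z(1) x] cls_eq_iff[OF x H_closed[OF z(1)]] by simp
qed (rule imageI)

lemma image_H_proper:
  assumes "H \<noteq> carrier R"
  shows "cls ` H \<noteq> carrier F"
proof
  assume eq: "cls ` H = carrier F"
  have "x \<in> H" if "x \<in> carrier R" for x
    using cls_in_image_H_iff[OF that] cls_closed[OF that] eq by simp
  then show False using assms H_closed by blast
qed

end

lemma (in ring) Units_uminus: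
  assumes "a \<in> Units R"
  shows "\<ominus> a \<in> Units R"
  using Units_m_closed[OF Units_minus_one_closed assms] Units_closed[OF assms] by (simp add: l_minus)

section \<open>Residue maps and rigidity when H is proper\<close>

context odd_galois_ring_unit_subgroup begin

context
  assumes proper: "H \<noteq> carrier R"
begin

text \<open>Taking x = y - 1/a in the adjointness relation puts v \<rho>(a) - w a into
  \<open>H\<close>, where w depends on y and v but not on a. Since w a is additive in a, every
  multiple v of the additivity defect of \<rho> lies in \<open>H\<close>, so the defect is 0 modulo
  p.\<close>

lemma residue_quotients:
  assumes f: "cyc_map f" and y: "y \<in> carrier R"
  defines "\<rho> \<equiv> \<lambda>a. inv (f y \<ominus> f (y \<ominus> inv a))"
  shows "a \<in> Units R \<Longrightarrow> \<rho> a \<in> carrier R"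
    and "a \<in> Units R \<Longrightarrow> b \<in> Units R \<Longrightarrow> a \<oplus> b \<in> Units R \<Longrightarrow> \<rho> (a \<oplus> b) \<ominus> (\<rho> a \<oplus> \<rho> b) \<in> I"
    and "a \<in> Units R \<Longrightarrow> \<rho> (\<ominus> a) \<oplus> \<rho> a \<in> I"
proof -
  have rback: "y \<ominus> (y \<ominus> inv a) = inv a" if a: "a \<in> Units R" for a
  proof -
    have "y \<ominus> (y \<ominus> t) \<ominus> t = \<zero>" if "t \<in> carrier R" for t using y that by algebra
    then show ?thesis using a y by simp
  qed
  have rc: "\<rho> a \<in> carrier R" if a: "a \<in> Units R" for a
    unfolding \<rho>_def using cyc_map_diff_Units[OF f, of "y \<ominus> inv a" y] a y rback[OF a] by simp
  then show "a \<in> Units R \<Longrightarrow> \<rho> a \<in> carrier R" .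
  have base: "v \<otimes> \<rho> a \<ominus> w \<otimes> a \<in> H"
    if a: "a \<in> Units R" and v: "v \<in> carrier R" and w: "w \<in> carrier R" "f (y \<oplus> P \<otimes> w) = f y \<oplus> P \<otimes> v" for a v w
    using top_layer_quotients[OF f _ y w(1) v w(2), of "y \<ominus> inv a"] a y rback[OF a] by (simp add: \<rho>_def)
  {
    assume a: "a \<in> Units R" and b: "b \<in> Units R" and ab: "a \<oplus> b \<in> Units R"
    define c where "c = \<rho> (a \<oplus> b) \<ominus> (\<rho> a \<oplus> \<rho> b)"
    have c: "c \<in> carrier R" using rc a b ab by (simp add: c_def)
    show "\<rho> (a \<oplus> b) \<ominus> (\<rho> a \<oplus> \<rho> b) \<in> I" unfolding c_def[symmetric]
    proof (rule all_multiples_in_H[OF proper c])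
      fix v assume v: "v \<in> carrier R"
      obtain w where w: "w \<in> carrier R" "f (y \<oplus> P \<otimes> w) = f y \<oplus> P \<otimes> v"
        using cyc_map_top_layer_surj[OF f y v] by blast
      define l m n where "l = \<rho> (a \<oplus> b)" "m = \<rho> a" "n = \<rho> b"
      have lmn: "l \<in> carrier R" "m \<in> carrier R" "n \<in> carrier R" using rc a b ab by (auto simp: l_m_n_def)
      have abc: "a \<in> carrier R" "b \<in> carrier R" using a b by auto
      have ms: "v \<otimes> l \<ominus> w \<otimes> (a \<oplus> b) \<in> H" "v \<otimes> m \<ominus> w \<otimes> a \<in> H" "v \<otimes> n \<ominus> w \<otimes> b \<in> H"
        unfolding l_m_n_def using base[OF _ v w] a b ab by auto
      have "(v \<otimes> l \<ominus> w \<otimes> (a \<oplus> b)) \<ominus> (v \<otimes> m \<ominus> w \<otimes> a) \<ominus> (v \<otimes> n \<ominus> w \<otimes> b) \<in> H"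
        by (rule H_diff[OF H_diff[OF ms(1,2)] ms(3)])
      moreover have "v \<otimes> (l \<ominus> (m \<oplus> n)) \<ominus> ((v \<otimes> l \<ominus> w \<otimes> (a \<oplus> b)) \<ominus> (v \<otimes> m \<ominus> w \<otimes> a) \<ominus> (v \<otimes> n \<ominus> w \<otimes> b)) = \<zero>"
        using lmn abc v w(1) by algebra
      ultimately show "\<exists>i\<in>H. v \<otimes> c \<ominus> i \<in> I" unfolding c_def l_m_n_def using I_zero by metis
    qed
  }
  {
    assume a: "a \<in> Units R"
    have ma: "\<ominus> a \<in> Units R" using a by (rule Units_uminus)
    define c where "c = \<rho> (\<ominus> a) \<oplus> \<rho> a"
    have c: "c \<in> carrier R" using rc a ma by (simp add: c_def)
    show "\<rho> (\<ominus> a) \<oplus> \<rho> a \<in> I" unfolding c_def[symmetric]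
    proof (rule all_multiples_in_H[OF proper c])
      fix v assume v: "v \<in> carrier R"
      obtain w where w: "w \<in> carrier R" "f (y \<oplus> P \<otimes> w) = f y \<oplus> P \<otimes> v"
        using cyc_map_top_layer_surj[OF f y v] by blast
      define l m where "l = \<rho> (\<ominus> a)" "m = \<rho> a"
      have lm: "l \<in> carrier R" "m \<in> carrier R" using rc a ma by (auto simp: l_m_def)
      have ac: "a \<in> carrier R" using a by auto
      have "v \<otimes> l \<ominus> w \<otimes> (\<ominus> a) \<in> H" "v \<otimes> m \<ominus> w \<otimes> a \<in> H"
        unfolding l_m_def using base[OF _ v w] a ma by auto
      then have "(v \<otimes> l \<ominus> w \<otimes> (\<ominus> a)) \<oplus> (v \<otimes> m \<ominus> w \<otimes> a) \<in> H" by (rule H_add)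
      moreover have "v \<otimes> (l \<oplus> m) \<ominus> ((v \<otimes> l \<ominus> w \<otimes> (\<ominus> a)) \<oplus> (v \<otimes> m \<ominus> w \<otimes> a)) = \<zero>"
        using lm ac v w(1) by algebra
      ultimately show "\<exists>i\<in>H. v \<otimes> c \<ominus> i \<in> I" unfolding c_def l_m_def using I_zero by metis
    qed
  }
qed

text \<open>Differences only gain unit factors, so f preserves and reflects congruence modulo p and
  induces an injection g of the residue field; \<open>residue_quotients\<close> provides the
  hypotheses of \<open>hua\<close> for g.\<close>

lemma residue_automorphism:
  assumes f: "cyc_map f" "f \<zero> = \<zero>" "f \<one> = \<one>" and x: "x \<in> carrier R" and y: "y \<in> carrier R"
  shows "cls (f (x \<oplus> y)) = cls (f x) \<oplus>\<^bsub>F\<^esub> cls (f y)" "cls (f (x \<otimes> y)) = cls (f x) \<otimes>\<^bsub>F\<^esub> cls (f y)"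
proof -
  interpret F: odd_finite_field F p r "p ^ r" by (rule odd_finite_field_F)
  define rep where "rep C = (SOME x. x \<in> carrier R \<and> cls x = C)" for C
  have rep: "rep C \<in> carrier R" "cls (rep C) = C" if "C \<in> carrier F" for C
    using someI_ex[of "\<lambda>x. x \<in> carrier R \<and> cls x = C"] cls_surj[OF that] unfolding rep_def by blast+
  define g where "g C = cls (f (rep C))" for C
  have fc: "f x \<in> carrier R" if "x \<in> carrier R" for x using cyc_map_closed[OF f(1) that] .
  have f_cong: "cls (f x) = cls (f y) \<longleftrightarrow> cls x = cls y" if "x \<in> carrier R" "y \<in> carrier R" for x y
    using cyc_map_diff_I_iff[OF f(1) that(2,1)] cls_eq_iff fc that by simp
  have g: "g (cls x) = cls (f x)" if "x \<in> carrier R" for x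
    unfolding g_def using f_cong[of "rep (cls x)" x] rep[of "cls x"] that by simp
  have gc: "g C \<in> carrier F" if "C \<in> carrier F" for C unfolding g_def using rep[OF that] fc by simp
  have inj: "inj_on g (carrier F)"
    by (rule inj_onI) (metis f_cong g_def rep)
  define Q where "Q Y A = inv\<^bsub>F\<^esub> (g Y \<ominus>\<^bsub>F\<^esub> g (Y \<ominus>\<^bsub>F\<^esub> inv\<^bsub>F\<^esub> A))" for Y A
  have Q: "Q (cls y) (cls a) = cls (inv (f y \<ominus> f (y \<ominus> inv a)))" if y: "y \<in> carrier R" and a: "a \<in> Units R" for y a
  proof -
    have "y \<ominus> (y \<ominus> t) \<ominus> t = \<zero>" if "t \<in> carrier R" for t using y that by algebra
    then have "y \<ominus> (y \<ominus> inv a) = inv a" using y a by simp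
    then have u: "f y \<ominus> f (y \<ominus> inv a) \<in> Units R" using cyc_map_diff_Units[OF f(1), of "y \<ominus> inv a" y] y a by simp
    have "Q (cls y) (cls a) = inv\<^bsub>F\<^esub> (cls (f y) \<ominus>\<^bsub>F\<^esub> g (cls (y \<ominus> inv a)))"
      unfolding Q_def g[OF y] using y a by simp
    also have "\<dots> = inv\<^bsub>F\<^esub> (cls (f y \<ominus> f (y \<ominus> inv a)))"
      using g[of "y \<ominus> inv a"] fc y a by simp
    also have "\<dots> = cls (inv (f y \<ominus> f (y \<ominus> inv a)))" using u by (rule cls_inv[symmetric])
    finally show ?thesis .
  qed
  have unit: "\<exists>a\<in>Units R. cls a = A" if A: "A \<in> carrier F" "A \<noteq> \<zero>\<^bsub>F\<^esub>" for A
  proof (intro bexI)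
    show "cls (rep A) = A" using rep A by simp
    then have "rep A \<notin> I" using cls_eq_zero_iff[of "rep A"] rep A by auto
    then show "rep A \<in> Units R" using notin_I_Units rep A by simp
  qed
  have Qadd: "Q Y (A \<oplus>\<^bsub>F\<^esub> B) = Q Y A \<oplus>\<^bsub>F\<^esub> Q Y B"
    if Y: "Y \<in> carrier F" and A1: "A \<in> carrier F" and B1: "B \<in> carrier F"
      and A2: "A \<noteq> \<zero>\<^bsub>F\<^esub>" and B2: "B \<noteq> \<zero>\<^bsub>F\<^esub>" and AB: "A \<oplus>\<^bsub>F\<^esub> B \<noteq> \<zero>\<^bsub>F\<^esub>" for Y A B
  proof -
    obtain y a b where yab: "y \<in> carrier R" "cls y = Y" "a \<in> Units R" "cls a = A" "b \<in> Units R" "cls b = B"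
      using cls_surj[OF Y] unit[OF A1 A2] unit[OF B1 B2] by blast
    have abc: "a \<in> carrier R" "b \<in> carrier R" using yab by auto
    have ab: "cls (a \<oplus> b) = A \<oplus>\<^bsub>F\<^esub> B" using yab abc by simp
    then have "a \<oplus> b \<notin> I" using cls_eq_zero_iff[of "a \<oplus> b"] AB abc by auto
    then have u: "a \<oplus> b \<in> Units R" using notin_I_Units abc by simp
    note rq = residue_quotients[OF f(1) yab(1)]
    have "cls (inv (f y \<ominus> f (y \<ominus> inv (a \<oplus> b)))) =
        cls (inv (f y \<ominus> f (y \<ominus> inv a)) \<oplus> inv (f y \<ominus> f (y \<ominus> inv b)))"
      using rq(2)[OF yab(3,5) u] rq(1)[OF yab(3)] rq(1)[OF yab(5)] rq(1)[OF u] by (subst cls_eq_iff) auto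
    then have "Q (cls y) (cls (a \<oplus> b)) = Q (cls y) (cls a) \<oplus>\<^bsub>F\<^esub> Q (cls y) (cls b)"
      unfolding Q[OF yab(1) u] Q[OF yab(1,3)] Q[OF yab(1,5)]
      using rq(1)[OF yab(3)] rq(1)[OF yab(5)] by simp
    then show ?thesis unfolding ab yab(2,4,6) .
  qed
  have Qminus: "Q Y (\<ominus>\<^bsub>F\<^esub> A) = \<ominus>\<^bsub>F\<^esub> Q Y A"
    if Y: "Y \<in> carrier F" and A: "A \<in> carrier F" "A \<noteq> \<zero>\<^bsub>F\<^esub>" for Y A
  proof -
    obtain y a where ya: "y \<in> carrier R" "cls y = Y" "a \<in> Units R" "cls a = A"
      using cls_surj[OF Y] unit[OF A] by blast
    have u: "\<ominus> a \<in> Units R" using ya(3) by (rule Units_uminus)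
    note rq = residue_quotients[OF f(1) ya(1)]
    define s t where "s = inv (f y \<ominus> f (y \<ominus> inv (\<ominus> a)))" "t = inv (f y \<ominus> f (y \<ominus> inv a))"
    have st: "s \<in> carrier R" "t \<in> carrier R" "s \<oplus> t \<in> I"
      unfolding s_t_def using rq(3)[OF ya(3)] rq(1)[OF ya(3)] rq(1)[OF u] by auto
    have "cls s = cls (\<ominus> t)" using st by (subst cls_eq_iff) (auto simp: minus_eq)
    moreover have "\<ominus>\<^bsub>F\<^esub> A = cls (\<ominus> a)" using ya by auto
    ultimately show ?thesis
      unfolding ya(2,4)[symmetric] using Q[OF ya(1) u] Q[OF ya(1,3)] st ya by (simp add: s_t_def)
  qed
  have g01: "g \<zero>\<^bsub>F\<^esub> = \<zero>\<^bsub>F\<^esub>" "g \<one>\<^bsub>F\<^esub> = \<one>\<^bsub>F\<^esub>"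
    using g[of \<zero>] g[of \<one>] f by auto
  have "g (cls x \<oplus>\<^bsub>F\<^esub> cls y) = g (cls x) \<oplus>\<^bsub>F\<^esub> g (cls y)"
    by (rule F.hua(1)[where g = g and P = Q]; fact F.minus_one_distinct(3) gc inj g01 Q_def Qadd Qminus cls_closed[OF x] cls_closed[OF y])
  moreover have "g (cls x \<otimes>\<^bsub>F\<^esub> cls y) = g (cls x) \<otimes>\<^bsub>F\<^esub> g (cls y)"
    by (rule F.hua(2)[where g = g and P = Q]; fact F.minus_one_distinct(3) gc inj g01 Q_def Qadd Qminus cls_closed[OF x] cls_closed[OF y])
  ultimately show "cls (f (x \<oplus> y)) = cls (f x) \<oplus>\<^bsub>F\<^esub> cls (f y)" "cls (f (x \<otimes> y)) = cls (f x) \<otimes>\<^bsub>F\<^esub> cls (f y)"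
    using g[of "x \<oplus> y"] g[of "x \<otimes> y"] g[OF x] g[OF y] x y by simp_all
qed

text \<open>Induction on layers. If f x = x + \<pi>^j E x, the factor from K in f y - f x = (y - x)
  k is 1 + \<pi>^j t with t the difference quotient of E, so t is in \<open>H\<close> whatever the
  layer. Once E is known to factor through residues, it vanishes there and f agrees with the
  identity one layer further.\<close>

lemma rigid:
  assumes f: "cyc_map f" "f \<zero> = \<zero>" "f \<one> = \<one>" and id: "\<And>x. x \<in> carrier R \<Longrightarrow> f x \<ominus> x \<in> I"
    and x: "x \<in> carrier R"
  shows "f x = x"
proof -
  interpret F: odd_finite_field F p r "p ^ r" by (rule odd_finite_field_F)
  have fc: "f x \<in> carrier R" if "x \<in> carrier R" for x using cyc_map_closed[OF f(1) that] .
  have "j < d \<Longrightarrow> \<forall>x\<in>carrier R. \<exists>e\<in>carrier R. f x = x \<oplus> \<pi> [^] Suc j \<otimes> e" for j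
  proof (induction j)
    case 0
    show ?case
    proof
      fix x assume x: "x \<in> carrier R"
      obtain e where e: "e \<in> carrier R" "f x \<ominus> x = \<pi> \<otimes> e" using id[OF x] unfolding I_iff by blast
      have "f x = x \<oplus> (f x \<ominus> x)" using fc[OF x] x by (simp add: add_minus_cancel)
      then show "\<exists>e\<in>carrier R. f x = x \<oplus> \<pi> [^] Suc 0 \<otimes> e" using e by auto
    qed
  next
    case (Suc i)
    define j where "j = Suc i"
    have j: "1 \<le> j" "j < d" using Suc.prems by (auto simp: j_def)
    obtain E where E: "\<And>x. x \<in> carrier R \<Longrightarrow> E x \<in> carrier R" "\<And>x. x \<in> carrier R \<Longrightarrow> f x = x \<oplus> \<pi> [^] j \<otimes> E x"
      using Suc.IH Suc.prems bchoice[of "carrier R" "\<lambda>x e. e \<in> carrier R \<and> f x = x \<oplus> \<pi> [^] j \<otimes> e"]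
      unfolding j_def by (metis Suc_lessD)
    have quot: "(E y \<ominus> E x) \<otimes> inv (y \<ominus> x) \<in> H"
      if x: "x \<in> carrier R" and y: "y \<in> carrier R" and u: "y \<ominus> x \<in> Units R" for x y
    proof -
      obtain k where k: "k \<in> K" "f y \<ominus> f x = (y \<ominus> x) \<otimes> k" using cyc_mapE[OF f(1) x y] .
      define t where "t = (E y \<ominus> E x) \<otimes> inv (y \<ominus> x)"
      define c where "c = \<pi> [^] j"
      define B where "B = y \<ominus> x"
      have cl: "t \<in> carrier R" "c \<in> carrier R" "B \<in> carrier R" using E x y u by (auto simp: t_def c_def B_def)
      have Bt: "B \<otimes> t = E y \<ominus> E x"
      proof -
        have "B \<otimes> t = t \<otimes> B" by (rule m_comm[OF cl(3,1)])
        also have "\<dots> = (E y \<ominus> E x) \<otimes> (inv B \<otimes> B)"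
          unfolding t_def B_def[symmetric] using E x y cl(3) u by (intro m_assoc) (auto simp: B_def)
        finally show ?thesis using u E x y by (simp add: B_def)
      qed
      have "B \<otimes> k = f y \<ominus> f x" using k by (simp add: B_def)
      also have "\<dots> = (y \<oplus> c \<otimes> E y) \<ominus> (x \<oplus> c \<otimes> E x)" using E x y by (simp add: c_def)
      also have "\<dots> = B \<oplus> c \<otimes> (E y \<ominus> E x)"
      proof (rule diff_zeroI)
        have "(y \<oplus> c \<otimes> v) \<ominus> (x \<oplus> c \<otimes> w) \<ominus> ((y \<ominus> x) \<oplus> c \<otimes> (v \<ominus> w)) = \<zero>"
          if "v \<in> carrier R" "w \<in> carrier R" for v w using x y cl(2) that by algebra
        then show "(y \<oplus> c \<otimes> E y) \<ominus> (x \<oplus> c \<otimes> E x) \<ominus> (B \<oplus> c \<otimes> (E y \<ominus> E x)) = \<zero>"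
          using E x y by (simp add: B_def)
      qed (use E x y cl in auto)
      also have "\<dots> = B \<otimes> (\<one> \<oplus> c \<otimes> t)" unfolding Bt[symmetric] using cl by (simp add: r_distr m_lcomm)
      finally have "k = \<one> \<oplus> c \<otimes> t" using Units_l_cancel[of B] u k cl by (simp add: B_def)
      then have "\<one> \<oplus> \<pi> [^] j \<otimes> t \<in> K" using k by (simp add: c_def)
      then show ?thesis using layer_in_H[OF cl(1) j] by (simp add: t_def)
    qed
    \<comment> \<open>For a unit v the auxiliary point y = x - 1/v makes v (E x - E y) a difference
      quotient, hence in \<open>H\<close>. As x' - y is congruent to 1/v, also v (E x' - E y) is in
      \<open>H\<close>, and the difference is the required multiple.\<close>
    have E_cong: "E x \<ominus> E x' \<in> I"
      if x: "x \<in> carrier R" and x': "x' \<in> carrier R" and xx: "x \<ominus> x' \<in> I" for x x'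
    proof (rule all_multiples_in_H[OF proper])
      show "E x \<ominus> E x' \<in> carrier R" using E x x' by simp
      fix v assume v: "v \<in> carrier R"
      show "\<exists>i\<in>H. v \<otimes> (E x \<ominus> E x') \<ominus> i \<in> I"
      proof (cases "v \<in> I")
        case True
        then have "v \<otimes> (E x \<ominus> E x') \<in> I" using E x x' by (intro I_rmult) auto
        then show ?thesis using I_subset_H[OF I_zero] by (intro bexI[of _ \<zero>]) (auto simp: minus_eq)
      next
        case False
        then have vu: "v \<in> Units R" using notin_I_Units v by blast
        define y where "y = x \<ominus> inv v"
        have y: "y \<in> carrier R" using x vu by (simp add: y_def)
        have "x \<ominus> (x \<ominus> t) \<ominus> t = \<zero>" if "t \<in> carrier R" for t using x that by algebra
        then have xy: "x \<ominus> y = inv v" using x vu by (simp add: y_def)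
        define s where "s = x' \<ominus> y"
        have s: "s \<in> carrier R" using x' y by (simp add: s_def)
        have "cls x' = cls x" using xx x x' cls_eq_iff by metis
        then have cs: "cls s = cls (inv v)" using x x' y by (simp add: s_def flip: xy)
        then have sI: "s \<notin> I" using cls_eq_zero_iff[OF s] cls_eq_zero_iff[of "inv v"] Units_notin_I[OF Units_inv_Units[OF vu]] vu by simp
        then have su: "s \<in> Units R" using notin_I_Units s by blast
        have "cls (inv s) = inv\<^bsub>F\<^esub> (cls (inv v))" using su cs by simp
        also have "\<dots> = cls (inv (inv v))" using vu by (intro cls_inv[symmetric]) auto
        also have "\<dots> = cls v" using vu by simp
        finally have "inv s \<ominus> v \<in> I" using cls_eq_iff[of "inv s" v] su v by simp
        then have sv: "(E x' \<ominus> E y) \<otimes> (inv s \<ominus> v) \<in> H" using E x' y by (intro I_subset_H I_lmult) auto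
        have 1: "(E x \<ominus> E y) \<otimes> v \<in> H" using quot[OF y x] xy vu by simp
        have 2: "(E x' \<ominus> E y) \<otimes> inv s \<in> H" using quot[OF y x'] su by (simp add: s_def)
        have mem: "(E x \<ominus> E y) \<otimes> v \<ominus> ((E x' \<ominus> E y) \<otimes> inv s \<ominus> (E x' \<ominus> E y) \<otimes> (inv s \<ominus> v)) \<in> H"
          by (rule H_diff[OF 1 H_diff[OF 2 sv]])
        have "v \<otimes> (a \<ominus> b) \<ominus> ((a \<ominus> e) \<otimes> v \<ominus> ((b \<ominus> e) \<otimes> t \<ominus> (b \<ominus> e) \<otimes> (t \<ominus> v))) = \<zero>"
          if "a \<in> carrier R" "b \<in> carrier R" "e \<in> carrier R" "t \<in> carrier R" for a b e t
          using v that by algebra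
        from this[OF E(1)[OF x] E(1)[OF x'] E(1)[OF y] Units_inv_closed[OF su]]
        show ?thesis using mem I_zero by (metis (no_types, lifting))
      qed
    qed
    \<comment> \<open>Fixed points of f have error 0 modulo p; at 0 and 1 this gives the
      normalisation that excludes nonzero affine errors.\<close>
    have Ezero: "E c \<in> I" if c: "c \<in> carrier R" "f c = c" for c
    proof -
      have "c \<oplus> \<pi> [^] j \<otimes> E c = c" using E(2)[OF c(1)] c(2) by simp
      then have "\<pi> [^] j \<otimes> E c = \<zero>" using c(1) E(1)[OF c(1)] by (simp add: add.r_cancel_one')
      then show ?thesis using pi_power_annihilator[OF j(2) E(1)[OF c(1)]] by simp
    qed
    define rep where "rep C = (SOME x. x \<in> carrier R \<and> cls x = C)" for C
    have rep: "rep C \<in> carrier R" "cls (rep C) = C" if "C \<in> carrier F" for C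
      using someI_ex[of "\<lambda>x. x \<in> carrier R \<and> cls x = C"] cls_surj[OF that] unfolding rep_def by blast+
    define g where "g C = cls (E (rep C))" for C
    have g: "g (cls x) = cls (E x)" if x: "x \<in> carrier R" for x
    proof -
      have "rep (cls x) \<ominus> x \<in> I" using rep[of "cls x"] x cls_eq_iff[of "rep (cls x)" x] by simp
      then show ?thesis unfolding g_def using E_cong[of "rep (cls x)" x] E x rep[of "cls x"] cls_eq_iff[of "E (rep (cls x))" "E x"] by simp
    qed
    have all: "g C = \<zero>\<^bsub>F\<^esub>" if C: "C \<in> carrier F" for C
    proof (rule F.additive_difference_quotients[OF additive_subgroup_image_H image_H_proper[OF proper] _ _ _ _ C])
      show "g \<in> carrier F \<rightarrow> carrier F" unfolding g_def using E rep by simp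
      show "g \<zero>\<^bsub>F\<^esub> = \<zero>\<^bsub>F\<^esub>" using g[of \<zero>] Ezero[of \<zero>] f E cls_eq_zero_iff[of "E \<zero>"] by simp
      show "g \<one>\<^bsub>F\<^esub> = \<zero>\<^bsub>F\<^esub>" using g[of \<one>] Ezero[of \<one>] f E cls_eq_zero_iff[of "E \<one>"] by simp
      fix A B assume AB: "A \<in> carrier F" "B \<in> carrier F" "A \<noteq> B"
      define x y where "x = rep A" "y = rep B"
      have xy: "x \<in> carrier R" "y \<in> carrier R" "cls x = A" "cls y = B" using rep AB by (auto simp: x_y_def)
      have "y \<ominus> x \<notin> I" using cls_eq_iff[OF xy(2,1)] xy AB by auto
      then have u: "y \<ominus> x \<in> Units R" using notin_I_Units xy by simp
      have "(g B \<ominus>\<^bsub>F\<^esub> g A) \<otimes>\<^bsub>F\<^esub> inv\<^bsub>F\<^esub> (B \<ominus>\<^bsub>F\<^esub> A) = (cls (E y) \<ominus>\<^bsub>F\<^esub> cls (E x)) \<otimes>\<^bsub>F\<^esub> inv\<^bsub>F\<^esub> (cls (y \<ominus> x))"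
        using xy unfolding g_def x_y_def[symmetric] by simp
      also have "\<dots> = cls ((E y \<ominus> E x) \<otimes> inv (y \<ominus> x))"
        unfolding cls_inv[OF u, symmetric] using E xy Units_inv_closed[OF u] by (simp del: cls_inv)
      finally show "(g B \<ominus>\<^bsub>F\<^esub> g A) \<otimes>\<^bsub>F\<^esub> inv\<^bsub>F\<^esub> (B \<ominus>\<^bsub>F\<^esub> A) \<in> cls ` H"
        using quot[OF xy(1,2) u] by simp
    qed
    show ?case
    proof
      fix x assume x: "x \<in> carrier R"
      have "E x \<in> I" using all[of "cls x"] g[OF x] cls_eq_zero_iff[of "E x"] E x by simp
      then obtain e where "e \<in> carrier R" "\<pi> [^] j \<otimes> E x = \<pi> [^] Suc j \<otimes> e" using pi_power_mult_I by blast
      then show "\<exists>e\<in>carrier R. f x = x \<oplus> \<pi> [^] Suc (Suc i) \<otimes> e" using E(2)[OF x] unfolding j_def by auto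
    qed
  qed
  from this[of "d - 1"] obtain e where "e \<in> carrier R" "f x = x \<oplus> \<pi> [^] d \<otimes> e" using x d_pos by auto
  then show ?thesis using x by (simp add: pi_power_d)
qed

end

end

section \<open>Normalised automorphisms are ring homomorphisms\<close>

context odd_galois_ring_unit_subgroup begin

context
  assumes proper: "H \<noteq> carrier R"
begin

context
  fixes f assumes f: "cyc_map f" "f \<zero> = \<zero>" "f \<one> = \<one>"
begin

lemma normalized_inverse:
  defines "g \<equiv> inv_into (carrier R) f"
  shows "cyc_map g" "g \<zero> = \<zero>" "g \<one> = \<one>"
    and "\<And>x. x \<in> carrier R \<Longrightarrow> f (g x) = x" "\<And>x. x \<in> carrier R \<Longrightarrow> g (f x) = x"
proof -
  have b: "inj_on f (carrier R)" "f ` carrier R = carrier R"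
    using cyc_map_bij[OF f(1)] by (auto simp: bij_betw_def)
  show "cyc_map g" unfolding g_def by (rule cyc_map_inv_into[OF f(1)])
  show gf: "g (f x) = x" if "x \<in> carrier R" for x unfolding g_def using b that by (simp add: inv_into_f_f)
  show "f (g x) = x" if "x \<in> carrier R" for x unfolding g_def using b that by (simp add: f_inv_into_f)
  show "g \<zero> = \<zero>" "g \<one> = \<one>" using gf[of \<zero>] gf[of \<one>] f by auto
qed

text \<open>Rigidity gives f (x + b) = a(b) f x + f b with a(b) in K. Commuting b with 1 shows a(b)
  = 1 + t f b for a constant t; a nonzero t would let a(b) run through the whole top layer,
  contradicting that \<open>H\<close> is proper.\<close>

lemma normalized_additive:
  assumes x: "x \<in> carrier R" and y: "y \<in> carrier R"
  shows "f (x \<oplus> y) = f x \<oplus> f y"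
proof -
  interpret F: field F by (rule field_F)
  define g where "g = inv_into (carrier R) f"
  note g = normalized_inverse[folded g_def]
  have fc: "f x \<in> carrier R" if "x \<in> carrier R" for x using cyc_map_closed[OF f(1) that] .
  have gc: "g x \<in> carrier R" if "x \<in> carrier R" for x using cyc_map_closed[OF g(1) that] .
  define a where "a b = f (\<one> \<oplus> b) \<ominus> f b" for b
  have aK: "a b \<in> K" if b: "b \<in> carrier R" for b
  proof -
    obtain k where k: "k \<in> K" "f (\<one> \<oplus> b) \<ominus> f b = (\<one> \<oplus> b \<ominus> b) \<otimes> k"
      using cyc_mapE[OF f(1) b, of "\<one> \<oplus> b"] b by auto
    have "\<one> \<oplus> b \<ominus> b = \<one>" using b by (simp add: minus_eq a_assoc r_neg)
    then show ?thesis using k by (simp add: a_def)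
  qed
  have shift: "f (x \<oplus> b) = a b \<otimes> f x \<oplus> f b" if b: "b \<in> carrier R" and x: "x \<in> carrier R" for b x
  proof -
    note ab = aK[OF b]
    have abu: "a b \<in> Units R" "a b \<in> carrier R" "inv (a b) \<in> carrier R" "inv (a b) \<otimes> a b = \<one>" "a b \<otimes> inv (a b) = \<one>"
      using K_Units[OF ab] by auto
    define \<phi> where "\<phi> z = inv (a b) \<otimes> f (\<one> \<otimes> g z \<oplus> b) \<oplus> \<ominus> (inv (a b) \<otimes> f b)" for z
    have \<phi>: "\<phi> z = inv (a b) \<otimes> (f (g z \<oplus> b) \<ominus> f b)" if "z \<in> carrier R" for z
      using fc gc b that abu by (simp add: \<phi>_def minus_eq r_distr r_minus)
    have "cyc_map (\<lambda>z. f (\<one> \<otimes> g z \<oplus> b))"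
      using cyc_map_comp[OF f(1) cyc_map_comp[OF cyc_map_affine[OF K_one b] g(1)]] .
    then have "cyc_map \<phi>"
      unfolding \<phi>_def using fc b abu by (intro cyc_map_comp[OF cyc_map_affine[OF K_inv[OF ab]]]) auto
    moreover have "\<phi> \<zero> = \<zero>" using \<phi>[of \<zero>] g b fc abu by (simp add: minus_eq r_neg)
    moreover have "\<phi> \<one> = \<one>" using \<phi>[of \<one>] g abu by (simp flip: a_def)
    \<comment> \<open>Modulo p the map f is additive, so numerator and denominator of \<phi> reduce
      to z and 1.\<close>
    moreover have "\<phi> z \<ominus> z \<in> I" if z: "z \<in> carrier R" for z
    proof -
      have "cls (a b) = \<one>\<^bsub>F\<^esub> \<oplus>\<^bsub>F\<^esub> cls (f b) \<ominus>\<^bsub>F\<^esub> cls (f b)"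
        using residue_automorphism(1)[OF proper f one_closed b] fc b f by (simp add: a_def)
      also have "\<dots> = \<one>\<^bsub>F\<^esub>" using fc[OF b] by (simp add: F.minus_eq F.a_assoc F.r_neg)
      finally have c1: "cls (inv (a b)) = \<one>\<^bsub>F\<^esub>" using abu by simp
      have "cls (f (g z \<oplus> b)) = cls z \<oplus>\<^bsub>F\<^esub> cls (f b)"
        using residue_automorphism(1)[OF proper f gc[OF z] b] g(4)[OF z] by simp
      then have "cls (f (g z \<oplus> b) \<ominus> f b) = cls z \<oplus>\<^bsub>F\<^esub> cls (f b) \<ominus>\<^bsub>F\<^esub> cls (f b)"
        using fc gc b z by simp
      also have "\<dots> = cls z" using fc[OF b] z by (simp add: F.minus_eq F.a_assoc F.r_neg)
      finally have "cls (\<phi> z) = cls z" unfolding \<phi>[OF z] using fc gc b z abu c1 by (simp del: cls_minus cls_inv)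
      moreover have "\<phi> z \<in> carrier R" unfolding \<phi>[OF z] using fc gc b z abu by simp
      ultimately show ?thesis using cls_eq_iff z by simp
    qed
    ultimately have "\<phi> (f x) = f x" using rigid[OF proper _ _ _ _ fc[OF x]] by blast
    then have "inv (a b) \<otimes> (f (x \<oplus> b) \<ominus> f b) = f x" using \<phi>[OF fc[OF x]] g(5)[OF x] by simp
    then have "a b \<otimes> f x = a b \<otimes> (inv (a b) \<otimes> (f (x \<oplus> b) \<ominus> f b))" by simp
    also have "\<dots> = (a b \<otimes> inv (a b)) \<otimes> (f (x \<oplus> b) \<ominus> f b)"
      using abu(2,3) fc b x by (intro m_assoc[symmetric]) auto
    also have "\<dots> = f (x \<oplus> b) \<ominus> f b" using abu fc b x by simp
    finally show ?thesis using fc b x by (simp add: minus_eq a_assoc l_neg)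
  qed
  define t where "t = a \<one> \<ominus> \<one>"
  have tc: "t \<in> carrier R" using aK[of \<one>] by (simp add: t_def)
  have ab: "a b = \<one> \<oplus> t \<otimes> f b" if b: "b \<in> carrier R" for b
  proof -
    have "a b \<oplus> f b = f (\<one> \<oplus> b)" using shift[OF b one_closed] f(3) aK[OF b] by simp
    also have "\<dots> = f (b \<oplus> \<one>)" using b by (simp add: a_comm)
    also have "\<dots> = a \<one> \<otimes> f b \<oplus> \<one>" using shift[OF one_closed b] f(3) by simp
    finally have "a b \<oplus> f b \<ominus> f b = a \<one> \<otimes> f b \<oplus> \<one> \<ominus> f b" by simp
    moreover have "u \<oplus> v \<ominus> v \<ominus> u = \<zero>" if "u \<in> carrier R" "v \<in> carrier R" for u v using that by algebra
    then have "a b \<oplus> f b \<ominus> f b = a b" using fc[OF b] aK[OF b] by simp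
    moreover have "w \<otimes> v \<oplus> \<one> \<ominus> v \<ominus> (\<one> \<oplus> (w \<ominus> \<one>) \<otimes> v) = \<zero>" if "w \<in> carrier R" "v \<in> carrier R" for w v
      using that by algebra
    then have "a \<one> \<otimes> f b \<oplus> \<one> \<ominus> f b = \<one> \<oplus> t \<otimes> f b" using fc[OF b] aK[of \<one>] by (simp add: t_def)
    ultimately show ?thesis by simp
  qed
  have "t = \<zero>"
  proof (rule ccontr)
    assume "t \<noteq> \<zero>"
    then obtain i u where iu: "i < d" "u \<in> Units R" "t = \<pi> [^] i \<otimes> u" using valuation[OF tc] by blast
    have "z \<in> H" if z: "z \<in> carrier R" for z
    proof -
      \<comment> \<open>Chosen so that t v = P z. As f is onto, v = f b for b = \<open>g v\<close>,
        and a(b) becomes 1 + P z.\<close>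
      define v where "v = inv u \<otimes> (\<pi> [^] (d - 1 - i) \<otimes> z)"
      have v: "v \<in> carrier R" using iu z by (simp add: v_def)
      have "t \<otimes> v = (\<pi> [^] i \<otimes> \<pi> [^] (d - 1 - i)) \<otimes> z \<otimes> (u \<otimes> inv u)"
        unfolding iu(3) v_def using iu(2) z Units_inv_closed[OF iu(2)] Units_closed[OF iu(2)] by (simp add: m_ac del: Units_r_inv)
      also have "\<dots> = P \<otimes> z" using iu(1,2) z by (simp add: nat_pow_mult P_def)
      finally have "\<one> \<oplus> P \<otimes> z = a (g v)" using ab[OF gc[OF v]] g(4)[OF v] by simp
      then show ?thesis using aK[OF gc[OF v]] z by (simp add: H_def)
    qed
    then show False using proper H_closed by blast
  qed
  then have "a y = \<one>" using ab[OF y] fc[OF y] by simp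
  then show ?thesis using shift[OF y x] fc[OF x] by simp
qed

text \<open>Since t is in K and f fixes 0, also f t is in K; multiplying by t before f and dividing
  by f t afterwards therefore stays among the automorphisms.\<close>

lemma normalized_mult_K:
  assumes t: "t \<in> K" and x: "x \<in> carrier R"
  shows "f (t \<otimes> x) = f t \<otimes> f x"
proof -
  interpret F: field F by (rule field_F)
  define g where "g = inv_into (carrier R) f"
  note g = normalized_inverse[folded g_def]
  have fc: "f x \<in> carrier R" if "x \<in> carrier R" for x using cyc_map_closed[OF f(1) that] .
  have gc: "g x \<in> carrier R" if "x \<in> carrier R" for x using cyc_map_closed[OF g(1) that] .
  have tc: "t \<in> carrier R" using t by simp
  obtain k where k: "k \<in> K" "f t \<ominus> f \<zero> = (t \<ominus> \<zero>) \<otimes> k" using cyc_mapE[OF f(1) zero_closed tc] .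
  have ft: "f t \<in> K" using k K_mult[OF t k(1)] f(2) fc[OF tc] tc by (simp add: minus_eq)
  have u: "f t \<in> Units R" "f t \<in> carrier R" "inv (f t) \<in> carrier R" using K_Units[OF ft] by auto
  define \<phi> where "\<phi> z = inv (f t) \<otimes> f (t \<otimes> g z \<oplus> \<zero>) \<oplus> \<zero>" for z
  have \<phi>: "\<phi> z = inv (f t) \<otimes> f (t \<otimes> g z)" if "z \<in> carrier R" for z
    using fc gc that u tc by (simp add: \<phi>_def)
  have "cyc_map (\<lambda>z. f (t \<otimes> g z \<oplus> \<zero>))"
    using cyc_map_comp[OF f(1) cyc_map_comp[OF cyc_map_affine[OF t zero_closed] g(1)]] .
  then have "cyc_map \<phi>"
    unfolding \<phi>_def by (intro cyc_map_comp[OF cyc_map_affine[OF K_inv[OF ft]]]) auto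
  moreover have "\<phi> \<zero> = \<zero>" using \<phi>[of \<zero>] g f tc u by simp
  moreover have "\<phi> \<one> = \<one>" using \<phi>[of \<one>] g tc u by simp
  moreover have "\<phi> z \<ominus> z \<in> I" if z: "z \<in> carrier R" for z
  proof -
    have "cls (f (t \<otimes> g z)) = cls (f t) \<otimes>\<^bsub>F\<^esub> cls z"
      using residue_automorphism(2)[OF proper f tc gc[OF z]] g(4)[OF z] by simp
    also have "\<dots> = cls (f t \<otimes> z)" using u z by simp
    finally have "cls (\<phi> z) = cls (inv (f t)) \<otimes>\<^bsub>F\<^esub> cls (f t \<otimes> z)"
      unfolding \<phi>[OF z] using u z tc fc gc by (simp del: cls_inv)
    also have "\<dots> = cls (inv (f t) \<otimes> (f t \<otimes> z))" using u z by (simp del: cls_inv)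
    also have "inv (f t) \<otimes> (f t \<otimes> z) = z" using u z by (simp add: m_assoc[symmetric])
    finally have "cls (\<phi> z) = cls z" .
    moreover have "\<phi> z \<in> carrier R" unfolding \<phi>[OF z] using fc gc z tc u by simp
    ultimately show ?thesis using cls_eq_iff z by simp
  qed
  ultimately have "\<phi> (f x) = f x" using rigid[OF proper _ _ _ _ fc[OF x]] by blast
  then have "inv (f t) \<otimes> f (t \<otimes> x) = f x" using \<phi>[OF fc[OF x]] g(5)[OF x] by simp
  then have "f t \<otimes> f x = f t \<otimes> (inv (f t) \<otimes> f (t \<otimes> x))" by simp
  also have "\<dots> = (f t \<otimes> inv (f t)) \<otimes> f (t \<otimes> x)" using u fc tc x by (intro m_assoc[symmetric]) auto
  also have "\<dots> = f (t \<otimes> x)" using u fc tc x by simp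
  finally show ?thesis by simp
qed

text \<open>The elements y with f (y x) = f y f x for all x are closed under sums, by additivity of
  f, and under products. They contain \<pi> and a representative of every residue, so \<pi>-adic
  expansion up to \<pi>^d = 0 reaches the whole ring.\<close>

lemma normalized_ring_hom:
  assumes teich: "\<And>u. u \<in> Units R \<Longrightarrow> u [^] (p ^ r - 1) = \<one> \<Longrightarrow> u \<in> K"
  shows "f \<in> ring_hom R R"
proof -
  interpret F: odd_finite_field F p r "p ^ r" by (rule odd_finite_field_F)
  have fc: "f x \<in> carrier R" if "x \<in> carrier R" for x using cyc_map_closed[OF f(1) that] .
  define Y where "Y = {y \<in> carrier R. \<forall>x\<in>carrier R. f (y \<otimes> x) = f y \<otimes> f x}"
  have Yc: "y \<in> carrier R" if "y \<in> Y" for y using that by (simp add: Y_def)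
  have YK: "k \<in> Y" if "k \<in> K" for k unfolding Y_def using normalized_mult_K[OF that] that by simp
  have Y0: "\<zero> \<in> Y" unfolding Y_def using f fc by simp
  have Yadd: "y \<oplus> z \<in> Y" if "y \<in> Y" "z \<in> Y" for y z
    using that fc unfolding Y_def by (simp add: l_distr normalized_additive)
  have Ymult: "y \<otimes> z \<in> Y" if "y \<in> Y" "z \<in> Y" for y z
    using that fc unfolding Y_def by (simp add: m_assoc)
  have Y1: "\<one> \<in> Y" using YK K_one by simp
  have "add_pow R n \<one> \<in> Y" for n :: nat by (induction n) (simp_all add: Y0 Y1 Yadd)
  then have "\<pi> \<in> Y" by (simp add: \<pi>_def)
  then have Ypi: "\<pi> [^] n \<in> Y" for n :: nat by (induction n) (simp_all add: Y1 Ymult)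
  have lift: "\<exists>t\<in>Y. x \<ominus> t \<in> I" if x: "x \<in> carrier R" for x
  proof (cases "x \<in> I")
    case True
    then show ?thesis using x Y0 by (intro bexI[of _ \<zero>]) (auto simp: minus_eq)
  next
    case False
    then have u: "x \<in> Units R" using notin_I_Units x by blast
    \<comment> \<open>The Teichmueller unit over x: x^(q-1) is 1 modulo p, so its p^(r d)-th power
      is 1 modulo \<pi>^(1 + r d) = 0, while q-th powers do not change residues.\<close>
    define t where "t = x [^] (p ^ (r * d))"
    have t: "t \<in> carrier R" using x by (simp add: t_def)
    have ct: "cls t = cls x"
    proof -
      have "cls x [^]\<^bsub>F\<^esub> (p ^ (r * n)) = cls x" for n
      proof (induction n)
        case (Suc n)
        have "cls x [^]\<^bsub>F\<^esub> (p ^ (r * Suc n)) = (cls x [^]\<^bsub>F\<^esub> (p ^ (r * n))) [^]\<^bsub>F\<^esub> (p ^ r)"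
          using x by (simp add: F.nat_pow_pow power_add mult.commute)
        then show ?case using Suc F.pow_q[of "cls x"] x by simp
      qed (use x in simp)
      then show ?thesis using x by (simp add: t_def)
    qed
    have "cls (x [^] (p ^ r - 1)) = \<one>\<^bsub>F\<^esub>"
    proof -
      have cx: "cls x \<in> carrier F" "cls x \<noteq> \<zero>\<^bsub>F\<^esub>" using x False cls_eq_zero_iff[OF x] by auto
      have "cls x [^]\<^bsub>F\<^esub> (p ^ r - 1) \<otimes>\<^bsub>F\<^esub> cls x = cls x [^]\<^bsub>F\<^esub> (p ^ r)"
        using F.q_gt_1 cx by (cases "p ^ r") simp_all
      also have "\<dots> = \<one>\<^bsub>F\<^esub> \<otimes>\<^bsub>F\<^esub> cls x" using F.pow_q cx by simp
      finally show ?thesis using F.m_rcancel[of "cls x" "cls x [^]\<^bsub>F\<^esub> (p ^ r - 1)" "\<one>\<^bsub>F\<^esub>"] cx x by simp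
    qed
    then have "cls (x [^] (p ^ r - 1)) = cls \<one>" by simp
    then have "x [^] (p ^ r - 1) \<ominus> \<one> \<in> I" using cls_eq_iff[of "x [^] (p ^ r - 1)" \<one>] x by simp
    then obtain e where e: "e \<in> carrier R" "x [^] (p ^ r - 1) \<ominus> \<one> = \<pi> \<otimes> e" unfolding I_iff by blast
    have "x [^] (p ^ r - 1) = \<one> \<oplus> (x [^] (p ^ r - 1) \<ominus> \<one>)" using x by (simp add: add_minus_cancel)
    then have xe: "x [^] (p ^ r - 1) = \<one> \<oplus> \<pi> [^] (1::nat) \<otimes> e" using e by simp
    obtain w where w: "w \<in> carrier R"
      "(\<one> \<oplus> \<pi> [^] (1::nat) \<otimes> e) [^] (p ^ (r * d)) = \<one> \<oplus> \<pi> [^] (1 + r * d) \<otimes> (e \<oplus> \<pi> \<otimes> w)"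
      using one_plus_pi_power[OF e(1), of 1 "r * d"] by auto
    have "d \<le> 1 + r * d" using r_pos by (cases r) auto
    then have "(x [^] (p ^ r - 1)) [^] (p ^ (r * d)) = \<one>"
      unfolding xe w(2) using w e pi_power_ge[of "1 + r * d"] by simp
    then have "t [^] (p ^ r - 1) = \<one>" unfolding t_def using x by (simp add: nat_pow_pow mult.commute)
    moreover have "t \<in> Units R"
      unfolding t_def using u by (rule Units_pow_closed)
    ultimately have "t \<in> K" by (rule teich[rotated])
    moreover have "x \<ominus> t \<in> I" using cls_eq_iff[OF x t] ct by simp
    ultimately show ?thesis using YK by blast
  qed
  have "\<forall>x\<in>carrier R. \<exists>y\<in>Y. \<exists>e\<in>carrier R. x = y \<oplus> \<pi> [^] n \<otimes> e" for n :: nat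
  proof (induction n)
    case 0
    show ?case
    proof
      fix x assume "x \<in> carrier R"
      then show "\<exists>y\<in>Y. \<exists>e\<in>carrier R. x = y \<oplus> \<pi> [^] (0::nat) \<otimes> e"
        by (intro bexI[of _ \<zero>] bexI[of _ x] Y0) auto
    qed
  next
    case (Suc n)
    show ?case
    proof
      fix x assume "x \<in> carrier R"
      then obtain y e where ye: "y \<in> Y" "e \<in> carrier R" "x = y \<oplus> \<pi> [^] n \<otimes> e" using Suc by blast
      obtain t where t: "t \<in> Y" "e \<ominus> t \<in> I" using lift[OF ye(2)] by blast
      obtain w where w: "w \<in> carrier R" "\<pi> [^] n \<otimes> (e \<ominus> t) = \<pi> [^] Suc n \<otimes> w" using pi_power_mult_I[OF t(2)] by blast
      have "e = t \<oplus> (e \<ominus> t)" using ye(2) Yc[OF t(1)] by (simp add: add_minus_cancel)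
      then have "\<pi> [^] n \<otimes> e = \<pi> [^] n \<otimes> t \<oplus> \<pi> [^] n \<otimes> (e \<ominus> t)"
        using ye(2) Yc[OF t(1)] by (metis minus_closed nat_pow_closed pi_closed r_distr)
      then have "x = (y \<oplus> \<pi> [^] n \<otimes> t) \<oplus> \<pi> [^] Suc n \<otimes> w"
        unfolding ye(3) w(2) using Yc[OF ye(1)] Yc[OF t(1)] w(1) by (simp add: a_assoc del: nat_pow_Suc)
      moreover have "y \<oplus> \<pi> [^] n \<otimes> t \<in> Y" using Yadd Ymult Ypi ye t by blast
      ultimately show "\<exists>y\<in>Y. \<exists>e\<in>carrier R. x = y \<oplus> \<pi> [^] Suc n \<otimes> e" using w(1) by blast
    qed
  qed
  from this[of d] have "x \<in> Y" if x: "x \<in> carrier R" for x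
  proof -
    assume "\<forall>x\<in>carrier R. \<exists>y\<in>Y. \<exists>e\<in>carrier R. x = y \<oplus> \<pi> [^] d \<otimes> e"
    then obtain y e where "y \<in> Y" "e \<in> carrier R" "x = y \<oplus> \<pi> [^] d \<otimes> e" using x by blast
    then show ?thesis using Yc by (simp add: pi_power_d)
  qed
  then show ?thesis
    using fc f normalized_additive by (intro ring_hom_memI) (auto simp: Y_def)
qed

end

end

end

section \<open>Cyclotomic schemes over a Galois ring\<close>

context odd_galois_ring begin

lemma scaled_ring_top: "scaled_ring R (add_pow R (p ^ (d - 1)) \<one>) = (\<lambda>x. \<pi> [^] (d - 1) \<otimes> x) ` carrier R"
  by (simp add: scaled_ring_def pi_power)

text \<open>Here p is 0 in R, so the maximal ideal is zero and R is its own residue field.\<close>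

lemma field_case:
  assumes d1: "d = 1"
  shows "odd_finite_field R p r (p ^ r)"
proof -
  have pi0: "\<pi> = \<zero>" using pi_power_d d1 by simp
  have I0: "I = {\<zero>}" unfolding set_eq_iff I_iff pi0 by auto
  have "maximalideal {\<zero>} R" using max_I I0 by simp
  then have fR: "field R" by (simp add: zeromaximalideal_eq_field)
  have inj: "inj_on cls (carrier R)"
    by (rule inj_onI) (simp add: cls_eq_iff I0)
  have "cls ` carrier R = carrier F" using cls_surj cls_closed by blast
  then have "card (carrier R) = p ^ r" using card_image[OF inj] card_res by simp
  then show ?thesis
    using fR finite_R prime_p odd pi0 unfolding \<pi>_def
    by (intro odd_finite_field.intro odd_finite_field_axioms.intro) auto
qed

end

context odd_galois_ring_unit_subgroup begin

lemma one_plus_P_pow: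
  assumes z: "z \<in> carrier R"
  shows "(\<one> \<oplus> P \<otimes> z) [^] (n::nat) = \<one> \<oplus> P \<otimes> add_pow R n z"
  by (induction n) (use z in \<open>simp_all add: one_plus_P_mult\<close>)

lemma proper_normal:
  assumes proper: "H \<noteq> carrier R"
  shows "cyc_normal R K"
proof -
  define m where "m = p ^ r - 1"
  \<comment> \<open>A larger group admits at least as many automorphisms, so it suffices to treat
    \<open>K'\<close>. It contains the Teichmueller units because their m-th power is 1.\<close>
  define K' where "K' = {u \<in> Units R. u [^] m \<in> K}"
  interpret U: group "units_of R" by (rule units_group)
  have KK: "k \<in> K'" if "k \<in> K" for k using that K_Units K_pow by (simp add: K'_def)
  have "subgroup K' (units_of R)"
  proof (rule U.subgroupI)
    show "K' \<subseteq> carrier (units_of R)" by (auto simp: K'_def units_of_carrier)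
    show "K' \<noteq> {}" using KK[OF K_one] by blast
    fix a assume a: "a \<in> K'"
    then have au: "a \<in> Units R" "a [^] m \<in> K" by (auto simp: K'_def)
    have "inv a [^] m = inv (a [^] m)"
    proof (rule comm_inv_char[symmetric])
      show "a [^] m \<otimes> inv a [^] m = \<one>" 
        using nat_pow_distrib[of a "inv a" m] Units_closed[OF au(1)] Units_inv_closed[OF au(1)] au(1) by simp
    qed (use au in auto)
    then show "inv\<^bsub>units_of R\<^esub> a \<in> K'" using au K_inv[OF au(2)] by (simp add: K'_def units_of_inv)
    fix b assume "b \<in> K'"
    then have bu: "b \<in> Units R" "b [^] m \<in> K" by (auto simp: K'_def)
    have "(a \<otimes> b) [^] m = a [^] m \<otimes> b [^] m"
      using Units_closed[OF au(1)] Units_closed[OF bu(1)] by (rule nat_pow_distrib)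
    then show "a \<otimes>\<^bsub>units_of R\<^esub> b \<in> K'"
      using au bu K_mult by (simp add: K'_def units_of_mult)
  qed
  then interpret E: odd_galois_ring_unit_subgroup R p d r K'
    using galois odd d_ge_2 is_cring
    by (intro odd_galois_ring_unit_subgroup.intro odd_galois_ring.intro odd_galois_ring_axioms.intro
        odd_galois_ring_unit_subgroup_axioms.intro)
  \<comment> \<open>The exponent m is -1 modulo p: (1 + P z)^m = 1 + P (m z), and m z + z = q z is
    divisible by p, hence in \<open>H\<close>. So m z in \<open>H\<close> forces z in
    \<open>H\<close>.\<close>
  have "E.H \<subseteq> H"
  proof
    fix z assume "z \<in> E.H"
    then have "z \<in> carrier R" "\<one> \<oplus> P \<otimes> z \<in> K'" unfolding E.H_def by simp_all
    then have z: "z \<in> carrier R" "(\<one> \<oplus> P \<otimes> z) [^] m \<in> K" by (simp_all add: K'_def)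
    then have mz: "add_pow R m z \<in> H" by (simp add: one_plus_P_pow H_def)
    have "p ^ r = Suc m" using p_gt_1 by (simp add: m_def)
    then have "add_pow R (p ^ r) z = add_pow R m z \<oplus> z" by simp
    moreover have "add_pow R (p ^ r) z = (add_pow R (p ^ r) \<one>) \<otimes> z" using z(1) by (rule add_pow_eq_mult)
    then have "add_pow R (p ^ r) z = \<pi> [^] r \<otimes> z" by (simp add: pi_power)
    moreover have "\<pi> [^] r \<otimes> z \<in> I"
    proof -
      obtain s where s: "r = Suc s" using r_pos by (cases r) auto
      have "\<pi> [^] r = \<pi> \<otimes> \<pi> [^] s" unfolding s by (simp add: m_comm)
      then show ?thesis using z(1) I_rmult[OF I_rmult[OF pi_in_I]] by simp
    qed
    ultimately have "add_pow R m z \<oplus> z \<in> H" using I_subset_H by simp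
    then have "(add_pow R m z \<oplus> z) \<ominus> add_pow R m z \<in> H" using mz by (rule H_diff)
    then show "z \<in> H" using z(1) by (simp add: add_minus_cancel)
  qed
  then have Eproper: "E.H \<noteq> carrier R" using proper H_closed by blast
  show ?thesis
  proof (rule cyc_normalI)
    fix f assume f: "cyc_map f" "f \<zero> = \<zero>" "f \<one> = \<one>"
    then have "E.cyc_map f" using KK unfolding cyc_map_def E.cyc_map_def by blast
    then show "f \<in> ring_hom R R"
      using E.normalized_ring_hom[OF Eproper _ f(2,3)] K_one by (auto simp: K'_def m_def)
  qed
qed

text \<open>Shifting the ideal by P alters only differences between a point of \<open>I\<close> and
  a point outside; these are units B and become B + P or B - P, that is, B times an element of 1 + P
  R inside K. An affine semilinear form would have intercept P and still fix 1 and -1, so 2 P = 0,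
  impossible for odd p.\<close>

lemma full_not_normal:
  assumes full: "H = carrier R"
  shows "\<not> cyc_normal R K"
proof
  assume normal: "cyc_normal R K"
  define f where "f x = (if x \<in> I then x \<oplus> P else x)" for x
  have fI: "f x \<in> I \<longleftrightarrow> x \<in> I" for x using I_add[OF _ P_in_I] by (auto simp: f_def)
  have fc: "f x \<in> carrier R" if "x \<in> carrier R" for x using that by (simp add: f_def)
  have inj: "inj_on f (carrier R)"
  proof (rule inj_onI)
    fix x y assume xy: "x \<in> carrier R" "y \<in> carrier R" "f x = f y"
    then have "x \<in> I \<longleftrightarrow> y \<in> I" using fI by metis
    then show "x = y" using xy by (auto simp: f_def split: if_splits)
  qed
  have bij: "bij_betw f (carrier R) (carrier R)"
    unfolding bij_betw_def
    using inj endo_inj_surj[OF finite_R image_subsetI inj, OF fc] by (rule conjI)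
  have unit: "\<exists>k\<in>K. B \<oplus> P \<otimes> s = B \<otimes> k" if B: "B \<in> Units R" and s: "s \<in> carrier R" for B s
  proof
    have Bc: "B \<in> carrier R" "inv B \<in> carrier R" "B \<otimes> inv B = \<one>" using B by auto
    have "B \<otimes> (\<one> \<oplus> P \<otimes> (s \<otimes> inv B)) = B \<oplus> P \<otimes> s \<otimes> (B \<otimes> inv B)"
      using Bc(1,2) s by (simp add: r_distr m_ac)
    then show "B \<oplus> P \<otimes> s = B \<otimes> (\<one> \<oplus> P \<otimes> (s \<otimes> inv B))" unfolding Bc(3) using s by simp
    have "s \<otimes> inv B \<in> H" using full s Bc by simp
    then show "\<one> \<oplus> P \<otimes> (s \<otimes> inv B) \<in> K" by (simp add: H_def)
  qed
  have "\<exists>k\<in>K. f y \<ominus> f x = (y \<ominus> x) \<otimes> k" if xy: "x \<in> carrier R" "y \<in> carrier R" for x y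
  proof -
    have nI: "y \<ominus> x \<in> Units R" if "x \<in> I \<longleftrightarrow> y \<notin> I"
    proof -
      have "y = (y \<ominus> x) \<oplus> x" "x = y \<ominus> (y \<ominus> x)"
      proof -
        have "(y \<ominus> x) \<oplus> x \<ominus> y = \<zero>" "y \<ominus> (y \<ominus> x) \<ominus> x = \<zero>" using xy by algebra+
        then show "y = (y \<ominus> x) \<oplus> x" "x = y \<ominus> (y \<ominus> x)" using xy by auto
      qed
      then have "y \<ominus> x \<notin> I" using that I_add I_diff by metis
      then show ?thesis using notin_I_Units xy by simp
    qed
    consider (same) "x \<in> I \<longleftrightarrow> y \<in> I" | (y) "x \<notin> I" "y \<in> I" | (x) "x \<in> I" "y \<notin> I" by blast
    then show ?thesis
    proof cases
      case same
      have "(y \<oplus> t) \<ominus> (x \<oplus> t) \<ominus> (y \<ominus> x) = \<zero>" if "t \<in> carrier R" for t using xy that by algebra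
      then have "(y \<oplus> P) \<ominus> (x \<oplus> P) = y \<ominus> x" using xy by simp
      then have "f y \<ominus> f x = (y \<ominus> x) \<otimes> \<one>" using same xy by (simp add: f_def)
      then show ?thesis using K_one by blast
    next
      case y
      have "f y \<ominus> f x = (y \<ominus> x) \<oplus> P \<otimes> \<one>" using y xy by (simp add: f_def minus_eq a_ac)
      then show ?thesis using unit[of "y \<ominus> x" \<one>] nI y by simp
    next
      case x
      have "f y \<ominus> f x = (y \<ominus> x) \<oplus> P \<otimes> (\<ominus> \<one>)" using x xy by (simp add: f_def minus_eq minus_add a_ac r_minus)
      then show ?thesis using unit[of "y \<ominus> x" "\<ominus> \<one>"] nI x by simp
    qed
  qed
  then have "f \<in> cyc_aut R K" using bij by (simp add: cyc_aut_iff cyc_map_def)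
  then have "f \<in> AGammaL1 R" using normal unfolding cyc_normal_def by (rule bspec[rotated])
  then have "\<exists>a\<in>Units R. \<exists>b\<in>carrier R. \<exists>s\<in>ring_iso R R. \<forall>x\<in>carrier R. f x = a \<otimes> s x \<oplus> b"
    unfolding AGammaL1_def by (rule CollectD)
  then obtain a b s where a: "a \<in> Units R" and b: "b \<in> carrier R" and s: "s \<in> ring_iso R R"
    and eqs: "\<forall>x\<in>carrier R. f x = a \<otimes> s x \<oplus> b"
    by (elim bexE)
  have eq: "f x = a \<otimes> s x \<oplus> b" if "x \<in> carrier R" for x using eqs that by (rule bspec)
  have ac: "a \<in> carrier R" using a by (rule Units_closed)
  have hom: "s \<in> ring_hom R R" using s by (simp add: ring_iso_def)
  have s0: "s \<zero> = \<zero>" using ring_hom_zero[OF hom ring_axioms ring_axioms] .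
  have s1: "s \<one> = \<one>" using ring_hom_one[OF hom] .
  have "s (\<ominus> \<one>) \<oplus> s \<one> = \<zero>" using ring_hom_add[OF hom, of "\<ominus> \<one>" \<one>] s0 by (simp add: l_neg)
  then have sm: "s (\<ominus> \<one>) = \<ominus> \<one>"
    using ring_hom_closed[OF hom, of "\<ominus> \<one>"] s1 minus_equality[of "s (\<ominus> \<one>)" \<one>] by simp
  have bP: "b = P" using eq[of \<zero>] s0 ac b by (simp add: f_def)
  have e1: "\<one> = a \<oplus> P" using eq[of \<one>] s1 ac bP one_notin_I by (simp add: f_def)
  have "\<ominus> \<one> \<notin> I" using one_notin_I I_minus[of "\<ominus> \<one>"] by auto
  then have e2: "\<ominus> \<one> = \<ominus> a \<oplus> P" using eq[of "\<ominus> \<one>"] sm ac bP by (simp add: f_def r_minus)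
  have "\<one> \<oplus> \<ominus> \<one> = (a \<oplus> P) \<oplus> (\<ominus> a \<oplus> P)" using e1 e2 by simp
  also have "\<dots> = P \<otimes> (\<one> \<oplus> \<one>)"
  proof -
    have "(a \<oplus> t) \<oplus> (\<ominus> a \<oplus> t) \<ominus> t \<otimes> (\<one> \<oplus> \<one>) = \<zero>" if "t \<in> carrier R" for t using ac that by algebra
    then show ?thesis using ac by simp
  qed
  finally have "P \<otimes> (\<one> \<oplus> \<one>) = \<zero>" by (simp add: r_neg)
  then have two: "\<one> \<oplus> \<one> \<in> I" by (intro P_annihilator) auto
  interpret F: odd_finite_field F p r "p ^ r" by (rule odd_finite_field_F)
  show False using two F.minus_one_distinct(3) cls_eq_zero_iff[of "\<one> \<oplus> \<one>"] by simp
qed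

end

theorem theorem1p7:
  fixes R :: "('a, 'b) ring_scheme" and K :: "'a set" and p d r :: nat
  assumes "galois_ring R p d r"
    and "p > 2"
    and "subgroup K (units_of R)"
  shows "cyc_normal R K \<longleftrightarrow>
           (d = 1 \<and> ((p, r) = (3, 1) \<or> K \<noteq> Units R))
         \<or> (d > 1 \<and> \<not> ((\<lambda>x. \<one>\<^bsub>R\<^esub> \<oplus>\<^bsub>R\<^esub> x) ` scaled_ring R (add_pow R (p ^ (d - 1)) \<one>\<^bsub>R\<^esub>) \<subseteq> K))"
proof -
  interpret cring R using assms(1) by (simp add: galois_ring_def)
  interpret odd_galois_ring R p d r
    using assms(1,2) by unfold_locales
  show ?thesis
  proof (cases "d = 1")
    case True
    interpret odd_finite_field_unit_subgroup R p r "p ^ r" K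
      using field_case[OF True] assms(3)
      by (intro odd_finite_field_unit_subgroup.intro odd_finite_field_unit_subgroup_axioms.intro)
    \<comment> \<open>Outside (3, 1) the field has an element other than 0, 1 and -1, as the swap of
      1 and -1 needs in order to be a counterexample.\<close>
    have "4 \<le> p ^ r" if "(p, r) \<noteq> (3, 1)"
    proof (cases "r = 1")
      case True
      then show ?thesis using that odd by simp
    next
      case False
      then have "2 \<le> r" using r_pos by simp
      then have "p ^ 2 \<le> p ^ r" using odd by (intro power_increasing) auto
      moreover have "(2::nat) ^ 2 \<le> p ^ 2" using odd by (intro power_mono) auto
      ultimately show ?thesis by simp
    qed
    then show ?thesis
      using True field_proper_normal field_three_normal field_full_not_normal by auto
  next
    case False
    then have d2: "2 \<le> d" using d_pos by simp
    interpret odd_galois_ring_unit_subgroup R p d r K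
      using odd_galois_ring_axioms assms(3) d2
      by (intro odd_galois_ring_unit_subgroup.intro odd_galois_ring_unit_subgroup_axioms.intro)
    have "(\<lambda>x. \<one>\<^bsub>R\<^esub> \<oplus>\<^bsub>R\<^esub> x) ` scaled_ring R (add_pow R (p ^ (d - 1)) \<one>\<^bsub>R\<^esub>) \<subseteq> K \<longleftrightarrow> H = carrier R"
      unfolding scaled_ring_top H_def P_def by auto
    then show ?thesis using False d2 proper_normal full_not_normal by auto
  qed
qed

end
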